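(* Let $\alpha\in(1,2)$ and suppose $T\ge T_2>T_1\ge M(\lambda_1)$, with $M(\lambda_1)$ as in the context. Let $u$ be the solution of the homogeneous diffusion-wave problem with initial data $u(0)=a$, $\partial_tu(0)=b$, let $g_1=u(T_1)$, $g_2=u(T_2)$, let $g_1^\delta,g_2^\delta\in L^2(\Omega)$ satisfy $\|g_1-g_1^\delta\|_{L^2(\Omega)}=\|g_2-g_2^\delta\|_{L^2(\Omega)}=\delta$, and for $\gamma>0$ let $\tilde u^\delta$ be the solution of the regularized problem $$\partial_t^\alpha\tilde u^\delta-\Delta\tilde u^\delta=0\ \text{in }\Omega\times(0,T],\quad \tilde u^\delta=0\ \text{on }\partial\Omega,\quad -\gamma\tilde u^\delta(0)+\tilde u^\delta(T_1)=g_1^\delta,\quad \gamma\partial_t\tilde u^\delta(0)+\tilde u^\delta(T_2)=g_2^\delta .$$ (i) If $a,b\in\dot H^q(\Omega)$ with $q\in[0,2]$, then $$\|(\tilde u^\delta-u)(0)\|_{L^2(\Omega)}+\|\partial_t(\tilde u^\delta-u)(0)\|_{L^2(\Omega)}\le c\big(\gamma^{q/2}+\delta\gamma^{-1}\big),$$ and for all $t\in(0,T]$ $$\|(\tilde u^\delta-u)(t)\|_{L^2(\Omega)}\le c\Big(\gamma\min\big(\gamma^{-(1-\frac q2)},t^{-\alpha(1-\frac q2)}\big)+\delta\min(\gamma^{-1},t^{-\alpha})\Big).$$ (ii) If $a,b\in L^2(\Omega)$, then for any $s\in(0,1]$ $$\|(\tilde u^\delta-u)(0)\|_{L^2(\Omega)}+\|\partial_t(\tilde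 u^\delta-u)(0)\|_{\dot H^{-s}(\Omega)}\to0\quad\text{as }\delta,\gamma\to0,\ \frac\delta\gamma\to0 .$$ Here the constant $c$ is independent of $\delta$, $\gamma$ and $t$ (it may depend on $\alpha,T_1,T_2,T,\Omega,q,a,b$).
   Context: $\Omega\subset\mathbb R^d$ ($d=1,2,3$) is a convex polyhedral domain and $T>0$. $\{(\lambda_j,\varphi_j)\}_{j\ge1}$ are the eigenvalues (nondecreasing) and $L^2(\Omega)$-orthonormal eigenfunctions of $-\Delta$ with homogeneous Dirichlet boundary condition; $\|v\|_{\dot H^q(\Omega)}^2=\sum_j\lambda_j^q(v,\varphi_j)^2$ for $q\ge-1$, and $\dot H^q(\Omega)$ is the corresponding Hilbert space. $\partial_t^\alpha$ is the Caputo derivative of order $\alpha\in(1,2)$: $\partial_t^\alpha u(t)=\frac1{\Gamma(2-\alpha)}\int_0^t(t-s)^{1-\alpha}u''(s)\,ds$. $E_{\alpha,\beta}(z)=\sum_{k\ge0}z^k/\Gamma(k\alpha+\beta)$. The homogeneous diffusion-wave problem is $\partial_t^\alpha u-\Delta u=0$ in $\Omega\times(0,T]$, $u=0$ on $\partial\Omega$, $u(0)=a$, $\partial_tu(0)=b$; its solution is $$u(t)=F(t)a+\bar F(t)b,\quad F(t)v=\sum_jE_{\alpha,1}(-\lambda_jt^\alpha)(v,\varphi_j)\varphi_j,\quad \bar F(t)v=\sum_jtE_{\alpha,2}(-\lambda_jt^\alpha)(v,\varphi_j)\varphi_j.$$ Likewise $\tilde u^\delta(t)=F(t)\tilde u^\delta(0)+\bar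 F(t)\partial_t\tilde u^\delta(0)$, where the pair $(\tilde u^\delta(0),\partial_t\tilde u^\delta(0))\in L^2(\Omega)^2$ is determined by the two conditions at $T_1,T_2$. Define $\psi(T_1,T_2;\lambda)=T_2E_{\alpha,1}(-\lambda T_1^\alpha)E_{\alpha,2}(-\lambda T_2^\alpha)-T_1E_{\alpha,1}(-\lambda T_2^\alpha)E_{\alpha,2}(-\lambda T_1^\alpha)$. There are a constant $c_*>0$ depending only on $\alpha$ and, for each $\lambda>0$, a constant $M(\lambda)>0$ such that for all $T_2>T_1\ge M(\lambda)$: $\psi(T_1,T_2;\lambda)\le \frac{c_*(T_2-T_1)}{\Gamma(1-\alpha)\Gamma(2-\alpha)}\frac1{\lambda^2T_1^\alpha T_2^\alpha}<0$. $M(\lambda_1)$ is this constant for $\lambda=\lambda_1$, chosen moreover so large that $M(\lambda_1)^\alpha>z_0/\lambda_1$, where $z_0>0$ is such that for all $z\ge z_0$: $E_{\alpha,1}(-z)\le\frac1{2\Gamma(1-\alpha)z}<0$ and $E_{\alpha,2}(-z)\ge\frac1{2\Gamma(2-\alpha)z}>0$. *)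

theory Defs
  imports "HOL-Analysis.Analysis"
begin

definition convex_polyhedral_domain :: "'a::euclidean_space set \<Rightarrow> bool" where
  "convex_polyhedral_domain \<Omega> \<longleftrightarrow>
     open \<Omega> \<and> convex \<Omega> \<and> \<Omega> \<noteq> {} \<and> polytope (closure \<Omega>)"


section \<open>Square-integrable functions\<close>

text \<open>
  Elements of $L^2(\Omega)$ are represented by functions on the whole space; only their values
  on \<open>\<Omega>\<close> matter, and equality in $L^2(\Omega)$ is equality almost everywhere on \<open>\<Omega>\<close>.
\<close>

definition L2_fun :: "'a::euclidean_space set \<Rightarrow> ('a \<Rightarrow> real) set" where
  "L2_fun \<Omega> = {f \<in> borel_measurable (lebesgue_on \<Omega>). integrable (lebesgue_on \<Omega>) (\<lambda>x. (f x)\<^sup>2)}"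

definition L2_inner :: "'a::euclidean_space set \<Rightarrow> ('a \<Rightarrow> real) \<Rightarrow> ('a \<Rightarrow> real) \<Rightarrow> real" where
  "L2_inner \<Omega> f g = (LINT x|lebesgue_on \<Omega>. f x * g x)"

definition norm_L2 :: "'a::euclidean_space set \<Rightarrow> ('a \<Rightarrow> real) \<Rightarrow> real" where
  "norm_L2 \<Omega> f = sqrt (LINT x|lebesgue_on \<Omega>. (f x)\<^sup>2)"

definition L2_eq :: "'a::euclidean_space set \<Rightarrow> ('a \<Rightarrow> real) \<Rightarrow> ('a \<Rightarrow> real) \<Rightarrow> bool" where
  "L2_eq \<Omega> f g \<longleftrightarrow> (AE x in lebesgue_on \<Omega>. f x = g x)"

definition L2_sums :: "'a::euclidean_space set \<Rightarrow> (nat \<Rightarrow> 'a \<Rightarrow> real) \<Rightarrow> ('a \<Rightarrow> real) \<Rightarrow> bool" where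
  "L2_sums \<Omega> f s \<longleftrightarrow>
     (\<forall>j. f j \<in> L2_fun \<Omega>) \<and> s \<in> L2_fun \<Omega> \<and>
     (\<lambda>n. norm_L2 \<Omega> (\<lambda>x. s x - (\<Sum>j<n. f j x))) \<longlonglongrightarrow> 0"


section \<open>The Dirichlet Laplacian and its eigensystem\<close>

definition test_fun :: "'a::euclidean_space set \<Rightarrow> ('a \<Rightarrow> real) \<Rightarrow> ('a \<Rightarrow> 'a) \<Rightarrow> bool" where
  "test_fun \<Omega> v Dv \<longleftrightarrow>
     (\<forall>x. GDERIV v x :> Dv x) \<and> continuous_on UNIV Dv \<and>
     compact (closure {x. v x \<noteq> 0}) \<and> closure {x. v x \<noteq> 0} \<subseteq> \<Omega>"

text \<open>
  \<open>H10_fun \<Omega> f G\<close>: the function \<open>f\<close> lies in $H^1_0(\Omega)$, the closure of $C^1_c(\Omega)$ in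
  $H^1(\Omega)$, and \<open>G\<close> is its weak gradient.
\<close>

definition H10_fun :: "'a::euclidean_space set \<Rightarrow> ('a \<Rightarrow> real) \<Rightarrow> ('a \<Rightarrow> 'a) \<Rightarrow> bool" where
  "H10_fun \<Omega> f G \<longleftrightarrow>
     f \<in> L2_fun \<Omega> \<and>
     G \<in> borel_measurable (lebesgue_on \<Omega>) \<and>
     (\<lambda>x. norm (G x)) \<in> L2_fun \<Omega> \<and>
     (\<exists>v Dv. (\<forall>n. test_fun \<Omega> (v n) (Dv n)) \<and>
        (\<lambda>n. norm_L2 \<Omega> (\<lambda>x. f x - v n x)) \<longlonglongrightarrow> 0 \<and>
        (\<lambda>n. norm_L2 \<Omega> (\<lambda>x. norm (G x - Dv n x))) \<longlonglongrightarrow> 0)"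

text \<open>Weak form of $-\Delta f = \mu f$ in \<open>\<Omega>\<close>, $f = 0$ on the boundary, $f \neq 0$.\<close>

definition dirichlet_eigenfunction :: "'a::euclidean_space set \<Rightarrow> real \<Rightarrow> ('a \<Rightarrow> real) \<Rightarrow> bool" where
  "dirichlet_eigenfunction \<Omega> \<mu> f \<longleftrightarrow>
     \<not> L2_eq \<Omega> f (\<lambda>x. 0) \<and>
     (\<exists>G. H10_fun \<Omega> f G \<and>
        (\<forall>w Dw. test_fun \<Omega> w Dw \<longrightarrow>
           (LINT x|lebesgue_on \<Omega>. G x \<bullet> Dw x) = \<mu> * L2_inner \<Omega> f w))"

text \<open>
  All eigenvalues, repeated according to multiplicity and in nondecreasing order, together with an
  orthonormal basis of $L^2(\Omega)$ consisting of eigenfunctions; the last clause says that no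
  eigenfunction is missing. The enumeration starts at \<open>0\<close>, so the smallest eigenvalue, usually
  written $\lambda_1$, is \<open>lam 0\<close>.
\<close>

definition dirichlet_eigensystem ::
    "'a::euclidean_space set \<Rightarrow> (nat \<Rightarrow> real) \<Rightarrow> (nat \<Rightarrow> 'a \<Rightarrow> real) \<Rightarrow> bool" where
  "dirichlet_eigensystem \<Omega> lam \<phi> \<longleftrightarrow>
     mono lam \<and>
     (\<forall>j. dirichlet_eigenfunction \<Omega> (lam j) (\<phi> j)) \<and>
     (\<forall>i j. L2_inner \<Omega> (\<phi> i) (\<phi> j) = (if i = j then 1 else 0)) \<and>
     (\<forall>v \<in> L2_fun \<Omega>. L2_sums \<Omega> (\<lambda>j x. L2_inner \<Omega> v (\<phi> j) * \<phi> j x) v)"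

text \<open>
  \<open>Hdot\<close> is the space of order \<open>q\<close> for \<open>q \<ge> 0\<close>, where it is contained in $L^2(\Omega)$. The norm
  below is used for negative \<open>q\<close> too, but only on elements of $L^2(\Omega)$, for which the series
  then converges because the eigenvalues are bounded below by \<open>lam 0 > 0\<close>.
\<close>

definition Hdot ::
    "'a::euclidean_space set \<Rightarrow> (nat \<Rightarrow> real) \<Rightarrow> (nat \<Rightarrow> 'a \<Rightarrow> real) \<Rightarrow> real \<Rightarrow> ('a \<Rightarrow> real) set" where
  "Hdot \<Omega> lam \<phi> q =
     {v \<in> L2_fun \<Omega>. summable (\<lambda>j. lam j powr q * (L2_inner \<Omega> v (\<phi> j))\<^sup>2)}"

definition norm_Hdot ::
    "'a::euclidean_space set \<Rightarrow> (nat \<Rightarrow> real) \<Rightarrow> (nat \<Rightarrow> 'a \<Rightarrow> real) \<Rightarrow> real \<Rightarrow> ('a \<Rightarrow> real) \<Rightarrow> real"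
  where
  "norm_Hdot \<Omega> lam \<phi> q v = sqrt (\<Sum>j. lam j powr q * (L2_inner \<Omega> v (\<phi> j))\<^sup>2)"


section \<open>The diffusion-wave problem\<close>

definition mittag_leffler :: "real \<Rightarrow> real \<Rightarrow> real \<Rightarrow> real" where
  "mittag_leffler \<alpha> \<beta> z = (\<Sum>k. z ^ k / Gamma (real k * \<alpha> + \<beta>))"

definition dw_psi :: "real \<Rightarrow> real \<Rightarrow> real \<Rightarrow> real \<Rightarrow> real" where
  "dw_psi \<alpha> T1 T2 l =
     T2 * mittag_leffler \<alpha> 1 (- l * T1 powr \<alpha>) * mittag_leffler \<alpha> 2 (- l * T2 powr \<alpha>) -
     T1 * mittag_leffler \<alpha> 1 (- l * T2 powr \<alpha>) * mittag_leffler \<alpha> 2 (- l * T1 powr \<alpha>)"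

text \<open>
  \<open>dw_F \<dots> t v w\<close> and \<open>dw_Fbar \<dots> t v w\<close> say that \<open>w\<close> represents the element $F(t)v$,
  respectively $\bar F(t)v$, of $L^2(\Omega)$.
\<close>

definition dw_F ::
    "'a::euclidean_space set \<Rightarrow> (nat \<Rightarrow> real) \<Rightarrow> (nat \<Rightarrow> 'a \<Rightarrow> real) \<Rightarrow> real \<Rightarrow> real
     \<Rightarrow> ('a \<Rightarrow> real) \<Rightarrow> ('a \<Rightarrow> real) \<Rightarrow> bool" where
  "dw_F \<Omega> lam \<phi> \<alpha> t v w \<longleftrightarrow>
     L2_sums \<Omega>
       (\<lambda>j x. mittag_leffler \<alpha> 1 (- lam j * t powr \<alpha>) * L2_inner \<Omega> v (\<phi> j) * \<phi> j x) w"

definition dw_Fbar ::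
    "'a::euclidean_space set \<Rightarrow> (nat \<Rightarrow> real) \<Rightarrow> (nat \<Rightarrow> 'a \<Rightarrow> real) \<Rightarrow> real \<Rightarrow> real
     \<Rightarrow> ('a \<Rightarrow> real) \<Rightarrow> ('a \<Rightarrow> real) \<Rightarrow> bool" where
  "dw_Fbar \<Omega> lam \<phi> \<alpha> t v w \<longleftrightarrow>
     L2_sums \<Omega>
       (\<lambda>j x. t * mittag_leffler \<alpha> 2 (- lam j * t powr \<alpha>) * L2_inner \<Omega> v (\<phi> j) * \<phi> j x) w"

text \<open>
  The solution on $[0,T]$ of $\partial_t^\alpha u - \Delta u = 0$ with homogeneous Dirichlet
  boundary condition, $u(0) = a$ and $\partial_t u(0) = b$, namely $u(t) = F(t)a + \bar F(t)b$.
  For data that are merely in $L^2(\Omega)$ the Caputo derivative and $\partial_t u(0)$ need not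
  exist as limits in $L^2(\Omega)$, and this formula is what is meant by the solution; the initial
  velocity is therefore carried along as the datum \<open>b\<close>. At \<open>t = 0\<close> the formula gives $u(0) = a$.
\<close>

definition dw_solution ::
    "'a::euclidean_space set \<Rightarrow> (nat \<Rightarrow> real) \<Rightarrow> (nat \<Rightarrow> 'a \<Rightarrow> real) \<Rightarrow> real \<Rightarrow> real
     \<Rightarrow> ('a \<Rightarrow> real) \<Rightarrow> ('a \<Rightarrow> real) \<Rightarrow> (real \<Rightarrow> 'a \<Rightarrow> real) \<Rightarrow> bool" where
  "dw_solution \<Omega> lam \<phi> \<alpha> T a b u \<longleftrightarrow>
     a \<in> L2_fun \<Omega> \<and> b \<in> L2_fun \<Omega> \<and>
     (\<forall>t\<in>{0..T}. u t \<in> L2_fun \<Omega> \<and>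
        (\<exists>Fa Fb. dw_F \<Omega> lam \<phi> \<alpha> t a Fa \<and> dw_Fbar \<Omega> lam \<phi> \<alpha> t b Fb \<and>
                 L2_eq \<Omega> (u t) (\<lambda>x. Fa x + Fb x)))"

text \<open>
  The regularized problem for the data \<open>g1\<close>, \<open>g2\<close>; the function \<open>v\<close> is the solution and \<open>v1\<close>
  its initial velocity $\partial_t v(0)$.
\<close>

definition dw_regularized ::
    "'a::euclidean_space set \<Rightarrow> (nat \<Rightarrow> real) \<Rightarrow> (nat \<Rightarrow> 'a \<Rightarrow> real) \<Rightarrow> real \<Rightarrow> real
     \<Rightarrow> real \<Rightarrow> real \<Rightarrow> real \<Rightarrow> ('a \<Rightarrow> real) \<Rightarrow> ('a \<Rightarrow> real)
     \<Rightarrow> (real \<Rightarrow> 'a \<Rightarrow> real) \<Rightarrow> ('a \<Rightarrow> real) \<Rightarrow> bool" where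
  "dw_regularized \<Omega> lam \<phi> \<alpha> T T1 T2 \<gamma> g1 g2 v v1 \<longleftrightarrow>
     dw_solution \<Omega> lam \<phi> \<alpha> T (v 0) v1 v \<and>
     L2_eq \<Omega> (\<lambda>x. - \<gamma> * v 0 x + v T1 x) g1 \<and>
     L2_eq \<Omega> (\<lambda>x. \<gamma> * v1 x + v T2 x) g2"

end

theory Submission
  imports Defs "HOL-Complex_Analysis.Complex_Analysis" "HOL-Probability.Sinc_Integral"
    "HOL-Real_Asymp.Real_Asymp"
begin

text \<open>
  In the eigenbasis the regularized problem decouples into \<open>2 \<times> 2\<close> systems, one per mode. Their
  determinant is \<open>- (\<gamma>\<^sup>2 + \<gamma> (R - p) - \<psi>)\<close> with \<open>p \<lesssim> - 1/\<lambda>\<close>, \<open>R \<gtrsim> 1/\<lambda>\<close> and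
  \<open>\<psi> \<lesssim> - 1/\<lambda>\<^sup>2\<close>, hence of size at least \<open>(\<gamma> + 1/\<lambda>)\<^sup>2\<close>, while all entries are \<open>O(\<gamma> + 1/\<lambda>)\<close>. So
  each mode of the initial error is at most \<open>(\<gamma> (\<bar>a\<^sub>j\<bar> + \<bar>b\<^sub>j\<bar>) + noise) / (\<gamma> + 1/\<lambda>)\<close>, and the
  evolution multiplies it by \<open>O(1 / (1 + \<lambda> t\<^sup>\<alpha>))\<close>; interpolating \<open>\<lambda>\<^sup>\<theta> \<le> w\<^sup>-\<^sup>\<theta> (1 + w \<lambda>)\<close> gives
  the rates, and dominated convergence the case of rough data. The bound on \<open>\<psi>\<close> is assumed for
  \<open>\<lambda> = \<lambda>\<^sub>1\<close> only and reaches the other modes by rescaling time.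

  The upper bounds \<open>\<bar>E\<^sub>\<alpha>\<^sub>,\<^sub>\<beta>(- z)\<bar> \<le> C / (1 + z)\<close> come from a Bromwich integral over a vertical line in
  the right half plane, where \<open>s\<^sup>\<alpha> + z\<close> stays away from \<open>0\<close> since \<open>\<alpha> < 2\<close>; raising \<open>\<beta>\<close> beforehand
  makes the integral converge absolutely. Positivity of \<open>\<lambda>\<^sub>1\<close> is the Poincare inequality.
\<close>

section \<open>Integrals over vertical lines\<close>

text \<open>The assumed Mittag-Leffler bounds are one-sided and concern large arguments; they keep
  the determinant away from 0. The cofactors, and the evolution down to t = 0, require two-sided
  decay for every z \<ge> 0. The obstacle there: for \<beta> = 1 the Bromwich integrand is only of
  order 1/|s| on a line, and extracting the factor 1/(1 + z) costs a further |s|^\<alpha>. A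
  majorant |s|^(-2) is therefore available once \<beta> \<ge> \<alpha> + 2, whence the threshold 4.
  Coming back down from \<beta> + 1 to \<beta> multiplies the coefficients by a factor linear in k,
  which raises the power of s^\<alpha> / (s^\<alpha> + z); so all powers m + 1 are treated at once.
  For a higher mode the threshold \<open>M (lam j)\<close> may exceed \<open>T1\<close>. Rescaling
  works because \<lambda> and t meet only in \<lambda> t^\<alpha>, so that a larger eigenvalue
  amounts to a longer time, which remains above \<open>M (lam 0)\<close>. All constants are fixed
  before \<gamma>, the noisy data and the regularized solution are introduced; this gives the
  required uniformity.\<close>

lemma has_bochner_integral_inverse_1_plus_square:
  "has_bochner_integral lborel (\<lambda>x::real. 1 / (1 + x\<^sup>2)) pi"
proof -
  have "integrable lborel (\<lambda>x::real. 1 / (1 + x\<^sup>2))"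
    using integrable_inverse_1_plus_square
    by (simp add: set_integrable_def einterval_def inverse_eq_divide)
  moreover have "(LINT x|lborel. 1 / (1 + x\<^sup>2)) = (pi::real)"
    using LBINT_inverse_1_plus_square
    by (simp add: interval_lebesgue_integral_def set_lebesgue_integral_def einterval_def
        inverse_eq_divide)
  ultimately show ?thesis
    by (simp add: has_bochner_integral_iff)
qed

lemma has_bochner_integral_inverse_square_plus_square:
  fixes \<sigma> :: real
  assumes "\<sigma> > 0"
  shows "has_bochner_integral lborel (\<lambda>x. 1 / (\<sigma>\<^sup>2 + x\<^sup>2)) (pi / \<sigma>)"
proof -
  have "has_bochner_integral lborel (\<lambda>x. 1 / (1 + (0 + (1/\<sigma>) * x)\<^sup>2)) (inverse \<bar>1/\<sigma>\<bar> *\<^sub>R pi)"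
    using lborel_has_bochner_integral_real_affine_iff[of "1/\<sigma>" "\<lambda>x. 1 / (1 + x\<^sup>2)" pi 0] assms
      has_bochner_integral_inverse_1_plus_square by simp
  hence "has_bochner_integral lborel (\<lambda>x. 1/\<sigma>\<^sup>2 * (1 / (1 + (0 + (1/\<sigma>) * x)\<^sup>2)))
     (1/\<sigma>\<^sup>2 * (inverse \<bar>1/\<sigma>\<bar> *\<^sub>R pi))"
    by (rule has_bochner_integral_mult_right)
  moreover have "1/\<sigma>\<^sup>2 * (1 / (1 + (0 + (1/\<sigma>) * x)\<^sup>2)) = 1 / (\<sigma>\<^sup>2 + x\<^sup>2)" for x :: real
  proof -
    have "1 + (0 + (1/\<sigma>) * x)\<^sup>2 = (\<sigma>\<^sup>2 + x\<^sup>2) / \<sigma>\<^sup>2"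
      using assms by (simp add: power_divide add_divide_distrib)
    thus ?thesis using assms by simp
  qed
  moreover have "1/\<sigma>\<^sup>2 * (inverse \<bar>1/\<sigma>\<bar> *\<^sub>R pi) = pi / \<sigma>"
    using assms by (simp add: power2_eq_square)
  ultimately show ?thesis by simp
qed

text \<open>The contour integral along Re s = \<sigma> divided by the imaginary unit: the factor in
  ds = i d\<omega> is dropped, so inversion formulas carry 1/(2 pi) without i.\<close>

definition vline_integral :: "(complex \<Rightarrow> complex) \<Rightarrow> real \<Rightarrow> complex" where
  "vline_integral f \<sigma> = (LINT \<omega>|lborel. f (Complex \<sigma> \<omega>))"

lemma continuous_on_Complex [continuous_intros]:
  assumes "continuous_on A f" "continuous_on A g"
  shows "continuous_on A (\<lambda>x. Complex (f x) (g x))"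
  unfolding Complex_eq by (intro continuous_intros assms)

lemma continuous_vline:
  assumes "continuous_on {s. Re s > 0} f" "\<sigma> > 0"
  shows "continuous_on A (\<lambda>\<omega>. f (Complex \<sigma> \<omega>))"
  by (rule continuous_on_compose2[OF assms(1)]) (use assms(2) in \<open>auto intro!: continuous_intros\<close>)

text \<open>On the line the squared modulus is \<open>\<sigma>\<^sup>2 + \<omega>\<^sup>2\<close>,
  so the majorant is a multiple of a Cauchy density and integrates to B pi / \<sigma>. The decay of
  this value in \<sigma> later makes integrals vanish as the line moves to the right.\<close>

lemma vline_integral_bound:
  fixes f :: "complex \<Rightarrow> complex"
  assumes f: "continuous_on {s. Re s > 0} f" and "\<sigma> > 0"
    and bound: "\<And>\<omega>. norm (f (Complex \<sigma> \<omega>)) \<le> B / (norm (Complex \<sigma> \<omega>))\<^sup>2"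
  shows "integrable lborel (\<lambda>\<omega>. f (Complex \<sigma> \<omega>))"
    and "norm (vline_integral f \<sigma>) \<le> B * (pi / \<sigma>)"
    and "(LINT \<omega>|lborel. norm (f (Complex \<sigma> \<omega>))) \<le> B * (pi / \<sigma>)"
proof -
  have hb: "has_bochner_integral lborel (\<lambda>x. B * (1 / (\<sigma>\<^sup>2 + x\<^sup>2))) (B * (pi / \<sigma>))"
    by (intro has_bochner_integral_mult_right has_bochner_integral_inverse_square_plus_square assms)
  have bound': "norm (f (Complex \<sigma> \<omega>)) \<le> B * (1 / (\<sigma>\<^sup>2 + \<omega>\<^sup>2))" for \<omega>
    using bound[of \<omega>] by (simp add: cmod_power2)
  have meas: "(\<lambda>\<omega>. f (Complex \<sigma> \<omega>)) \<in> borel_measurable lborel"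
    using continuous_vline[OF f \<open>\<sigma> > 0\<close>, of UNIV] by (simp add: borel_measurable_continuous_onI)
  show i: "integrable lborel (\<lambda>\<omega>. f (Complex \<sigma> \<omega>))"
  proof (rule Bochner_Integration.integrable_bound[OF _ meas])
    show "integrable lborel (\<lambda>x. B * (1 / (\<sigma>\<^sup>2 + x\<^sup>2)))"
      using hb by (simp only: has_bochner_integral_iff)
    show "AE x in lborel. norm (f (Complex \<sigma> x)) \<le> norm (B * (1 / (\<sigma>\<^sup>2 + x\<^sup>2)))"
      using bound' by (intro AE_I2) (smt (verit) real_norm_def)
  qed
  show *: "(LINT \<omega>|lborel. norm (f (Complex \<sigma> \<omega>))) \<le> B * (pi / \<sigma>)"
  proof -
    have "(LINT \<omega>|lborel. norm (f (Complex \<sigma> \<omega>))) \<le> (LINT \<omega>|lborel. B * (1 / (\<sigma>\<^sup>2 + \<omega>\<^sup>2)))"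
      using hb i bound' by (intro integral_mono) (auto simp only: has_bochner_integral_iff integrable_norm)
    thus ?thesis using hb by (simp only: has_bochner_integral_iff)
  qed
  show "norm (vline_integral f \<sigma>) \<le> B * (pi / \<sigma>)"
    unfolding vline_integral_def using * by (rule order.trans[OF integral_norm_bound])
qed

text \<open>The map from \<omega> to F(\<sigma> + i \<omega>) has derivative i f, so -i F is a
  primitive along the line; the truncated integrals converge by domination with |f|.\<close>

lemma vline_integral_LIMSEQ:
  assumes int: "integrable lborel (\<lambda>\<omega>. f (Complex \<sigma> \<omega>))"
    and cont: "continuous_on {s. Re s > 0} f" and "\<sigma> > 0"
    and F: "\<And>s. Re s > 0 \<Longrightarrow> (F has_field_derivative f s) (at s)"
  shows "(\<lambda>n. - \<i> * (F (Complex \<sigma> (real n)) - F (Complex \<sigma> (- real n))))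
           \<longlonglongrightarrow> vline_integral f \<sigma>"
proof -
  have "(LINT x|lborel. indicator {- real n..real n} x *\<^sub>R f (Complex \<sigma> x)) =
      (- \<i> * F (Complex \<sigma> (real n))) - (- \<i> * F (Complex \<sigma> (- real n)))" for n
  proof (rule integral_FTC_atLeastAtMost)
    show "continuous_on {- real n..real n} (\<lambda>x. f (Complex \<sigma> x))"
      by (rule continuous_vline[OF cont \<open>\<sigma> > 0\<close>])
    fix x :: real
    have "((\<lambda>x. Complex \<sigma> x) has_vector_derivative \<i>) (at x within {- real n..real n})"
      unfolding Complex_eq by (auto intro!: derivative_eq_intros has_vector_derivative_real_field 
       simp: has_vector_derivative_def scaleR_conv_of_real)
    from field_vector_diff_chain_within[OF this, of F "f (Complex \<sigma> x)"]
    have "((\<lambda>x. F (Complex \<sigma> x)) has_vector_derivative \<i> * f (Complex \<sigma> x)) (at x within {- real n..real n})"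
      using F[of "Complex \<sigma> x"] \<open>\<sigma> > 0\<close> by (simp add: o_def has_field_derivative_at_within)
    from has_vector_derivative_mult_right[OF this, of "- \<i>"]
    show "((\<lambda>x. - \<i> * F (Complex \<sigma> x)) has_vector_derivative f (Complex \<sigma> x))
        (at x within {- real n..real n})"
      by (simp flip: mult.assoc)
  qed simp
  moreover have "(\<lambda>n. LINT x|lborel. indicator {- real n..real n} x *\<^sub>R f (Complex \<sigma> x))
      \<longlonglongrightarrow> vline_integral f \<sigma>"
    unfolding vline_integral_def
  proof (rule integral_dominated_convergence)
    show "(\<lambda>\<omega>. f (Complex \<sigma> \<omega>)) \<in> borel_measurable lborel"
      using int by (rule borel_measurable_integrable)
    show "integrable lborel (\<lambda>\<omega>. norm (f (Complex \<sigma> \<omega>)))" using int by (rule integrable_norm)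
    show "AE x in lborel. (\<lambda>n. indicator {- real n..real n} x *\<^sub>R f (Complex \<sigma> x)) \<longlonglongrightarrow> f (Complex \<sigma> x)"
    proof (intro AE_I2)
      fix x :: real
      have "eventually (\<lambda>n. indicator {- real n..real n} x *\<^sub>R f (Complex \<sigma> x) = f (Complex \<sigma> x)) sequentially"
        using eventually_ge_at_top[of "nat \<lceil>\<bar>x\<bar>\<rceil>"]
        by eventually_elim (auto simp: indicator_def abs_le_iff nat_le_iff ceiling_le_iff)
      thus "(\<lambda>n. indicator {- real n..real n} x *\<^sub>R f (Complex \<sigma> x)) \<longlonglongrightarrow> f (Complex \<sigma> x)"
        by (rule tendsto_eventually)
    qed
    show "(\<lambda>x. indicator {- real n..real n} x *\<^sub>R f (Complex \<sigma> x)) \<in> borel_measurable lborel" for n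
      by (intro borel_measurable_scaleR borel_measurable_integrable[OF int] borel_measurable_indicator) simp
    show "AE x in lborel. norm (indicator {- real n..real n} x *\<^sub>R f (Complex \<sigma> x)) \<le> norm (f (Complex \<sigma> x))" for n
      by (intro AE_I2) (simp split: split_indicator)
  qed
  ultimately show ?thesis by (simp only: right_diff_distrib)
qed

text \<open>Shifting a vertical line: on the half plane \<open>f\<close> has a primitive, and the decay of \<open>f\<close>
  makes the primitive take asymptotically equal values on the two lines.\<close>

lemma vline_integral_shift:
  assumes hol: "f holomorphic_on {s. Re s > 0}" and "0 < \<sigma>" "\<sigma> \<le> \<tau>"
    and bound: "\<And>s. \<sigma> \<le> Re s \<Longrightarrow> Re s \<le> \<tau> \<Longrightarrow> Re s = \<sigma> \<or> Re s = \<tau> \<or> \<bar>Im s\<bar> \<ge> 1 \<Longrightarrow>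
                norm (f s) \<le> B / (norm s)\<^sup>2"
  shows "vline_integral f \<sigma> = vline_integral f \<tau>"
proof -
  let ?H = "{s. Re s > 0}"
  have op: "open ?H" by (simp add: open_halfspace_Re_gt)
  have cont: "continuous_on ?H f" using hol by (rule holomorphic_on_imp_continuous_on)
  obtain F where F0: "\<And>s. s \<in> ?H \<Longrightarrow> (F has_field_derivative f s) (at s within ?H)"
    using holomorphic_convex_primitive'[OF convex_halfspace_Re_gt op hol] by metis
  hence F: "(F has_field_derivative f s) (at s)" if "Re s > 0" for s
    using that at_within_open[OF _ op] by fastforce
  have B0: "0 \<le> B"
  proof -
    have "0 \<le> B / (norm (Complex \<sigma> 1))\<^sup>2"
      using bound[of "Complex \<sigma> 1"] \<open>\<sigma> \<le> \<tau>\<close> norm_ge_zero order.trans by (metis complex.sel(1) order.refl)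
    thus ?thesis by (simp add: cmod_power2 zero_le_divide_iff) (smt (verit) zero_le_power2)
  qed
  have lim: "(\<lambda>n. - \<i> * (F (Complex \<rho> (real n)) - F (Complex \<rho> (- real n)))) \<longlonglongrightarrow> vline_integral f \<rho>"
    if "\<rho> = \<sigma> \<or> \<rho> = \<tau>" for \<rho>
  proof (rule vline_integral_LIMSEQ[OF _ cont])
    show "\<rho> > 0" using that assms by auto
    show "integrable lborel (\<lambda>\<omega>. f (Complex \<rho> \<omega>))"
      by (rule vline_integral_bound(1)[OF cont \<open>\<rho> > 0\<close>, of B]) (use bound that assms in auto)
  qed (use F in auto)
  \<comment> \<open>The horizontal segment at height w has |s| \<ge> |w|, so the derivative of
    \<open>F\<close> there is at most B / w^2, and the segment has length \<tau> - \<sigma>. The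
    condition |w| \<ge> 1 puts it where the decay bound is available.\<close>
  have diff: "norm (F (Complex \<sigma> w) - F (Complex \<tau> w)) \<le> B / w\<^sup>2 * (\<tau> - \<sigma>)" if "\<bar>w\<bar> \<ge> 1" for w
  proof -
    let ?S = "closed_segment (Complex \<sigma> w) (Complex \<tau> w)"
    have S: "Im s = w \<and> \<sigma> \<le> Re s \<and> Re s \<le> \<tau>" if s: "s \<in> ?S" for s
    proof -
      obtain u where u: "0 \<le> u" "u \<le> 1" "s = (1 - u) *\<^sub>R Complex \<sigma> w + u *\<^sub>R Complex \<tau> w"
        using s by (auto simp: closed_segment_def)
      have "Re s = \<sigma> + u * (\<tau> - \<sigma>)" "Im s = w" unfolding u(3) by (simp_all add: algebra_simps)
      moreover have "0 \<le> u * (\<tau> - \<sigma>)" using u \<open>\<sigma> \<le> \<tau>\<close> by simp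
      moreover have "u * (\<tau> - \<sigma>) \<le> 1 * (\<tau> - \<sigma>)" using u \<open>\<sigma> \<le> \<tau>\<close> by (intro mult_right_mono) auto
      ultimately show ?thesis by simp
    qed
    have "norm (F (Complex \<sigma> w) - F (Complex \<tau> w)) \<le> B / w\<^sup>2 * norm (Complex \<sigma> w - Complex \<tau> w)"
    proof (rule field_differentiable_bound[of ?S])
      fix s assume s: "s \<in> ?S"
      show "(F has_field_derivative f s) (at s within ?S)"
        using F[of s] S[OF s] \<open>0 < \<sigma>\<close> by (auto intro: has_field_derivative_at_within)
      have "norm (f s) \<le> B / (norm s)\<^sup>2" using S[OF s] that bound by auto
      also have "\<dots> \<le> B / w\<^sup>2"
        using S[OF s] that B0 by (intro divide_left_mono) (auto simp: cmod_power2 sum_power2_gt_zero_iff intro!: mult_pos_pos)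
      finally show "norm (f s) \<le> B / w\<^sup>2" .
    qed auto
    also have "Complex \<sigma> w - Complex \<tau> w = of_real (\<sigma> - \<tau>)" by (simp add: complex_eq_iff)
    also have "norm (complex_of_real (\<sigma> - \<tau>)) = \<tau> - \<sigma>"
      using \<open>\<sigma> \<le> \<tau>\<close> by (subst norm_of_real) simp
    finally show ?thesis .
  qed
  have z: "(\<lambda>n. B / (real n)\<^sup>2 * (\<tau> - \<sigma>)) \<longlonglongrightarrow> 0" by real_asymp
  have d1: "(\<lambda>n. F (Complex \<sigma> (real n)) - F (Complex \<tau> (real n))) \<longlonglongrightarrow> 0"
    by (rule tendsto_0_le[OF z, of _ 1], rule eventually_mono[OF eventually_ge_at_top[of 1]])
       (use diff B0 \<open>\<sigma> \<le> \<tau>\<close> in auto)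
  have d2: "(\<lambda>n. F (Complex \<sigma> (- real n)) - F (Complex \<tau> (- real n))) \<longlonglongrightarrow> 0"
    by (rule tendsto_0_le[OF z, of _ 1], rule eventually_mono[OF eventually_ge_at_top[of 1]])
       (use diff[of "- real n" for n] B0 \<open>\<sigma> \<le> \<tau>\<close> in auto)
  have "(\<lambda>n. - \<i> * (F (Complex \<sigma> (real n)) - F (Complex \<sigma> (- real n)))
           - (- \<i> * (F (Complex \<tau> (real n)) - F (Complex \<tau> (- real n))))) \<longlonglongrightarrow>
         vline_integral f \<sigma> - vline_integral f \<tau>"
    by (intro tendsto_diff lim) auto
  moreover have "(\<lambda>n. - \<i> * ((F (Complex \<sigma> (real n)) - F (Complex \<tau> (real n))) -
            (F (Complex \<sigma> (- real n)) - F (Complex \<tau> (- real n))))) \<longlonglongrightarrow> - \<i> * (0 - 0)"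
    by (intro tendsto_intros d1 d2)
  ultimately have "vline_integral f \<sigma> - vline_integral f \<tau> = 0"
    by (intro LIMSEQ_unique) (simp_all add: algebra_simps)
  thus ?thesis by simp
qed

text \<open>The line can be pushed to any \<tau> \<ge> R, where the integral is at most B pi /
  \<tau>. The rectangle with \<sigma> < Re s < R and |Im s| < 1 is exempt from the bound to leave
  room for a removable singularity at s = 1, near which the quotient form of the integrand gives no
  estimate.\<close>

lemma vline_integral_eq_0:
  assumes hol: "f holomorphic_on {s. Re s > 0}" and "0 < \<sigma>" "\<sigma> < R"
    and bound: "\<And>s. \<sigma> \<le> Re s \<Longrightarrow> Re s = \<sigma> \<or> Re s \<ge> R \<or> \<bar>Im s\<bar> \<ge> 1 \<Longrightarrow>
                norm (f s) \<le> B / (norm s)\<^sup>2"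
  shows "vline_integral f \<sigma> = 0"
proof -
  have cont: "continuous_on {s. Re s > 0} f" using hol by (rule holomorphic_on_imp_continuous_on)
  have "norm (vline_integral f \<sigma>) \<le> B * (pi / \<tau>)" if "\<tau> \<ge> R" for \<tau>
  proof -
    have "vline_integral f \<sigma> = vline_integral f \<tau>"
      by (rule vline_integral_shift[OF hol, of _ _ B]) (use assms that in auto)
    thus ?thesis using vline_integral_bound(2)[OF cont, of \<tau> B] bound that assms by auto
  qed
  hence "eventually (\<lambda>\<tau>. norm (vline_integral f \<sigma>) \<le> B * (pi / \<tau>)) at_top"
    by (intro eventually_mono[OF eventually_ge_at_top[of R]]) auto
  moreover have "((\<lambda>\<tau>. B * (pi / \<tau>)) \<longlongrightarrow> 0) at_top" by real_asymp
  ultimately have "norm (vline_integral f \<sigma>) \<le> 0"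
    by (intro tendsto_lowerbound) auto
  thus ?thesis by simp
qed

section \<open>The Bromwich integral of the Gamma function\<close>

text \<open>For a nonnegative function the gauge integral is absolutely convergent; this brings
  known gauge integrals into the Bochner setting, where domination and Fubini apply.\<close>

lemma integral_lborel_nonneg_eq:
  fixes f :: "real \<Rightarrow> real"
  assumes f: "f \<in> borel_measurable borel" and nn: "\<And>x. 0 \<le> f x" and int: "(f has_integral I) UNIV"
  shows "has_bochner_integral lborel f I"
proof (rule has_bochner_integral_nn_integral)
  show "0 \<le> I" using has_integral_nonneg[OF int] nn by simp
  show "integral\<^sup>N lborel f = ennreal I"
    by (rule nn_integral_has_integral_lborel[OF f nn int])
qed (use f nn in auto)

lemma has_bochner_integral_exp_half_line:
  fixes z :: complex
  assumes z: "Re z > 0"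
  shows "has_bochner_integral lborel (\<lambda>t. indicator {0<..} t *\<^sub>R exp (- (of_real t * z))) (1 / z)"
proof -
  have z0: "z \<noteq> 0" using z by auto
  have "((\<lambda>t::real. if t \<in> {0..} then exp (- (Re z) * t) else 0) has_integral exp (- (Re z) * 0) / Re z) UNIV"
    unfolding has_integral_restrict_UNIV by (rule has_integral_exp_minus_to_infinity[OF z])
  hence "has_bochner_integral lborel (\<lambda>t::real. if t \<in> {0..} then exp (- (Re z) * t) else 0) (exp (- (Re z) * 0) / Re z)"
    by (intro integral_lborel_nonneg_eq) auto
  hence i0: "integrable lborel (\<lambda>t::real. if t \<in> {0..} then exp (- (Re z) * t) else 0)"
    by (simp only: has_bochner_integral_iff)
  have meas: "(\<lambda>t. indicator {0<..} t *\<^sub>R exp (- (of_real t * z))) \<in> borel_measurable lborel"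
    by simp
  have i: "integrable lborel (\<lambda>t. indicator {0<..} t *\<^sub>R exp (- (of_real t * z)))"
    by (rule Bochner_Integration.integrable_bound[OF i0 meas]) (auto simp: indicator_def)
  have fin: "(LINT t|lborel. indicator {0..real n} t *\<^sub>R exp (- (of_real t * z))) =
      - exp (- (of_real (real n) * z)) / z - - exp (- (of_real 0 * z)) / z" for n
  proof (rule integral_FTC_atLeastAtMost)
    fix x :: real
    have "((\<lambda>w. - exp (- (w * z)) / z) has_field_derivative exp (- (of_real x * z))) (at (of_real x))"
      using z0 by (auto intro!: derivative_eq_intros)
    from has_vector_derivative_real_field[OF this]
    show "((\<lambda>x. - exp (- (of_real x * z)) / z) has_vector_derivative exp (- (of_real x * z))) (at x within {0..real n})"
      by (simp add: o_def has_vector_derivative_at_within)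
  qed (auto intro!: continuous_intros)
  have "(\<lambda>n. LINT t|lborel. indicator {0..real n} t *\<^sub>R exp (- (of_real t * z)))
       \<longlonglongrightarrow> (LINT t|lborel. indicator {0<..} t *\<^sub>R exp (- (of_real t * z)))"
  proof (rule integral_dominated_convergence[OF meas _ i0])
    show "(\<lambda>t. indicator {0..real n} t *\<^sub>R exp (- (of_real t * z))) \<in> borel_measurable lborel" for n
      by simp
    \<comment> \<open>The segments contain 0 while the half line is open; hence convergence only
      away from that point.\<close>
    show "AE x in lborel. (\<lambda>n. indicator {0..real n} x *\<^sub>R exp (- (of_real x * z)))
        \<longlonglongrightarrow> indicator {0<..} x *\<^sub>R exp (- (of_real x * z))"
      using AE_lborel_singleton[of 0]
    proof eventually_elim
      case (elim x)
      have "eventually (\<lambda>n. indicator {0..real n} x *\<^sub>R exp (- (of_real x * z)) =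
          indicator {0<..} x *\<^sub>R exp (- (of_real x * z))) sequentially"
        using eventually_ge_at_top[of "nat \<lceil>\<bar>x\<bar>\<rceil>"] 
        by eventually_elim (use elim in \<open>auto simp: indicator_def nat_le_iff ceiling_le_iff\<close>)
      thus ?case by (rule tendsto_eventually)
    qed
    show "AE x in lborel. norm (indicator {0..real n} x *\<^sub>R exp (- (of_real x * z)))
       \<le> (if x \<in> {0..} then exp (- (Re z) * x) else 0)" for n
      by (intro AE_I2) (auto simp: indicator_def)
  qed
  moreover have "(\<lambda>n. - exp (- (of_real (real n) * z)) / z - - exp (- (of_real 0 * z)) / z) \<longlonglongrightarrow> - 0 / z - - exp (- (of_real 0 * z)) / z"
  proof (intro tendsto_intros z0)
    have "(\<lambda>n. exp (- (real n * Re z))) \<longlonglongrightarrow> 0" using z by real_asymp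
    thus "(\<lambda>n. exp (- (of_real (real n) * z))) \<longlonglongrightarrow> 0"
      by (subst tendsto_norm_zero_iff[symmetric]) simp
  qed
  ultimately have "(LINT t|lborel. indicator {0<..} t *\<^sub>R exp (- (of_real t * z))) = 1 / z"
    unfolding fin by (intro LIMSEQ_unique) auto
  with i show ?thesis by (simp add: has_bochner_integral_iff)
qed

lemma has_bochner_integral_Gamma:
  fixes x :: real
  assumes "x > 0"
  shows "has_bochner_integral lborel (\<lambda>t. indicator {0<..} t * (t powr (x - 1) * exp (- t))) (Gamma x)"
proof (rule integral_lborel_nonneg_eq)
  have "((\<lambda>t. if t \<in> {0..} then t powr (x - 1) / exp t else 0) has_integral Gamma x) UNIV"
    unfolding has_integral_restrict_UNIV by (rule Gamma_integral_real[OF assms])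
  also have "(\<lambda>t. if t \<in> {0..} then t powr (x - 1) / exp t else 0) =
        (\<lambda>t. indicator {0<..} t * (t powr (x - 1) * exp (- t)))"
    by (auto simp: fun_eq_iff indicator_def exp_minus divide_inverse)
  finally show "((\<lambda>t. indicator {0<..} t * (t powr (x - 1) * exp (- t))) has_integral Gamma x) UNIV" .
qed auto

section \<open>Complex powers on vertical lines and the reciprocal Gamma function\<close>

lemma norm_powr_minus_le:
  fixes s :: complex
  assumes "\<nu> \<ge> 2" "\<sigma> > 0" "Re s \<ge> \<sigma>"
  shows "norm (s powr (- of_real \<nu>)) \<le> \<sigma> powr (2 - \<nu>) / (norm s)\<^sup>2"
proof -
  have "norm s \<ge> \<sigma>" using assms complex_Re_le_cmod[of s] by linarith
  have pos: "norm s > 0" using \<open>norm s \<ge> \<sigma>\<close> assms by linarith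
  have "norm (s powr (- of_real \<nu>)) = norm s powr (- \<nu>)"
    by (subst norm_powr_real_powr') auto
  also have "\<dots> = norm s powr ((2 - \<nu>) + (- 2))" by simp
  also have "\<dots> = norm s powr (2 - \<nu>) / (norm s)\<^sup>2"
    unfolding powr_add using pos by (simp add: powr_minus divide_inverse)
  also have "\<dots> \<le> \<sigma> powr (2 - \<nu>) / (norm s)\<^sup>2"
    using assms \<open>norm s \<ge> \<sigma>\<close> by (intro divide_right_mono powr_mono2') auto
  finally show ?thesis .
qed

lemma holomorphic_powr_half_plane [holomorphic_intros]:
  "(\<lambda>s. s powr c) holomorphic_on {s. Re s > 0}"
  by (intro holomorphic_intros) (auto simp: complex_nonpos_Reals_iff)

lemma exp_powr_bound:
  fixes s :: complex
  assumes "\<nu> \<ge> 2" "\<sigma> > 0" "Re s \<ge> \<sigma>" "Re s \<le> \<tau>" "t \<ge> 0"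
  shows "norm (exp (of_real t * s) * s powr (- of_real \<nu>)) \<le> (exp (t * \<tau>) * \<sigma> powr (2 - \<nu>)) / (norm s)\<^sup>2"
proof -
  have "norm (exp (of_real t * s) * s powr (- of_real \<nu>)) \<le> exp (t * \<tau>) * (\<sigma> powr (2 - \<nu>) / (norm s)\<^sup>2)"
    unfolding norm_mult using assms by (intro mult_mono norm_powr_minus_le) (auto intro: mult_left_mono)
  thus ?thesis by simp
qed

lemma vline_integral_exp_powr_indep:
  assumes "\<nu> \<ge> 2" "\<sigma> > 0" "\<tau> > 0"
  shows "vline_integral (\<lambda>s. exp s * s powr (- of_real \<nu>)) \<sigma> =
         vline_integral (\<lambda>s. exp s * s powr (- of_real \<nu>)) \<tau>"
proof -
  have "vline_integral (\<lambda>s. exp s * s powr (- of_real \<nu>)) \<sigma> =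
         vline_integral (\<lambda>s. exp s * s powr (- of_real \<nu>)) \<tau>" if "\<sigma> > 0" "\<sigma> \<le> \<tau>" for \<sigma> \<tau> :: real
  proof (rule vline_integral_shift)
    show "(\<lambda>s. exp s * s powr (- of_real \<nu>)) holomorphic_on {s. Re s > 0}"
      by (intro holomorphic_intros)
    fix s assume "\<sigma> \<le> Re s" "Re s \<le> \<tau>"
    thus "norm (exp s * s powr (- of_real \<nu>)) \<le> (exp (1 * \<tau>) * \<sigma> powr (2 - \<nu>)) / (norm s)\<^sup>2"
      using exp_powr_bound[of \<nu> \<sigma> s \<tau> 1] assms that by simp
  qed (use that in auto)
  thus ?thesis by (metis assms(2,3) linear)
qed

text \<open>The substitution z = t s takes the line Re s = 1/2 to Re z = t/2; the power contributes
  t^\<nu> and the measure 1/t. The line is then moved back to Re z = 1, where the integral no longer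
  depends on t.\<close>

lemma vline_integral_exp_powr_scale:
  assumes "\<nu> \<ge> 2" "t > 0"
  shows "vline_integral (\<lambda>s. exp (of_real t * s) * s powr (- of_real \<nu>)) (1/2) =
         of_real (t powr (\<nu> - 1)) * vline_integral (\<lambda>s. exp s * s powr (- of_real \<nu>)) 1"
proof -
  have "vline_integral (\<lambda>s. exp (of_real t * s) * s powr (- of_real \<nu>)) (1/2) =
     (1/t) *\<^sub>R (LINT x|lborel. exp (of_real t * Complex (1/2) (0 + 1/t*x)) * Complex (1/2) (0 + 1/t*x) powr (- of_real \<nu>))"
    unfolding vline_integral_def using assms by (subst lborel_integral_real_affine[of "1/t" _ 0]) auto
  also have "(\<lambda>x. exp (of_real t * Complex (1/2) (0 + 1/t*x)) * Complex (1/2) (0 + 1/t*x) powr (- of_real \<nu>)) =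
       (\<lambda>x. of_real (t powr \<nu>) * (exp (Complex (t/2) x) * Complex (t/2) x powr (- of_real \<nu>)))"
  proof
    fix x
    let ?z = "Complex (t/2) x"
    have z0: "?z \<noteq> 0" using assms by (auto simp: complex_eq_iff)
    have 1: "of_real t * Complex (1/2) (0 + 1/t*x) = ?z" using assms by (simp add: complex_eq_iff)
    have 2: "Complex (1/2) (0 + 1/t*x) = of_real (1/t) * ?z" using assms by (simp add: complex_eq_iff)
    \<comment> \<open>The principal logarithm of the product splits without a correction term
      because one factor is a positive real.\<close>
    have 3: "Ln (of_real (1/t) * ?z) = of_real (- ln t) + Ln ?z"
    proof -
      have e: "ln (1/t) = - ln t" and "1/t > 0" using assms by (simp_all add: ln_div)
      show ?thesis using Ln_times_of_real[OF \<open>1/t > 0\<close> z0] unfolding Ln_of_real[OF \<open>1/t > 0\<close>] e .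
    qed
    have "(of_real (1/t) * ?z) powr (- of_real \<nu>) = of_real (t powr \<nu>) * ?z powr (- of_real \<nu>)"
    proof -
      have "(of_real (1/t) * ?z) powr (- of_real \<nu>) = exp (- of_real \<nu> * (of_real (- ln t) + Ln ?z))"
        using z0 assms by (simp only: powr_def 3) simp
      also have "\<dots> = exp (of_real (\<nu> * ln t)) * exp (- of_real \<nu> * Ln ?z)"
        by (simp add: ring_distribs flip: exp_add)
      also have "exp (of_real (\<nu> * ln t)) = complex_of_real (t powr \<nu>)"
        using assms by (simp only: exp_of_real powr_def) simp
      also have "exp (- of_real \<nu> * Ln ?z) = ?z powr (- of_real \<nu>)"
        using z0 by (simp add: powr_def)
      finally show ?thesis .
    qed
    thus "exp (of_real t * Complex (1/2) (0 + 1/t*x)) * Complex (1/2) (0 + 1/t*x) powr (- of_real \<nu>) =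
       of_real (t powr \<nu>) * (exp ?z * ?z powr (- of_real \<nu>))"
      unfolding 1 unfolding 2 by (simp add: mult_ac)
  qed
  also have "(1/t) *\<^sub>R (LINT x|lborel. of_real (t powr \<nu>) * (exp (Complex (t/2) x) * Complex (t/2) x powr (- of_real \<nu>))) =
       (1/t) *\<^sub>R (of_real (t powr \<nu>) * vline_integral (\<lambda>s. exp s * s powr (- of_real \<nu>)) (t/2))"
    unfolding vline_integral_def by (subst integral_mult_right_zero) simp
  also have "\<dots> = of_real (t powr (\<nu> - 1)) * vline_integral (\<lambda>s. exp s * s powr (- of_real \<nu>)) (t/2)"
    using assms by (simp add: powr_diff scaleR_conv_of_real)
  also have "vline_integral (\<lambda>s. exp s * s powr (- of_real \<nu>)) (t/2) = vline_integral (\<lambda>s. exp s * s powr (- of_real \<nu>)) 1"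
    using assms by (intro vline_integral_exp_powr_indep) auto
  finally show ?thesis .
qed

lemma norm_one_minus_ge:
  fixes s :: complex
  assumes "Re s = 1/2 \<or> Re s \<ge> 2 \<or> \<bar>Im s\<bar> \<ge> 1"
  shows "norm (1 - s) \<ge> 1/2"
  using abs_Re_le_cmod[of "1 - s"] abs_Im_le_cmod[of "1 - s"] assms by auto

lemma powr_minus_two:
  fixes s :: complex
  assumes "s \<noteq> 0"
  shows "s powr (- of_real 2) = 1 / s\<^sup>2"
proof -
  have "- of_real 2 * Ln s = - Ln s + - Ln s" by (simp add: algebra_simps)
  hence "s powr (- of_real 2) = exp (- Ln s + - Ln s)"
    using assms unfolding powr_def by (simp only: if_False)
  also have "\<dots> = inverse s * inverse s" unfolding exp_add exp_minus exp_Ln[OF assms] ..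
  finally show ?thesis by (simp add: power2_eq_square divide_inverse)
qed

text \<open>A residue at s = 1, computed without a residue theorem. Subtracting s^(-2) from
  s^(-\<nu>) produces a zero at 1, so the quotient \<open>h\<close> extends holomorphically and
  integrates to 0, as does s^(-2) alone. What is left of s^(-2) / (1 - s) after removing s^(-2) is 1
  / (s (1 - s)), an explicit integral.\<close>

lemma vline_integral_powr_resolvent:
  assumes nu: "\<nu> \<ge> 2"
  shows "vline_integral (\<lambda>s. s powr (- of_real \<nu>) / (1 - s)) (1/2) = of_real (2 * pi)"
proof -
  let ?H = "{s. Re s > 0}"
  define k where "k = (\<lambda>s::complex. s powr (- of_real \<nu>) - s powr (- of_real 2))"
  define h where "h = (\<lambda>s. if s = 1 then deriv k 1 else (k s - k 1) / (s - 1))"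
  have k1: "k 1 = 0" by (simp add: k_def)
  have holk: "k holomorphic_on ?H" unfolding k_def by (intro holomorphic_intros)
  have holh: "h holomorphic_on ?H"
    unfolding h_def using pole_lemma_open[OF holk open_halfspace_Re_gt] by simp
  let ?A = "(1/2) powr (2 - \<nu>) :: real"
  have pb: "norm (s powr (- of_real \<mu>)) \<le> (1/2) powr (2 - \<mu>) / (norm s)\<^sup>2" if "Re s \<ge> 1/2" "\<mu> \<ge> 2" for s \<mu>
    using norm_powr_minus_le[of \<mu> "1/2" s] that by simp
  have h0: "vline_integral h (1/2) = 0"
  proof (rule vline_integral_eq_0[OF holh])
    fix s assume s: "1/2 \<le> Re s" "Re s = 1/2 \<or> 2 \<le> Re s \<or> 1 \<le> \<bar>Im s\<bar>"
    have s1: "norm (1 - s) \<ge> 1/2" using s(2) by (rule norm_one_minus_ge)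
    hence "s \<noteq> 1" by auto
    have "norm (k s) \<le> ?A / (norm s)\<^sup>2 + 1 / (norm s)\<^sup>2"
      unfolding k_def using pb[of s \<nu>] pb[of s 2] nu s(1) by (intro order.trans[OF norm_triangle_ineq4] add_mono) auto
    moreover have "norm (h s) = norm (k s) / norm (1 - s)"
      using \<open>s \<noteq> 1\<close> by (simp add: h_def k1 norm_divide norm_minus_commute)
    moreover have "norm (k s) / norm (1 - s) \<le> norm (k s) / (1/2)"
      using s1 by (intro divide_left_mono mult_pos_pos) auto
    ultimately show "norm (h s) \<le> (2 * (?A + 1)) / (norm s)\<^sup>2" by (simp add: add_divide_distrib)
  qed auto
  have sq0: "vline_integral (\<lambda>s. s powr (- of_real 2)) (1/2) = 0"
  proof (rule vline_integral_eq_0[of _ _ 2])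
    show "(\<lambda>s. s powr (- of_real 2)) holomorphic_on ?H" by (intro holomorphic_intros)
    fix s :: complex assume "1/2 \<le> Re s"
    thus "norm (s powr (- of_real 2)) \<le> 1 / (norm s)\<^sup>2" using pb[of s 2] by simp
  qed auto
  have ih: "integrable lborel (\<lambda>\<omega>. h (Complex (1/2) \<omega>))"
  proof (rule vline_integral_bound(1)[OF holomorphic_on_imp_continuous_on[OF holh]])
    fix \<omega> :: real
    let ?s = "Complex (1/2) \<omega>"
    have s1: "norm (1 - ?s) \<ge> 1/2" by (rule norm_one_minus_ge) simp
    hence "?s \<noteq> 1" by auto
    have "norm (k ?s) \<le> ?A / (norm ?s)\<^sup>2 + 1 / (norm ?s)\<^sup>2"
      unfolding k_def using pb[of ?s \<nu>] pb[of ?s 2] nu by (intro order.trans[OF norm_triangle_ineq4] add_mono) auto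
    moreover have "norm (h ?s) = norm (k ?s) / norm (1 - ?s)"
      using \<open>?s \<noteq> 1\<close> by (simp add: h_def k1 norm_divide norm_minus_commute)
    moreover have "norm (k ?s) / norm (1 - ?s) \<le> norm (k ?s) / (1/2)"
      using s1 by (intro divide_left_mono mult_pos_pos) auto
    ultimately show "norm (h ?s) \<le> (2 * (?A + 1)) / (norm ?s)\<^sup>2" by (simp add: add_divide_distrib)
  qed simp
  have isq: "integrable lborel (\<lambda>\<omega>. Complex (1/2) \<omega> powr (- of_real 2))"
  proof (rule vline_integral_bound(1)[where B = 1 and f = "\<lambda>s. s powr (- of_real 2)"])
    show "continuous_on {s. Re s > 0} (\<lambda>s. s powr (- of_real 2))"
      by (intro holomorphic_on_imp_continuous_on holomorphic_powr_half_plane)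
    show "norm (Complex (1/2) \<omega> powr (- of_real 2)) \<le> 1 / (norm (Complex (1/2) \<omega>))\<^sup>2" for \<omega>
      using pb[of "Complex (1/2) \<omega>" 2] by simp
  qed simp
  have hq: "has_bochner_integral lborel (\<lambda>\<omega>. complex_of_real (1 / ((1/2)\<^sup>2 + \<omega>\<^sup>2))) (of_real (pi / (1/2)))"
    by (intro has_bochner_integral_of_real has_bochner_integral_inverse_square_plus_square) simp
  have eq: "Complex (1/2) \<omega> powr (- of_real \<nu>) / (1 - Complex (1/2) \<omega>) =
     - h (Complex (1/2) \<omega>) + (of_real (1 / ((1/2)\<^sup>2 + \<omega>\<^sup>2)) + Complex (1/2) \<omega> powr (- of_real 2))" for \<omega>
  proof -
    let ?s = "Complex (1/2) \<omega>"
    have n1: "?s \<noteq> 1" "?s \<noteq> 0" by (auto simp: complex_eq_iff)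
    have p2: "?s powr (- of_real 2) = 1 / ?s\<^sup>2"
      using n1(2) by (rule powr_minus_two)
    have q: "complex_of_real (1 / ((1/2)\<^sup>2 + \<omega>\<^sup>2)) = 1 / (?s * (1 - ?s))"
    proof -
      have "complex_of_real ((1/2)\<^sup>2 + \<omega>\<^sup>2) = ?s * (1 - ?s)"
        by (simp add: complex_eq_iff power2_eq_square)
      thus ?thesis by (metis of_real_1 of_real_divide)
    qed
    have "- h ?s = (?s powr (- of_real \<nu>) - 1 / ?s\<^sup>2) / (1 - ?s)"
    proof -
      have "h ?s = k ?s / (?s - 1)" using n1(1) by (simp add: h_def k1)
      hence "- h ?s = k ?s / (1 - ?s)" by (metis minus_diff_eq minus_divide_right)
      thus ?thesis by (simp only: k_def p2)
    qed
    moreover have "1 / (?s * (1 - ?s)) + 1 / ?s\<^sup>2 = 1 / ?s\<^sup>2 / (1 - ?s)"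
      using n1 by (simp add: divide_simps power2_eq_square)
    ultimately show ?thesis unfolding q p2 by (simp add: diff_divide_distrib)
  qed
  have "has_bochner_integral lborel (\<lambda>\<omega>. - h (Complex (1/2) \<omega>) + (of_real (1 / ((1/2)\<^sup>2 + \<omega>\<^sup>2)) + Complex (1/2) \<omega> powr (- of_real 2)))
      (- vline_integral h (1/2) + (of_real (pi / (1/2)) + vline_integral (\<lambda>s. s powr (- of_real 2)) (1/2)))"
    unfolding vline_integral_def
    by (intro has_bochner_integral_add has_bochner_integral_minus has_bochner_integral_integrable ih isq hq)
  hence "vline_integral (\<lambda>s. s powr (- of_real \<nu>) / (1 - s)) (1/2) =
     - vline_integral h (1/2) + (of_real (pi / (1/2)) + vline_integral (\<lambda>s. s powr (- of_real 2)) (1/2))"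
    unfolding vline_integral_def eq by (rule has_bochner_integral_integral_eq)
  thus ?thesis unfolding h0 sq0 by simp
qed

text \<open>Fubini for exp(-t (1 - s)) s^(-\<nu>) over t > 0 and the line Re s = 1/2. Integrating in
  t first gives the resolvent integral 2 pi; integrating along the line first gives, by scaling,
  t^(\<nu> - 1) exp(-t) times the value sought, and the t-integral is then Gamma \<nu>.\<close>

lemma vline_integral_exp_powr:
  assumes nu: "\<nu> \<ge> 2" and "\<sigma> > 0"
  shows "vline_integral (\<lambda>s. exp s * s powr (- of_real \<nu>)) \<sigma> = of_real (2 * pi / Gamma \<nu>)"
proof -
  let ?s = "\<lambda>\<omega>. Complex (1/2) \<omega>"
  let ?p = "\<lambda>\<omega>. ?s \<omega> powr (- of_real \<nu>)"
  define f where "f = (\<lambda>(t::real) \<omega>. (indicator {0<..} t *\<^sub>R exp (- (of_real t * (1 - ?s \<omega>)))) * ?p \<omega>)"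
  have contp: "continuous_on {s. Re s > 0} (\<lambda>s. s powr (- of_real \<nu>))"
    by (intro holomorphic_on_imp_continuous_on holomorphic_powr_half_plane)
  have ip: "integrable lborel ?p"
    by (rule vline_integral_bound(1)[OF contp, where B = "(1/2) powr (2 - \<nu>)"])
       (use nu in \<open>simp_all add: norm_powr_minus_le\<close>)
  \<comment> \<open>Re (1 - s) = 1/2 along the whole line, so the modulus is a product of a function
    of t and a function of \<omega>; integrability on the product follows from the two
    factors.\<close>
  have nf: "norm (f t \<omega>) = norm (indicator {0<..} t *\<^sub>R exp (- (of_real t * (1/2))) :: complex) * norm (?p \<omega>)" for t \<omega>
    by (simp add: f_def norm_mult indicator_def)
  have expint: "integrable lborel (\<lambda>t. indicator {0<..} t *\<^sub>R exp (- (of_real t * z)))" if "Re z > 0" for z :: complex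
    using has_bochner_integral_exp_half_line[OF that] by (simp add: has_bochner_integral_iff)
  have meas: "case_prod f \<in> borel_measurable (lborel \<Otimes>\<^sub>M lborel)"
  proof -
    have [measurable]: "?p \<in> borel_measurable lborel" using ip by (rule borel_measurable_integrable)
    have [measurable]: "?s \<in> borel_measurable borel"
      by (intro borel_measurable_continuous_onI continuous_intros)
    have "(\<lambda>x. (indicator {0<..} (fst x) *\<^sub>R exp (- (complex_of_real (fst x) * (1 - ?s (snd x))))) * ?p (snd x))
        \<in> borel_measurable (lborel \<Otimes>\<^sub>M lborel)" by measurable
    thus ?thesis by (simp add: f_def case_prod_beta)
  qed
  have "integrable (lborel \<Otimes>\<^sub>M lborel) (case_prod f)"
  proof (rule lborel_pair.Fubini_integrable[OF meas])
    show "integrable lborel (\<lambda>x. LINT y|lborel. norm (case_prod f (x, y)))"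
      unfolding case_prod_conv nf using expint[of "1/2"] by (simp only: integral_mult_right_zero)
        (intro integrable_mult_left integrable_norm, simp)
    have "integrable lborel (f t)" for t
    proof (rule Bochner_Integration.integrable_bound[OF integrable_mult_right[OF integrable_norm[OF ip]]])
      show "f t \<in> borel_measurable lborel"
        using measurable_Pair_compose_split[OF meas, of "\<lambda>_. t" lborel "\<lambda>x. x"] by simp
      show "AE x in lborel. norm (f t x) \<le> norm (norm (indicator {0<..} t *\<^sub>R exp (- (of_real t * (1/2))) :: complex) * norm (?p x))"
        unfolding nf by (intro AE_I2) simp
    qed
    thus "AE x in lborel. integrable lborel (\<lambda>y. case_prod f (x, y))" by simp
  qed
  hence "(LINT \<omega>|lborel. LINT t|lborel. f t \<omega>) = (LINT t|lborel. LINT \<omega>|lborel. f t \<omega>)"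
    by (rule lborel_pair.Fubini_integral)
  moreover have "(LINT t|lborel. f t \<omega>) = ?p \<omega> / (1 - ?s \<omega>)" for \<omega>
  proof -
    have E: "(LINT t|lborel. indicator {0<..} t *\<^sub>R exp (- (complex_of_real t * (1 - ?s \<omega>)))) = 1 / (1 - ?s \<omega>)"
      by (intro has_bochner_integral_integral_eq has_bochner_integral_exp_half_line) simp
    show ?thesis unfolding f_def case_prod_conv integral_mult_left_zero E by simp
  qed
  moreover have "(LINT \<omega>|lborel. f t \<omega>) = of_real (indicator {0<..} t * (t powr (\<nu> - 1) * exp (- t))) *
       vline_integral (\<lambda>s. exp s * s powr (- of_real \<nu>)) 1" for t
  proof (cases "t > 0")
    case True
    have "f t \<omega> = of_real (exp (- t)) * (exp (of_real t * ?s \<omega>) * ?p \<omega>)" for \<omega>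
    proof -
      have "- (of_real t * (1 - ?s \<omega>)) = of_real (- t) + of_real t * ?s \<omega>" by (simp add: algebra_simps)
      thus ?thesis using True by (simp only: f_def exp_add exp_of_real) simp
    qed
    hence "(LINT \<omega>|lborel. f t \<omega>) = of_real (exp (- t)) * vline_integral (\<lambda>s. exp (of_real t * s) * s powr (- of_real \<nu>)) (1/2)"
      by (simp add: vline_integral_def)
    thus ?thesis using True by (simp add: vline_integral_exp_powr_scale[OF nu])
  qed (simp add: f_def)
  ultimately have "vline_integral (\<lambda>s. s powr (- of_real \<nu>) / (1 - s)) (1/2) =
     (LINT t|lborel. complex_of_real (indicator {0<..} t * (t powr (\<nu> - 1) * exp (- t)))) * 
       vline_integral (\<lambda>s. exp s * s powr (- of_real \<nu>)) 1"
    by (simp only: vline_integral_def integral_mult_left_zero)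
  also have "(LINT t|lborel. complex_of_real (indicator {0<..} t * (t powr (\<nu> - 1) * exp (- t)))) = of_real (Gamma \<nu>)"
    using has_bochner_integral_integral_eq[OF has_bochner_integral_Gamma, of \<nu>] nu
    unfolding integral_complex_of_real by simp
  finally have "of_real (Gamma \<nu>) * vline_integral (\<lambda>s. exp s * s powr (- of_real \<nu>)) 1 = of_real (2 * pi)"
    by (simp only: vline_integral_powr_resolvent[OF nu])
  moreover have "Gamma \<nu> > 0" using nu by (intro Gamma_real_pos) auto
  ultimately have "vline_integral (\<lambda>s. exp s * s powr (- of_real \<nu>)) 1 = of_real (2 * pi / Gamma \<nu>)"
    by (simp add: field_simps)
  thus ?thesis using vline_integral_exp_powr_indep[OF nu, of \<sigma> 1] assms by simp
qed

section \<open>Decay of Mittag-Leffler functions\<close>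

text \<open>The binomial series for exponent -(m + 1), where negating the upper index turns the
  generalized coefficients into ordinary ones.\<close>

lemma neg_binomial_sums:
  fixes x :: complex
  assumes "norm x < 1"
  shows "(\<lambda>k. of_nat ((k + m) choose m) * x ^ k) sums (1 / (1 - x) ^ Suc m)"
proof -
  have x1: "1 - x \<noteq> 0" using assms by auto
  have "(\<lambda>k. ((- of_nat (Suc m)) gchoose k) * (- x) ^ k) sums (1 + - x) powr (- of_nat (Suc m))"
    using assms by (intro gen_binomial_complex) simp
  moreover have "((- of_nat (Suc m)) gchoose k) * (- x) ^ k = of_nat ((k + m) choose m) * x ^ k" for k
  proof -
    have "((- of_nat (Suc m)) gchoose k :: complex) = (- 1) ^ k * (of_nat (k + m) gchoose k)"
      by (subst gbinomial_minus) (simp add: add_ac)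
    also have "(of_nat (k + m) gchoose k :: complex) = of_nat ((k + m) choose m)"
      using binomial_symmetric[of k "k + m"] by (simp only: binomial_gbinomial[symmetric]) simp
    finally show ?thesis by (simp add: power_minus[of x] mult_ac)
  qed
  moreover have "(1 + - x) powr (- of_nat (Suc m)) = 1 / (1 - x) ^ Suc m"
  proof -
    have "(1 - x) powr (- of_nat (Suc m)) = inverse ((1 - x) powr of_nat (Suc m))" by (rule powr_minus)
    also have "(1 - x) powr of_nat (Suc m) = (1 - x) ^ Suc m" using x1 by (metis powr_nat')
    finally show ?thesis by (simp add: divide_inverse)
  qed
  ultimately show ?thesis by (simp only:)
qed

lemma neg_binomial_summable:
  fixes x :: real
  assumes "\<bar>x\<bar> < 1"
  shows "summable (\<lambda>k. of_nat ((k + m) choose m) * x ^ k)"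
proof -
  have "(\<lambda>k. of_nat ((k + m) choose m) * complex_of_real x ^ k) sums (1 / (1 - complex_of_real x) ^ Suc m)"
    using assms by (intro neg_binomial_sums) simp
  hence "summable (\<lambda>k. complex_of_real (of_nat ((k + m) choose m) * x ^ k))"
    by (simp add: sums_iff)
  thus ?thesis by (simp only: summable_complex_of_real)
qed

text \<open>For Re s > 0 the argument of s^\<alpha> is at most \<alpha> pi / 2 < pi in absolute
  value, so s^\<alpha> never points opposite to \<open>l\<close>. With \<kappa> = -cos(\<alpha> pi /
  2) in (0, 1) and r = |s|^\<alpha>, the law of cosines bounds the squared modulus below by
  \<open>r\<^sup>2 + l\<^sup>2 - 2 \<kappa> r l\<close>, which equals (1 - \<kappa>)/2 times the
  square of r + l plus (1 + \<kappa>)/2 times the square of r - l.\<close>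

lemma norm_powr_add_ge:
  fixes \<alpha> :: real
  assumes "1 < \<alpha>" "\<alpha> < 2"
  obtains c where "c > 0"
    "\<And>s l. Re s > 0 \<Longrightarrow> l \<ge> 0 \<Longrightarrow> c * (norm s powr \<alpha> + l) \<le> norm (s powr of_real \<alpha> + of_real l)"
proof
  define \<kappa> where "\<kappa> = - cos (\<alpha> * pi / 2)"
  have k1: "\<kappa> < 1"
  proof -
    have "cos pi < cos (\<alpha> * pi / 2)" using assms by (intro cos_monotone_0_pi) auto
    thus ?thesis by (simp add: \<kappa>_def)
  qed
  have k0: "\<kappa> > 0"
  proof -
    have "cos (\<alpha> * pi / 2) < cos (pi / 2)" using assms by (intro cos_monotone_0_pi) auto
    thus ?thesis by (simp add: \<kappa>_def)
  qed
  show "sqrt ((1 - \<kappa>) / 2) > 0" using k1 by simp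
  fix s :: complex and l :: real
  assume s: "Re s > 0" and l: "l \<ge> 0"
  have s0: "s \<noteq> 0" using s by auto
  define r where "r = norm s powr \<alpha>"
  define \<theta> where "\<theta> = \<alpha> * Im (Ln s)"
  have th: "\<bar>\<theta>\<bar> \<le> \<alpha> * pi / 2"
    using Re_Ln_pos_lt[OF s0] s assms by (simp add: \<theta>_def abs_mult)
  have "\<alpha> * pi / 2 \<le> pi" using assms by simp
  hence "cos (\<alpha> * pi / 2) \<le> cos \<bar>\<theta>\<bar>" using th by (intro cos_monotone_0_pi_le) auto
  hence cs: "cos \<theta> \<ge> - \<kappa>" by (simp add: \<kappa>_def)
  have r0: "r \<ge> 0" by (simp add: r_def)
  have "s powr of_real \<alpha> = exp (of_real \<alpha> * Ln s)" using s0 by (simp add: powr_def)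
  moreover have "exp (\<alpha> * Re (Ln s)) = r" using s0 by (simp add: r_def powr_def)
  ultimately have re: "Re (s powr of_real \<alpha>) = r * cos \<theta>" and im: "Im (s powr of_real \<alpha>) = r * sin \<theta>"
    by (simp_all add: Re_exp Im_exp \<theta>_def)
  have "(norm (s powr of_real \<alpha> + of_real l))\<^sup>2 = (r * cos \<theta> + l)\<^sup>2 + (r * sin \<theta>)\<^sup>2"
    by (simp add: cmod_power2 re im)
  also have "\<dots> = r\<^sup>2 * ((sin \<theta>)\<^sup>2 + (cos \<theta>)\<^sup>2) + l\<^sup>2 + 2 * (r * l) * cos \<theta>"
    by (simp only: power2_eq_square algebra_simps) 
  also have "\<dots> = r\<^sup>2 + l\<^sup>2 + 2 * (r * l) * cos \<theta>" by simp
  finally have eq: "(norm (s powr of_real \<alpha> + of_real l))\<^sup>2 = r\<^sup>2 + l\<^sup>2 + 2 * (r * l) * cos \<theta>" .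
  have "2 * (r * l) * (- \<kappa>) \<le> 2 * (r * l) * cos \<theta>"
    using cs r0 l by (intro mult_left_mono) auto
  with eq have "(norm (s powr of_real \<alpha> + of_real l))\<^sup>2 \<ge> r\<^sup>2 + l\<^sup>2 + 2 * (r * l) * (- \<kappa>)" by simp
  moreover have "r\<^sup>2 + l\<^sup>2 + 2 * (r * l) * (- \<kappa>) = (1 - \<kappa>) / 2 * (r + l)\<^sup>2 + (1 + \<kappa>) / 2 * (r - l)\<^sup>2"
    by (simp add: field_simps power2_eq_square)
  moreover have "(1 + \<kappa>) / 2 * (r - l)\<^sup>2 \<ge> 0" using k0 by simp
  ultimately have "(sqrt ((1 - \<kappa>) / 2) * (r + l))\<^sup>2 \<le> (norm (s powr of_real \<alpha> + of_real l))\<^sup>2"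
    using k1 by (simp add: power_mult_distrib)
  thus "sqrt ((1 - \<kappa>) / 2) * (norm s powr \<alpha> + l) \<le> norm (s powr of_real \<alpha> + of_real l)"
    unfolding r_def by (rule power2_le_imp_le) simp
qed

text \<open>The three-parameter (Prabhakar) Mittag-Leffler function with third parameter m + 1: the
  binomial coefficient is the rising factorial of m + 1 divided by k!. For m = 0 it is the ordinary
  Mittag-Leffler function.\<close>

definition prabhakar :: "real \<Rightarrow> nat \<Rightarrow> real \<Rightarrow> real \<Rightarrow> real" where
  "prabhakar \<alpha> m \<beta> z = (\<Sum>k. of_nat ((k + m) choose m) * z ^ k / Gamma (real k * \<alpha> + \<beta>))"

text \<open>The Bromwich integral: \<open>s\<^sup>-\<^sup>\<beta> (s\<^sup>\<alpha> / (s\<^sup>\<alpha> + l))\<^sup>m\<^sup>+\<^sup>1\<close> is the Laplace transform of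
  \<open>t\<^sup>\<beta>\<^sup>-\<^sup>1 prabhakar \<alpha> m \<beta> (- l t\<^sup>\<alpha>)\<close>, inverted at \<open>t = 1\<close>. The geometric expansion needs a line far to
  the right; the line is then moved to \<open>Re s = 1\<close>.\<close>

lemma prabhakar_sums_vline_integral:
  assumes al: "1 < \<alpha>" "\<alpha> < 2" and be: "\<beta> \<ge> 2" and l: "l \<ge> 0"
  shows "(\<lambda>k. of_real (of_nat ((k + m) choose m) * (- l) ^ k / Gamma (real k * \<alpha> + \<beta>)))
    sums (vline_integral (\<lambda>s. exp s * s powr (- of_real \<beta>) * (s powr of_real \<alpha> / (s powr of_real \<alpha> + of_real l)) ^ Suc m) 1
          / of_real (2 * pi))"
proof -
  define g where "g = (\<lambda>s::complex. exp s * s powr (- of_real \<beta>) * (s powr of_real \<alpha> / (s powr of_real \<alpha> + of_real l)) ^ Suc m)"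
  obtain c where c: "c > 0"
    "\<And>s l. Re s > 0 \<Longrightarrow> l \<ge> 0 \<Longrightarrow> c * (norm s powr \<alpha> + l) \<le> norm (s powr of_real \<alpha> + of_real l)"
    using norm_powr_add_ge[OF al] by metis
  have den: "s powr of_real \<alpha> + of_real l \<noteq> 0" if "Re s > 0" for s
  proof -
    have "s \<noteq> 0" using that by auto
    hence "0 < c * (norm s powr \<alpha> + l)" using c(1) l by (intro mult_pos_pos add_pos_nonneg) auto
    thus ?thesis using c(2)[OF that l] by auto
  qed
  \<comment> \<open>Far enough to the right for the geometric expansion: \<sigma> \<ge> 1 and
    \<alpha> > 1 give \<sigma>^\<alpha> \<ge> \<sigma> > l, so the ratio l |s|^(-\<alpha>) is at
    most \<open>?q\<close> < 1 on the entire line.\<close>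
  define \<sigma> where "\<sigma> = l + 1"
  have sg: "\<sigma> \<ge> 1" "\<sigma> > 0" using l by (auto simp: \<sigma>_def)
  have sga: "\<sigma> powr \<alpha> > l"
  proof -
    have "\<sigma> powr 1 \<le> \<sigma> powr \<alpha>" using sg al by (intro powr_mono) auto
    thus ?thesis using sg by (simp add: \<sigma>_def)
  qed
  define b where "b = (\<lambda>k. of_nat ((k + m) choose m) * (- l) ^ k)"
  define \<nu> where "\<nu> = (\<lambda>k. real k * \<alpha> + \<beta>)"
  have nu: "\<nu> k \<ge> 2" for k
  proof -
    have "0 \<le> real k * \<alpha>" using al by simp
    thus ?thesis using be by (simp add: \<nu>_def)
  qed
  define e where "e = (\<lambda>k (s::complex). exp s * s powr (- of_real (\<nu> k)))"
  have conte: "continuous_on {s. Re s > 0} (e k)" for k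
    unfolding e_def by (intro holomorphic_on_imp_continuous_on holomorphic_intros)
  have be: "norm (e k (Complex \<sigma> \<omega>)) \<le> (exp \<sigma> * \<sigma> powr (2 - \<nu> k)) / (norm (Complex \<sigma> \<omega>))\<^sup>2" for k \<omega>
    unfolding e_def using exp_powr_bound[OF nu sg(2), of "Complex \<sigma> \<omega>" \<sigma> 1] by simp
  note ve = vline_integral_bound[OF conte sg(2) be]
  define f where "f = (\<lambda>k \<omega>. of_real (b k) * e k (Complex \<sigma> \<omega>))"
  have fi: "integrable lborel (f k)" for k unfolding f_def using ve(1) by (intro integrable_mult_right)
  let ?q = "l * \<sigma> powr (- \<alpha>)"
  have q: "0 \<le> ?q" "?q < 1" using l sga sg by (auto simp: powr_minus field_simps)
  have pe: "s powr (- of_real (\<nu> k)) = s powr (- of_real \<beta>) * (s powr (- of_real \<alpha>)) ^ k" if "s \<noteq> 0" for k and s :: complex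
  proof -
    have "- of_real (\<nu> k) * Ln s = - of_real \<beta> * Ln s + of_nat k * (- of_real \<alpha> * Ln s)"
      by (simp add: \<nu>_def algebra_simps)
    thus ?thesis using that unfolding powr_def by (simp only: exp_add exp_of_nat_mult if_False)
  qed
  have main: "(\<lambda>k. f k \<omega>) sums g (Complex \<sigma> \<omega>)" "summable (\<lambda>k. norm (f k \<omega>))" for \<omega>
  proof -
    let ?s = "Complex \<sigma> \<omega>"
    have s0: "?s \<noteq> 0" "Re ?s > 0" using sg by (auto simp: complex_eq_iff)
    define x where "x = - of_real l * ?s powr (- of_real \<alpha>)"
    have "norm (?s powr (- of_real \<alpha>)) = norm ?s powr (- \<alpha>)" by (subst norm_powr_real_powr') auto
    also have "\<dots> \<le> \<sigma> powr (- \<alpha>)"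
      using complex_Re_le_cmod[of ?s] sg al by (intro powr_mono2') auto
    finally have "norm x \<le> ?q" using l by (simp add: x_def norm_mult mult_left_mono)
    hence x1: "norm x < 1" using q by simp
    have fx: "f k \<omega> = exp ?s * ?s powr (- of_real \<beta>) * (of_nat ((k + m) choose m) * x ^ k)" for k
      unfolding f_def b_def e_def pe[OF s0(1)] x_def power_mult_distrib
      by (simp only: of_real_mult of_real_power of_real_minus of_real_of_nat_eq mult_ac)
    have "1 - x = (?s powr of_real \<alpha> + of_real l) / ?s powr of_real \<alpha>"
      using s0 by (simp add: x_def powr_minus field_simps)
    hence "1 / (1 - x) ^ Suc m = (?s powr of_real \<alpha> / (?s powr of_real \<alpha> + of_real l)) ^ Suc m"
      by (simp only: power_divide) simp
    with neg_binomial_sums[OF x1, of m] show "(\<lambda>k. f k \<omega>) sums g (Complex \<sigma> \<omega>)"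
      unfolding fx g_def by (intro sums_mult) simp
    have "summable (\<lambda>k. norm (exp ?s * ?s powr (- of_real \<beta>)) * (of_nat ((k + m) choose m) * norm x ^ k))"
      using x1 by (intro summable_mult neg_binomial_summable) simp
    thus "summable (\<lambda>k. norm (f k \<omega>))"
      unfolding fx by (simp add: norm_mult norm_power mult.assoc)
  qed
  \<comment> \<open>Termwise integration needs summable L1 norms; moving from index 0 to k
    multiplies the majorant by the binomial coefficient and \<open>?q ^ k\<close>, so a negative
    binomial series dominates.\<close>
  have sumint: "summable (\<lambda>k. LINT \<omega>|lborel. norm (f k \<omega>))"
  proof (rule summable_comparison_test')
    show "summable (\<lambda>k. (exp \<sigma> * \<sigma> powr (2 - \<beta>) * (pi / \<sigma>)) * (of_nat ((k + m) choose m) * ?q ^ k))"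
      using q by (intro summable_mult neg_binomial_summable) auto
    fix k :: nat assume "k \<ge> 0"
    have "(LINT \<omega>|lborel. norm (f k \<omega>)) = \<bar>b k\<bar> * (LINT \<omega>|lborel. norm (e k (Complex \<sigma> \<omega>)))"
      by (simp add: f_def norm_mult)
    also have "\<dots> \<le> \<bar>b k\<bar> * ((exp \<sigma> * \<sigma> powr (2 - \<nu> k)) * (pi / \<sigma>))"
      by (intro mult_left_mono ve(3)) simp
    also have "\<sigma> powr (2 - \<nu> k) = \<sigma> powr (2 - \<beta>) * (\<sigma> powr (- \<alpha>)) ^ k"
      using sg by (simp add: powr_def \<nu>_def ring_distribs exp_add exp_diff exp_minus divide_simps flip: exp_of_nat_mult)
    also have "\<bar>b k\<bar> * ((exp \<sigma> * (\<sigma> powr (2 - \<beta>) * (\<sigma> powr (- \<alpha>)) ^ k)) * (pi / \<sigma>)) =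
      (exp \<sigma> * \<sigma> powr (2 - \<beta>) * (pi / \<sigma>)) * (of_nat ((k + m) choose m) * ?q ^ k)"
      using l by (simp add: b_def abs_mult power_abs power_mult_distrib)
    finally show "norm (LINT \<omega>|lborel. norm (f k \<omega>)) \<le> (exp \<sigma> * \<sigma> powr (2 - \<beta>) * (pi / \<sigma>)) * (of_nat ((k + m) choose m) * ?q ^ k)"
      by simp
  qed
  have "(\<lambda>k. LINT \<omega>|lborel. f k \<omega>) sums (LINT \<omega>|lborel. (\<Sum>k. f k \<omega>))"
    by (rule sums_integral) (use fi main sumint in auto)
  moreover have "(LINT \<omega>|lborel. (\<Sum>k. f k \<omega>)) = vline_integral g \<sigma>"
    unfolding vline_integral_def using main(1) by (simp add: sums_iff)
  moreover have "(LINT \<omega>|lborel. f k \<omega>) = of_real (b k) * of_real (2 * pi / Gamma (\<nu> k))" for k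
    using vline_integral_exp_powr[OF nu sg(2), of k] by (simp add: f_def e_def vline_integral_def)
  ultimately have "(\<lambda>k. of_real (b k) * of_real (2 * pi / Gamma (\<nu> k))) sums vline_integral g \<sigma>" by simp
  \<comment> \<open>Staying at \<sigma> = l + 1 would leave a factor exp(l + 1) in every estimate; a
    line independent of l is what makes uniform bounds possible. The summed integrand, unlike the
    series, is holomorphic on the whole half plane.\<close>
  also have "vline_integral g \<sigma> = vline_integral g 1"
  proof (rule sym, rule vline_integral_shift)
    show "g holomorphic_on {s. Re s > 0}"
      unfolding g_def using den by (intro holomorphic_intros) auto
    fix s assume s: "1 \<le> Re s" "Re s \<le> \<sigma>"
    hence s0: "Re s > 0" "s \<noteq> 0" by auto
    have "norm (s powr of_real \<alpha> / (s powr of_real \<alpha> + of_real l)) \<le> 1 / c"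
    proof -
      have "c * norm s powr \<alpha> \<le> c * (norm s powr \<alpha> + l)" using c(1) l by (intro mult_left_mono) auto
      also note c(2)[OF s0(1) l]
      finally have "norm (s powr of_real \<alpha>) * c \<le> norm (s powr of_real \<alpha> + of_real l)"
        by (subst norm_powr_real_powr') (auto simp: mult_ac)
      thus ?thesis using c(1) den[OF s0(1)] by (simp add: norm_divide divide_simps mult_ac)
    qed
    hence "norm (s powr of_real \<alpha> / (s powr of_real \<alpha> + of_real l)) ^ Suc m \<le> (1 / c) ^ Suc m"
      by (intro power_mono) auto
    moreover have "norm (exp s * s powr (- of_real \<beta>)) \<le> (exp (1 * \<sigma>) * 1 powr (2 - \<beta>)) / (norm s)\<^sup>2"
      using exp_powr_bound[of \<beta> 1 s \<sigma> 1] assms s by simp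
    ultimately have "norm (g s) \<le> ((exp (1 * \<sigma>) * 1 powr (2 - \<beta>)) / (norm s)\<^sup>2) * (1 / c) ^ Suc m"
      unfolding g_def norm_mult[of "_ * _"] norm_power by (intro mult_mono) auto
    thus "norm (g s) \<le> (exp \<sigma> * (1 / c) ^ Suc m) / (norm s)\<^sup>2" by (simp add: mult_ac)
  qed (use sg in auto)
  finally have "(\<lambda>k. of_real (b k) * of_real (2 * pi / Gamma (\<nu> k)) / of_real (2 * pi)) sums (vline_integral g 1 / of_real (2 * pi))"
    by (rule sums_divide)
  moreover have "complex_of_real (b k) * of_real (2 * pi / Gamma (\<nu> k)) / of_real (2 * pi) = of_real (b k / Gamma (\<nu> k))" for k
    by (simp flip: of_real_mult of_real_divide)
  ultimately show ?thesis by (simp only: b_def \<nu>_def g_def)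
qed

text \<open>Of the m + 1 factors s^\<alpha> / (s^\<alpha> + l), m are bounded by 1/c and one is
  spent on the decay in l, at the price of |s|^\<alpha>. On Re s = 1, where |s| \<ge> 1, the
  resulting |s|^(\<alpha> - \<beta>) is at most |s|^(-2), as \<beta> \<ge> 4 and \<alpha> <
  2.\<close>

lemma prabhakar_bound_large:
  assumes al: "1 < \<alpha>" "\<alpha> < 2" and be: "\<beta> \<ge> 4"
  shows "\<exists>C. \<forall>l\<ge>0. summable (\<lambda>k. of_nat ((k + m) choose m) * (- l) ^ k / Gamma (real k * \<alpha> + \<beta>)) \<and>
             \<bar>prabhakar \<alpha> m \<beta> (- l)\<bar> * (1 + l) \<le> C"
proof -
  obtain c where c: "c > 0"
    "\<And>s l. Re s > 0 \<Longrightarrow> l \<ge> 0 \<Longrightarrow> c * (norm s powr \<alpha> + l) \<le> norm (s powr of_real \<alpha> + of_real l)"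
    using norm_powr_add_ge[OF al] by metis
  have be2: "\<beta> \<ge> 2" using be by simp
  show ?thesis
  proof (intro exI allI impI conjI)
    fix l :: real assume l: "l \<ge> 0"
    let ?a = "\<lambda>k. of_nat ((k + m) choose m) * (- l) ^ k / Gamma (real k * \<alpha> + \<beta>)"
    define g where "g = (\<lambda>s::complex. exp s * s powr (- of_real \<beta>) * (s powr of_real \<alpha> / (s powr of_real \<alpha> + of_real l)) ^ Suc m)"
    have S: "(\<lambda>k. complex_of_real (?a k)) sums (vline_integral g 1 / of_real (2 * pi))"
      unfolding g_def by (rule prabhakar_sums_vline_integral[OF al be2 l])
    hence "summable (\<lambda>k. complex_of_real (?a k))" by (simp only: sums_iff)
    thus sm: "summable ?a" by (simp only: summable_complex_of_real)
    hence "?a sums prabhakar \<alpha> m \<beta> (- l)" unfolding prabhakar_def by (rule summable_sums)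
    hence "(\<lambda>k. complex_of_real (?a k)) sums of_real (prabhakar \<alpha> m \<beta> (- l))" by (rule sums_of_real)
    hence eq: "complex_of_real (prabhakar \<alpha> m \<beta> (- l)) = vline_integral g 1 / of_real (2 * pi)"
      using S sums_unique2 by blast
    have den: "s powr of_real \<alpha> + of_real l \<noteq> 0" if "Re s > 0" for s
    proof -
      have "s \<noteq> 0" using that by auto
      hence "0 < c * (norm s powr \<alpha> + l)" using c(1) l by (intro mult_pos_pos add_pos_nonneg) auto
      thus ?thesis using c(2)[OF that l] by auto
    qed
    have V: "norm (vline_integral g 1) \<le> (exp 1 * (1 / c) ^ m * (2 / (c * (1 + l)))) * (pi / 1)"
    proof (rule vline_integral_bound(2))
      show "continuous_on {s. Re s > 0} g"
        unfolding g_def using den by (intro holomorphic_on_imp_continuous_on holomorphic_intros) auto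
      fix \<omega> :: real
      let ?s = "Complex 1 \<omega>"
      have s0: "Re ?s > 0" "?s \<noteq> 0" by (auto simp: complex_eq_iff)
      have s1: "norm ?s \<ge> 1" using complex_Re_le_cmod[of ?s] by simp
      let ?n = "norm ?s powr \<alpha>"
      let ?w = "?s powr of_real \<alpha> / (?s powr of_real \<alpha> + of_real l)"
      have n1: "?n \<ge> 1" using s1 al by (intro ge_one_powr_ge_zero) auto
      have w: "norm ?w \<le> ?n / (c * (?n + l))"
      proof -
        have p: "0 < c * (?n + l)" using c(1) l n1 by (intro mult_pos_pos) auto
        have "norm ?w = ?n / norm (?s powr of_real \<alpha> + of_real l)"
          unfolding norm_divide by (subst norm_powr_real_powr') auto
        also have "\<dots> \<le> ?n / (c * (?n + l))"
          using c(2)[OF s0(1) l] p by (intro divide_left_mono) (auto intro!: mult_pos_pos intro: less_le_trans)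
        finally show ?thesis .
      qed
      have w1: "norm ?w \<le> 1 / c"
      proof (rule order.trans[OF w])
        have "?n / (c * (?n + l)) \<le> ?n / (c * ?n)"
          using c(1) l n1 by (intro divide_left_mono mult_left_mono mult_pos_pos) auto
        thus "?n / (c * (?n + l)) \<le> 1 / c" using n1 s0(2) by simp
      qed
      \<comment> \<open>The decay comes from |s|^\<alpha> + l \<ge> 1 + l. The factor 2 is slack,
        chosen to cancel the 2 in 2 pi at the end.\<close>
      have w2: "norm ?w \<le> ?n * (2 / (c * (1 + l)))"
      proof (rule order.trans[OF w])
        have "?n / (c * (?n + l)) \<le> ?n / (c * (1 + l))"
          using c(1) l n1 by (intro divide_left_mono mult_left_mono mult_pos_pos) auto
        also have "\<dots> \<le> ?n * (2 / (c * (1 + l)))"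
          using c(1) l n1 by (simp add: divide_simps)
        finally show "?n / (c * (?n + l)) \<le> ?n * (2 / (c * (1 + l)))" .
      qed
      have p: "norm (?s powr (- of_real \<beta>)) * ?n \<le> 1 / (norm ?s)\<^sup>2"
      proof -
        have "norm (?s powr (- of_real \<beta>)) = norm ?s powr (- \<beta>)" by (subst norm_powr_real_powr') auto
        hence "norm (?s powr (- of_real \<beta>)) * ?n = norm ?s powr (- \<beta> + \<alpha>)" by (simp only: powr_add)
        also have "\<dots> \<le> norm ?s powr (- 2)" using s1 be al by (intro powr_mono) auto
        also have "\<dots> = 1 / (norm ?s)\<^sup>2" using s1 by (intro powr_neg_numeral) linarith
        finally show ?thesis .
      qed
      have "norm (g ?s) = exp 1 * norm (?s powr (- of_real \<beta>)) * (norm ?w ^ m * norm ?w)"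
        unfolding g_def by (simp only: norm_mult norm_power power_Suc norm_exp_eq_Re complex.sel mult_ac)
      also have "\<dots> \<le> exp 1 * norm (?s powr (- of_real \<beta>)) * ((1 / c) ^ m * (?n * (2 / (c * (1 + l)))))"
        using w1 w2 c(1) by (intro mult_left_mono mult_mono power_mono) auto
      also have "\<dots> = (exp 1 * (1 / c) ^ m * (2 / (c * (1 + l)))) * (norm (?s powr (- of_real \<beta>)) * ?n)"
        by (simp only: mult_ac)
      also have "\<dots> \<le> (exp 1 * (1 / c) ^ m * (2 / (c * (1 + l)))) * (1 / (norm ?s)\<^sup>2)"
        using p c(1) l by (intro mult_left_mono) auto
      finally show "norm (g ?s) \<le> (exp 1 * (1 / c) ^ m * (2 / (c * (1 + l)))) / (norm ?s)\<^sup>2" by simp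
    qed simp
    have "\<bar>prabhakar \<alpha> m \<beta> (- l)\<bar> = norm (vline_integral g 1) / (2 * pi)"
      using arg_cong[OF eq, of norm] by (simp add: norm_divide)
    also have "\<dots> \<le> (exp 1 * (1 / c) ^ m * (2 / (c * (1 + l)))) * (pi / 1) / (2 * pi)"
      by (intro divide_right_mono V) simp
    also have "\<dots> = (exp 1 * (1 / c) ^ m / c) / (1 + l)" by simp
    finally show "\<bar>prabhakar \<alpha> m \<beta> (- l)\<bar> * (1 + l) \<le> exp 1 * (1 / c) ^ m / c"
      by (subst pos_le_divide_eq[symmetric]) (use l in simp_all)
  qed
qed

text \<open>Descending in \<open>\<beta>\<close>: since \<open>(k+m+1) ((k+m) choose m) = (m+1) ((k+m+1) choose (m+1))\<close>,
  writing \<open>1 / Gamma y = y / Gamma (y + 1)\<close> trades \<open>\<beta>\<close> for \<open>\<beta> + 1\<close> and \<open>m\<close> for \<open>m + 1\<close>.\<close>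

lemma prabhakar_bound:
  assumes al: "1 < \<alpha>" "\<alpha> < 2" and be: "\<beta> > 0"
  shows "\<exists>C. \<forall>l\<ge>0. summable (\<lambda>k. of_nat ((k + m) choose m) * (- l) ^ k / Gamma (real k * \<alpha> + \<beta>)) \<and>
             \<bar>prabhakar \<alpha> m \<beta> (- l)\<bar> * (1 + l) \<le> C"
proof -
  \<comment> \<open>\<open>n\<close> counts the unit steps from \<beta> up to the range where the
    integral estimate applies. \<open>m\<close> must vary in the induction, since each step also
    uses m + 1.\<close>
  have "\<beta> > 0 \<Longrightarrow> \<beta> + real n \<ge> 4 \<Longrightarrow> 
       \<exists>C. \<forall>l\<ge>0. summable (\<lambda>k. of_nat ((k + m) choose m) * (- l) ^ k / Gamma (real k * \<alpha> + \<beta>)) \<and>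
             \<bar>prabhakar \<alpha> m \<beta> (- l)\<bar> * (1 + l) \<le> C" for n
  proof (induction n arbitrary: \<beta> m)
    case 0
    thus ?case using prabhakar_bound_large[OF al] by simp
  next
    case (Suc n)
    define a where "a = (\<lambda>m \<beta> l k. of_nat ((k + m) choose m) * (- l) ^ k / Gamma (real k * \<alpha> + \<beta>))"
    define A where "A = \<alpha> * real (Suc m)"
    obtain C1 where C1: "\<And>l. l \<ge> 0 \<Longrightarrow> summable (a (Suc m) (\<beta> + 1) l) \<and> \<bar>prabhakar \<alpha> (Suc m) (\<beta> + 1) (- l)\<bar> * (1 + l) \<le> C1"
      using Suc.IH[of "\<beta> + 1" "Suc m"] Suc.prems unfolding a_def by auto
    obtain C2 where C2: "\<And>l. l \<ge> 0 \<Longrightarrow> summable (a m (\<beta> + 1) l) \<and> \<bar>prabhakar \<alpha> m (\<beta> + 1) (- l)\<bar> * (1 + l) \<le> C2"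
      using Suc.IH[of "\<beta> + 1" "m"] Suc.prems unfolding a_def by auto
    \<comment> \<open>The numerator y = k \<alpha> + \<beta> is split as \<alpha> (k + m + 1) +
      (\<beta> - A): the first summand is absorbed by the binomial coefficient of order m + 1, the
      second is constant in k.\<close>
    have rec: "a m \<beta> l k = A * a (Suc m) (\<beta> + 1) l k + (\<beta> - A) * a m (\<beta> + 1) l k" for l k
    proof -
      define y where "y = real k * \<alpha> + \<beta>"
      have y: "y > 0" using al Suc.prems(1) by (simp add: y_def add_nonneg_pos)
      have "Gamma (y + 1) = y * Gamma y" using y by (intro Gamma_plus1) (auto dest: nonpos_Ints_nonpos)
      moreover have "Gamma y > 0" "Gamma (y + 1) > 0" using y by (auto intro: Gamma_real_pos)
      ultimately have G: "1 / Gamma y = y / Gamma (y + 1)" using y by simp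
      have "real (Suc m) * real ((k + Suc m) choose Suc m) = real (k + Suc m) * real ((k + m) choose m)"
        using Suc_times_binomial_eq[of "k + m" m] by (simp only: add_Suc_right flip: of_nat_mult) (simp add: mult.commute)
      hence "A * real ((k + Suc m) choose Suc m) = \<alpha> * real (k + Suc m) * real ((k + m) choose m)"
        by (simp add: A_def)
      hence "A * real ((k + Suc m) choose Suc m) + (\<beta> - A) * real ((k + m) choose m) = y * real ((k + m) choose m)"
        by (simp add: y_def A_def algebra_simps)
      moreover have "a m \<beta> l k = real ((k + m) choose m) * (- l) ^ k * (1 / Gamma y)"
        by (simp add: a_def y_def)
      moreover have "A * a (Suc m) (\<beta> + 1) l k + (\<beta> - A) * a m (\<beta> + 1) l k =
        (A * real ((k + Suc m) choose Suc m) + (\<beta> - A) * real ((k + m) choose m)) * (- l) ^ k / Gamma (y + 1)"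
        unfolding a_def y_def by (simp only: add.assoc add_divide_distrib distrib_right) simp
      ultimately show ?thesis unfolding G by (simp add: mult_ac)
    qed
    show ?case
    proof (intro exI allI impI conjI)
      fix l :: real assume l: "l \<ge> 0"
      have "(\<lambda>k. A * a (Suc m) (\<beta> + 1) l k + (\<beta> - A) * a m (\<beta> + 1) l k) sums
            (A * prabhakar \<alpha> (Suc m) (\<beta> + 1) (- l) + (\<beta> - A) * prabhakar \<alpha> m (\<beta> + 1) (- l))"
        unfolding prabhakar_def using C1[OF l] C2[OF l]
        by (intro sums_add sums_mult) (auto simp: a_def intro: summable_sums)
      hence S: "a m \<beta> l sums (A * prabhakar \<alpha> (Suc m) (\<beta> + 1) (- l) + (\<beta> - A) * prabhakar \<alpha> m (\<beta> + 1) (- l))"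
        by (simp add: rec[symmetric])
      thus "summable (\<lambda>k. of_nat ((k + m) choose m) * (- l) ^ k / Gamma (real k * \<alpha> + \<beta>))"
        by (simp add: sums_iff a_def)
      have "prabhakar \<alpha> m \<beta> (- l) = A * prabhakar \<alpha> (Suc m) (\<beta> + 1) (- l) + (\<beta> - A) * prabhakar \<alpha> m (\<beta> + 1) (- l)"
        using S by (simp add: sums_iff a_def prabhakar_def)
      hence "\<bar>prabhakar \<alpha> m \<beta> (- l)\<bar> \<le> \<bar>A\<bar> * \<bar>prabhakar \<alpha> (Suc m) (\<beta> + 1) (- l)\<bar> + \<bar>\<beta> - A\<bar> * \<bar>prabhakar \<alpha> m (\<beta> + 1) (- l)\<bar>"
        by (simp only: abs_mult[symmetric] abs_triangle_ineq)
      hence "\<bar>prabhakar \<alpha> m \<beta> (- l)\<bar> * (1 + l) \<le>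
         (\<bar>A\<bar> * \<bar>prabhakar \<alpha> (Suc m) (\<beta> + 1) (- l)\<bar> + \<bar>\<beta> - A\<bar> * \<bar>prabhakar \<alpha> m (\<beta> + 1) (- l)\<bar>) * (1 + l)"
        using l by (intro mult_right_mono) auto
      also have "\<dots> = \<bar>A\<bar> * (\<bar>prabhakar \<alpha> (Suc m) (\<beta> + 1) (- l)\<bar> * (1 + l)) + \<bar>\<beta> - A\<bar> * (\<bar>prabhakar \<alpha> m (\<beta> + 1) (- l)\<bar> * (1 + l))"
        by (simp only: distrib_right mult.assoc)
      also have "\<dots> \<le> \<bar>A\<bar> * C1 + \<bar>\<beta> - A\<bar> * C2"
        using C1[OF l] C2[OF l] by (intro add_mono mult_left_mono) auto
      finally show "\<bar>prabhakar \<alpha> m \<beta> (- l)\<bar> * (1 + l) \<le> \<bar>A\<bar> * C1 + \<bar>\<beta> - A\<bar> * C2" .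
    qed
  qed
  from this[of 4] be show ?thesis by simp
qed

lemma mittag_leffler_bound:
  assumes "1 < \<alpha>" "\<alpha> < 2" "\<beta> > 0"
  shows "\<exists>C. \<forall>z\<ge>0. \<bar>mittag_leffler \<alpha> \<beta> (- z)\<bar> * (1 + z) \<le> C"
proof -
  have "mittag_leffler \<alpha> \<beta> z = prabhakar \<alpha> 0 \<beta> z" for z
    by (simp add: mittag_leffler_def prabhakar_def)
  thus ?thesis using prabhakar_bound[OF assms, of 0] by metis
qed

section \<open>Parseval identity\<close>

lemma L2_funD:
  assumes "f \<in> L2_fun \<Omega>"
  shows "f \<in> borel_measurable (lebesgue_on \<Omega>)" "integrable (lebesgue_on \<Omega>) (\<lambda>x. (f x)\<^sup>2)"
  using assms by (auto simp: L2_fun_def)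

lemma L2_fun_mult_integrable:
  assumes f: "f \<in> L2_fun \<Omega>" and g: "g \<in> L2_fun \<Omega>"
  shows "integrable (lebesgue_on \<Omega>) (\<lambda>x. f x * g x)"
proof (rule Bochner_Integration.integrable_bound)
  show "integrable (lebesgue_on \<Omega>) (\<lambda>x. (f x)\<^sup>2 + (g x)\<^sup>2)"
    using L2_funD[OF f] L2_funD[OF g] by simp
  show "(\<lambda>x. f x * g x) \<in> borel_measurable (lebesgue_on \<Omega>)"
    using L2_funD[OF f] L2_funD[OF g] by simp
  have "\<bar>a * b\<bar> \<le> a\<^sup>2 + b\<^sup>2" for a b :: real
  proof -
    have "2 * (\<bar>a\<bar> * \<bar>b\<bar>) \<le> a\<^sup>2 + b\<^sup>2" using sum_squares_bound[of "\<bar>a\<bar>" "\<bar>b\<bar>"] by simp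
    moreover have "0 \<le> \<bar>a\<bar> * \<bar>b\<bar>" by simp
    ultimately show ?thesis unfolding abs_mult by linarith
  qed
  thus "AE x in lebesgue_on \<Omega>. norm (f x * g x) \<le> norm ((f x)\<^sup>2 + (g x)\<^sup>2)"
    by (intro AE_I2) (simp add: abs_of_nonneg)
qed

lemma L2_fun_scale [intro]: "f \<in> L2_fun \<Omega> \<Longrightarrow> (\<lambda>x. c * f x) \<in> L2_fun \<Omega>"
  by (auto simp: L2_fun_def power_mult_distrib)

lemma L2_fun_add [intro]:
  assumes f: "f \<in> L2_fun \<Omega>" and g: "g \<in> L2_fun \<Omega>"
  shows "(\<lambda>x. f x + g x) \<in> L2_fun \<Omega>"
proof -
  have "(\<lambda>x. (f x + g x)\<^sup>2) = (\<lambda>x. (f x)\<^sup>2 + 2 * (f x * g x) + (g x)\<^sup>2)"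
    by (auto simp: fun_eq_iff power2_eq_square algebra_simps)
  thus ?thesis using L2_funD[OF f] L2_funD[OF g] L2_fun_mult_integrable[OF f g] by (simp add: L2_fun_def)
qed

lemma L2_fun_diff [intro]:
  assumes "f \<in> L2_fun \<Omega>" "g \<in> L2_fun \<Omega>"
  shows "(\<lambda>x. f x - g x) \<in> L2_fun \<Omega>"
  using L2_fun_add[OF assms(1) L2_fun_scale[OF assms(2), of "- 1"]] by simp

lemma L2_fun_zero [intro]: "(\<lambda>x. 0) \<in> L2_fun \<Omega>"
  by (simp add: L2_fun_def)

lemma L2_fun_sum [intro]: "(\<And>j. j \<in> A \<Longrightarrow> f j \<in> L2_fun \<Omega>) \<Longrightarrow> (\<lambda>x. \<Sum>j\<in>A. f j x) \<in> L2_fun \<Omega>"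
  by (induction A rule: infinite_finite_induct) auto

lemma L2_inner_commute: "L2_inner \<Omega> f g = L2_inner \<Omega> g f"
  by (simp add: L2_inner_def mult.commute)

lemma L2_inner_scale_left: "L2_inner \<Omega> (\<lambda>x. c * f x) g = c * L2_inner \<Omega> f g"
  by (simp add: L2_inner_def mult.assoc)

lemma L2_inner_add_left:
  assumes "f \<in> L2_fun \<Omega>" "g \<in> L2_fun \<Omega>" "h \<in> L2_fun \<Omega>"
  shows "L2_inner \<Omega> (\<lambda>x. f x + g x) h = L2_inner \<Omega> f h + L2_inner \<Omega> g h"
  using assms by (simp add: L2_inner_def distrib_right L2_fun_mult_integrable)

lemma L2_inner_diff_left:
  assumes "f \<in> L2_fun \<Omega>" "g \<in> L2_fun \<Omega>" "h \<in> L2_fun \<Omega>"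
  shows "L2_inner \<Omega> (\<lambda>x. f x - g x) h = L2_inner \<Omega> f h - L2_inner \<Omega> g h"
  using assms by (simp add: L2_inner_def left_diff_distrib L2_fun_mult_integrable)

lemma L2_inner_sum_left:
  assumes "\<And>j. j \<in> A \<Longrightarrow> f j \<in> L2_fun \<Omega>" "h \<in> L2_fun \<Omega>"
  shows "L2_inner \<Omega> (\<lambda>x. \<Sum>j\<in>A. f j x) h = (\<Sum>j\<in>A. L2_inner \<Omega> (f j) h)"
  using assms unfolding L2_inner_def sum_distrib_right
  by (intro Bochner_Integration.integral_sum L2_fun_mult_integrable)

lemma L2_inner_cong:
  assumes "L2_eq \<Omega> f g" "f \<in> L2_fun \<Omega>" "g \<in> L2_fun \<Omega>" "h \<in> L2_fun \<Omega>"
  shows "L2_inner \<Omega> f h = L2_inner \<Omega> g h"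
  unfolding L2_inner_def
proof (rule integral_cong_AE)
  show "AE x in lebesgue_on \<Omega>. f x * h x = g x * h x"
    using assms(1) unfolding L2_eq_def by eventually_elim simp
qed (use assms(2-4)[THEN L2_funD(1)] in auto)

lemma norm_L2_square: "(norm_L2 \<Omega> f)\<^sup>2 = L2_inner \<Omega> f f"
  by (simp add: norm_L2_def L2_inner_def power2_eq_square)

lemma norm_L2_nonneg [simp]: "norm_L2 \<Omega> f \<ge> 0"
  by (simp add: norm_L2_def)

lemma norm_L2_square_diff:
  assumes "f \<in> L2_fun \<Omega>" "g \<in> L2_fun \<Omega>"
  shows "(norm_L2 \<Omega> (\<lambda>x. f x - g x))\<^sup>2 = (norm_L2 \<Omega> f)\<^sup>2 - 2 * L2_inner \<Omega> f g + (norm_L2 \<Omega> g)\<^sup>2"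
proof -
  have d: "(\<lambda>x. f x - g x) \<in> L2_fun \<Omega>" using assms by auto
  show ?thesis
    unfolding norm_L2_square
    by (subst L2_inner_diff_left[OF assms d],
        subst (1 2) L2_inner_commute,
        simp add: L2_inner_diff_left[OF assms assms(1)] L2_inner_diff_left[OF assms assms(2)] L2_inner_commute[of _ g f])
qed

text \<open>Cauchy-Schwarz against a unit vector, from the nonnegative squared distance of
  \<open>f\<close> to its projection on \<open>e\<close>.\<close>

lemma L2_inner_unit_le:
  assumes "f \<in> L2_fun \<Omega>" "e \<in> L2_fun \<Omega>" "L2_inner \<Omega> e e = 1"
  shows "(L2_inner \<Omega> f e)\<^sup>2 \<le> (norm_L2 \<Omega> f)\<^sup>2"
proof -
  let ?c = "L2_inner \<Omega> f e"
  have "0 \<le> (norm_L2 \<Omega> (\<lambda>x. f x - ?c * e x))\<^sup>2" by simp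
  also have "\<dots> = (norm_L2 \<Omega> f)\<^sup>2 - 2 * L2_inner \<Omega> f (\<lambda>x. ?c * e x) + (norm_L2 \<Omega> (\<lambda>x. ?c * e x))\<^sup>2"
    using assms by (intro norm_L2_square_diff) auto
  also have "L2_inner \<Omega> f (\<lambda>x. ?c * e x) = ?c * ?c"
    by (subst L2_inner_commute, subst L2_inner_scale_left) (simp add: L2_inner_commute)
  also have "(norm_L2 \<Omega> (\<lambda>x. ?c * e x))\<^sup>2 = ?c * ?c"
    unfolding norm_L2_square L2_inner_scale_left
    by (subst L2_inner_commute, subst L2_inner_scale_left) (simp add: assms)
  finally show ?thesis by (simp add: power2_eq_square)
qed

text \<open>Taking the k-th coefficient is continuous in the L2 norm, and for n > k the k-th
  coefficient of every partial sum is already \<open>c k\<close>.\<close>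

lemma L2_sums_coeff:
  assumes phi: "\<And>j. \<phi> j \<in> L2_fun \<Omega>"
    and on: "\<And>i j. L2_inner \<Omega> (\<phi> i) (\<phi> j) = (if i = j then 1 else 0)"
    and s: "L2_sums \<Omega> (\<lambda>j x. c j * \<phi> j x) w"
  shows "L2_inner \<Omega> w (\<phi> k) = c k"
proof -
  have w: "w \<in> L2_fun \<Omega>" and
    lim: "(\<lambda>n. norm_L2 \<Omega> (\<lambda>x. w x - (\<Sum>j<n. c j * \<phi> j x))) \<longlonglongrightarrow> 0"
    using s by (auto simp: L2_sums_def)
  have "(L2_inner \<Omega> w (\<phi> k) - c k)\<^sup>2 \<le> (norm_L2 \<Omega> (\<lambda>x. w x - (\<Sum>j<n. c j * \<phi> j x)))\<^sup>2" if "n > k" for n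
  proof -
    have S: "(\<lambda>x. \<Sum>j<n. c j * \<phi> j x) \<in> L2_fun \<Omega>" by (intro L2_fun_sum L2_fun_scale phi)
    have "L2_inner \<Omega> (\<lambda>x. \<Sum>j<n. c j * \<phi> j x) (\<phi> k) = (\<Sum>j<n. c j * (if j = k then 1 else 0))"
      using phi by (subst L2_inner_sum_left) (auto simp: L2_inner_scale_left on)
    also have "\<dots> = (\<Sum>j<n. if j = k then c j else 0)" by (intro sum.cong) auto
    also have "\<dots> = c k" using that by simp
    finally have i: "L2_inner \<Omega> (\<lambda>x. w x - (\<Sum>j<n. c j * \<phi> j x)) (\<phi> k) = L2_inner \<Omega> w (\<phi> k) - c k"
      by (simp only: L2_inner_diff_left[OF w S phi])
    have "L2_inner \<Omega> (\<phi> k) (\<phi> k) = 1" by (simp add: on)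
    from L2_inner_unit_le[OF L2_fun_diff[OF w S] phi this] show ?thesis unfolding i .
  qed
  moreover have "(\<lambda>n. (norm_L2 \<Omega> (\<lambda>x. w x - (\<Sum>j<n. c j * \<phi> j x)))\<^sup>2) \<longlonglongrightarrow> 0\<^sup>2"
    by (intro tendsto_intros lim)
  ultimately have "(L2_inner \<Omega> w (\<phi> k) - c k)\<^sup>2 \<le> 0\<^sup>2"
    by (metis (lifting) LIMSEQ_le_const Suc_le_lessD)
  thus ?thesis by simp
qed

text \<open>By orthogonality, subtracting the n-th term lowers the squared norm of the remainder by
  exactly the squared coefficient; the assumed expansion says that the remainder tends to 0.\<close>

lemma L2_parseval:
  assumes phi: "\<And>j. \<phi> j \<in> L2_fun \<Omega>"
    and on: "\<And>i j. L2_inner \<Omega> (\<phi> i) (\<phi> j) = (if i = j then 1 else 0)"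
    and v: "v \<in> L2_fun \<Omega>"
    and s: "L2_sums \<Omega> (\<lambda>j x. L2_inner \<Omega> v (\<phi> j) * \<phi> j x) v"
  shows "(\<lambda>j. (L2_inner \<Omega> v (\<phi> j))\<^sup>2) sums (norm_L2 \<Omega> v)\<^sup>2"
proof -
  let ?c = "\<lambda>j. L2_inner \<Omega> v (\<phi> j)"
  let ?S = "\<lambda>n x. \<Sum>j<n. ?c j * \<phi> j x"
  have eq: "(norm_L2 \<Omega> (\<lambda>x. v x - ?S n x))\<^sup>2 = (norm_L2 \<Omega> v)\<^sup>2 - (\<Sum>j<n. (?c j)\<^sup>2)" for n
  proof (induction n)
    case (Suc n)
    have S: "?S n \<in> L2_fun \<Omega>" by (intro L2_fun_sum L2_fun_scale phi)
    have d: "(\<lambda>x. v x - ?S n x) \<in> L2_fun \<Omega>" using v S by auto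
    have "L2_inner \<Omega> (?S n) (\<phi> n) = (\<Sum>j<n. ?c j * (if j = n then 1 else 0))"
      using phi by (subst L2_inner_sum_left) (auto simp: L2_inner_scale_left on)
    also have "\<dots> = 0" by (intro sum.neutral) auto
    finally have i: "L2_inner \<Omega> (\<lambda>x. v x - ?S n x) (\<phi> n) = ?c n"
      unfolding L2_inner_diff_left[OF v S phi] by simp
    have "(norm_L2 \<Omega> (\<lambda>x. v x - ?S (Suc n) x))\<^sup>2 = (norm_L2 \<Omega> (\<lambda>x. (v x - ?S n x) - ?c n * \<phi> n x))\<^sup>2"
      by (simp add: algebra_simps)
    also have "\<dots> = (norm_L2 \<Omega> (\<lambda>x. v x - ?S n x))\<^sup>2 - 2 * L2_inner \<Omega> (\<lambda>x. v x - ?S n x) (\<lambda>x. ?c n * \<phi> n x)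
         + (norm_L2 \<Omega> (\<lambda>x. ?c n * \<phi> n x))\<^sup>2"
      using d phi by (intro norm_L2_square_diff) auto
    also have "L2_inner \<Omega> (\<lambda>x. v x - ?S n x) (\<lambda>x. ?c n * \<phi> n x) = ?c n * ?c n"
      by (subst L2_inner_commute, subst L2_inner_scale_left, subst L2_inner_commute) (simp only: i)
    also have "(norm_L2 \<Omega> (\<lambda>x. ?c n * \<phi> n x))\<^sup>2 = ?c n * ?c n"
      unfolding norm_L2_square L2_inner_scale_left
      by (subst L2_inner_commute, subst L2_inner_scale_left) (simp add: on)
    finally show ?case using Suc.IH by (simp add: power2_eq_square)
  qed simp
  have "(\<lambda>n. (norm_L2 \<Omega> (\<lambda>x. v x - ?S n x))\<^sup>2) \<longlonglongrightarrow> 0\<^sup>2"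
    using s by (intro tendsto_intros) (auto simp: L2_sums_def)
  hence "(\<lambda>n. (norm_L2 \<Omega> v)\<^sup>2 - (\<Sum>j<n. (?c j)\<^sup>2)) \<longlonglongrightarrow> 0" by (simp only: eq) simp
  hence "(\<lambda>n. (norm_L2 \<Omega> v)\<^sup>2 - ((norm_L2 \<Omega> v)\<^sup>2 - (\<Sum>j<n. (?c j)\<^sup>2))) \<longlonglongrightarrow> (norm_L2 \<Omega> v)\<^sup>2 - 0"
    by (intro tendsto_intros)
  thus ?thesis by (simp add: sums_def)
qed

section \<open>Positivity of Dirichlet eigenvalues\<close>

text \<open>Transfers integrals over \<Omega> to the whole space, where Lebesgue measure is
  translation invariant; nothing changes because the integrand vanishes outside \<Omega>.\<close>

lemma integral_lebesgue_on_eq_lborel: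
  fixes h :: "'a::euclidean_space \<Rightarrow> real"
  assumes "open \<Omega>" "continuous_on UNIV h" "\<And>x. x \<notin> \<Omega> \<Longrightarrow> h x = 0"
  shows "(LINT x|lebesgue_on \<Omega>. h x) = (LINT x|lborel. h x)"
    and "integrable lborel h \<Longrightarrow> integrable (lebesgue_on \<Omega>) h"
proof -
  have hb: "h \<in> borel_measurable lborel" using assms(2) by (simp add: borel_measurable_continuous_onI)
  have O: "\<Omega> \<inter> space lebesgue \<in> sets lebesgue" using assms(1) by simp
  have ih: "(\<lambda>x. indicator \<Omega> x *\<^sub>R h x) = h" using assms(3) by (auto simp: fun_eq_iff indicator_def)
  show "(LINT x|lebesgue_on \<Omega>. h x) = (LINT x|lborel. h x)"
    using integral_restrict_space[OF O, of h] ih integral_completion[OF hb] by simp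
  show "integrable (lebesgue_on \<Omega>) h" if "integrable lborel h"
    using integrable_restrict_space[OF O, of h] ih integrable_completion[OF hb] that by simp
qed

lemma test_fun_has_derivative:
  assumes "test_fun \<Omega> v Dv"
  shows "(v has_derivative (\<lambda>h. h \<bullet> Dv x)) (at x)"
  using assms unfolding test_fun_def gderiv_def by blast

lemma test_fun_continuous:
  assumes "test_fun \<Omega> v Dv"
  shows "continuous_on A v" "continuous_on A Dv"
proof -
  have "isCont v x" for x
    by (rule has_derivative_continuous[OF test_fun_has_derivative[OF assms]])
  thus "continuous_on A v" by (simp add: continuous_at_imp_continuous_on)
  show "continuous_on A Dv" using assms by (auto simp: test_fun_def intro: continuous_on_subset)
qed

lemma has_derivative_zero_outside_closed:
  assumes "(v has_derivative D) (at x)" "closed K" "x \<notin> K" "\<And>y. y \<notin> K \<Longrightarrow> v y = 0"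
  shows "D = (\<lambda>h. 0)"
proof -
  have "(v has_derivative (\<lambda>h. 0)) (at x)"
  proof (rule has_derivative_transform_within_open[where s = "- K"])
    show "((\<lambda>x. 0) has_derivative (\<lambda>h. 0)) (at x)" by (rule has_derivative_const)
    show "open (- K)" using assms(2) by (rule open_Compl)
    show "x \<in> - K" using assms(3) by simp
    show "0 = v y" if "y \<in> - K" for y using assms(4)[of y] that by simp
  qed
  with assms(1) show ?thesis by (rule has_derivative_unique)
qed

lemma test_fun_zero:
  assumes t: "test_fun \<Omega> v Dv" and x: "x \<notin> closure {x. v x \<noteq> 0}"
  shows "v x = 0" "Dv x = 0"
proof -
  have out: "v y = 0" if "y \<notin> closure {x. v x \<noteq> 0}" for y
  proof (rule ccontr)
    assume "v y \<noteq> 0"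
    hence "y \<in> closure {x. v x \<noteq> 0}" by (intro subsetD[OF closure_subset] CollectI)
    with that show False by (rule notE)
  qed
  show "v x = 0" by (rule out[OF x])
  have "(\<lambda>h. h \<bullet> Dv x) = (\<lambda>h. 0)"
    using test_fun_has_derivative[OF t] closed_closure x out by (rule has_derivative_zero_outside_closed)
  hence "Dv x \<bullet> Dv x = 0" by (rule fun_cong)
  thus "Dv x = 0" by (simp only: inner_eq_zero_iff)
qed

lemma test_fun_supportE:
  assumes "test_fun \<Omega> v Dv"
  obtains K where "compact K" "K \<subseteq> \<Omega>" "\<And>x. x \<notin> K \<Longrightarrow> v x = 0" "\<And>x. x \<notin> K \<Longrightarrow> Dv x = 0"
  using that[of "closure {x. v x \<noteq> 0}"] test_fun_zero[OF assms] assms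
  unfolding test_fun_def by metis

lemma integrable_continuous_compact_support:
  fixes h :: "'a::euclidean_space \<Rightarrow> real"
  assumes "continuous_on UNIV h" "compact K" "\<And>x. x \<notin> K \<Longrightarrow> h x = 0"
  shows "integrable lborel h"
proof -
  have "integrable lborel (\<lambda>x. indicator K x *\<^sub>R h x)"
    using assms by (intro borel_integrable_compact) (auto intro: continuous_on_subset)
  moreover have "(\<lambda>x. indicator K x *\<^sub>R h x) = h" using assms(3) by (auto simp: fun_eq_iff indicator_def)
  ultimately show ?thesis by simp
qed

lemma test_fun_L2:
  assumes O: "open \<Omega>" and t: "test_fun \<Omega> v Dv"
  shows "v \<in> L2_fun \<Omega>" "(\<lambda>x. norm (Dv x)) \<in> L2_fun \<Omega>"
proof -
  obtain K where K: "compact K" "K \<subseteq> \<Omega>" and z: "\<And>x. x \<notin> K \<Longrightarrow> v x = 0" "\<And>x. x \<notin> K \<Longrightarrow> Dv x = 0"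
    using test_fun_supportE[OF t] by metis
  have "f \<in> L2_fun \<Omega>" if c: "continuous_on UNIV f" and z: "\<And>x. x \<notin> K \<Longrightarrow> f x = 0" for f :: "'a \<Rightarrow> real"
  proof -
    have "integrable lborel (\<lambda>x. (f x)\<^sup>2)"
      using c z K by (intro integrable_continuous_compact_support[of _ K] continuous_intros) auto
    hence "integrable (lebesgue_on \<Omega>) (\<lambda>x. (f x)\<^sup>2)"
      using c z K O by (intro integral_lebesgue_on_eq_lborel(2) continuous_intros) auto
    moreover have "f \<in> borel_measurable (lebesgue_on \<Omega>)"
      using c O by (intro continuous_imp_measurable_on_sets_lebesgue) (auto intro: continuous_on_subset)
    ultimately show ?thesis by (simp add: L2_fun_def)
  qed
  thus "v \<in> L2_fun \<Omega>" "(\<lambda>x. norm (Dv x)) \<in> L2_fun \<Omega>"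
    using test_fun_continuous[OF t] z continuous_on_norm[OF test_fun_continuous(2)[OF t]] by simp_all
qed

text \<open>The difference quotients have integral zero by translation invariance.\<close>

lemma integral_directional_derivative_zero:
  fixes g d :: "'a::euclidean_space \<Rightarrow> real"
  assumes g: "\<And>x s. ((\<lambda>s. g (x + s *\<^sub>R e)) has_real_derivative d (x + s *\<^sub>R e)) (at s)"
    and cg: "continuous_on UNIV g" and cd: "continuous_on UNIV d" and K: "compact K"
    and zg: "\<And>x. x \<notin> K \<Longrightarrow> g x = 0" and zd: "\<And>x. x \<notin> K \<Longrightarrow> d x = 0"
  shows "(LINT x|lborel. d x) = 0"
proof -
  obtain B where B: "\<And>x. \<bar>d x\<bar> \<le> B" "B \<ge> 0"
  proof -
    have "compact (d ` K)" using K cd by (intro compact_continuous_image) (auto intro: continuous_on_subset)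
    then obtain B where "\<And>y. y \<in> d ` K \<Longrightarrow> \<bar>y\<bar> \<le> B" by (meson compact_imp_bounded bounded_real)
    hence "\<bar>d x\<bar> \<le> max B 0" for x using zd[of x] by (cases "x \<in> K") (auto simp: le_max_iff_disj)
    thus ?thesis using that[of "max B 0"] by auto
  qed
  obtain R where R: "\<And>x. x \<in> K \<Longrightarrow> norm x \<le> R"
    using compact_imp_bounded[OF K] by (auto simp: bounded_iff)
  define q where "q = (\<lambda>n x. real (Suc n) * (g (x + (1 / real (Suc n)) *\<^sub>R e) - g x))"
  have ig: "integrable lborel g" by (rule integrable_continuous_compact_support[OF cg K zg])
  have tr: "integrable lborel (\<lambda>x. g (x + c)) \<and> (LINT x|lborel. g (x + c)) = (LINT x|lborel. g x)" for c
  proof -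
    have "integrable (distr lborel borel ((+) c)) g" using ig by (simp add: lborel_distr_plus)
    hence "integrable lborel (\<lambda>x. g (c + x))" by (subst (asm) integrable_distr_eq) (use ig in auto)
    moreover have "(LINT x|distr lborel borel ((+) c). g x) = (LINT x|lborel. g (c + x))"
      by (rule integral_distr) (use ig in auto)
    ultimately show ?thesis by (simp add: lborel_distr_plus add.commute)
  qed
  have q0: "(LINT x|lborel. q n x) = 0" for n
    unfolding q_def using tr ig by simp
  have "(\<lambda>n. LINT x|lborel. q n x) \<longlonglongrightarrow> (LINT x|lborel. d x)"
  \<comment> \<open>By the mean value theorem each quotient is a value of \<open>d\<close> at a
    point x + z e with 0 < z < 1. It is thus bounded by B and vanishes unless x is within distance
    |e| of K, hence the enlarged ball.\<close>
  proof (rule integral_dominated_convergence[where w = "\<lambda>x. B * indicator (cball 0 (R + norm e)) x"])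
    show "d \<in> borel_measurable lborel" using cd by (simp add: borel_measurable_continuous_onI)
    show "q n \<in> borel_measurable lborel" for n
      unfolding q_def using tr ig by (intro borel_measurable_integrable integrable_mult_right Bochner_Integration.integrable_diff) auto
    have "emeasure lborel (cball (0::'a) (R + norm e)) < \<infinity>" by (rule emeasure_lborel_cball_finite)
    thus "integrable lborel (\<lambda>x::'a. B * indicator (cball 0 (R + norm e)) x)"
      by (intro integrable_mult_right integrable_real_indicator) auto
    show "AE x in lborel. (\<lambda>n. q n x) \<longlonglongrightarrow> d x"
    proof (intro AE_I2)
      fix x
      have "((\<lambda>h. (g (x + h *\<^sub>R e) - g x) / h) \<longlongrightarrow> d x) (at 0)"
        using g[of x 0] by (simp add: DERIV_def)
      moreover have "filterlim (\<lambda>n. 1 / real (Suc n)) (at 0) sequentially"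
        unfolding filterlim_at using LIMSEQ_Suc[OF lim_1_over_n[where 'a = real]]
        by (auto simp del: of_nat_Suc)
      ultimately have "(\<lambda>n. (g (x + (1 / real (Suc n)) *\<^sub>R e) - g x) / (1 / real (Suc n))) \<longlonglongrightarrow> d x"
        by (rule filterlim_compose)
      thus "(\<lambda>n. q n x) \<longlonglongrightarrow> d x" by (simp add: q_def mult.commute)
    qed
    show "AE x in lborel. norm (q n x) \<le> B * indicator (cball 0 (R + norm e)) x" for n
    proof (intro AE_I2)
      fix x
      define h where "h = 1 / real (Suc n)"
      have h: "0 < h" "h \<le> 1" by (simp_all add: h_def)
      obtain z where z: "0 < z" "z < h" "g (x + h *\<^sub>R e) - g (x + 0 *\<^sub>R e) = (h - 0) * d (x + z *\<^sub>R e)"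
        using MVT2[OF h(1), of "\<lambda>s. g (x + s *\<^sub>R e)" "\<lambda>s. d (x + s *\<^sub>R e)"] g by auto
      have "q n x = (1 / h) * (h * d (x + z *\<^sub>R e))" using z(3) by (simp add: q_def h_def)
      hence qe: "q n x = d (x + z *\<^sub>R e)" using h by simp
      show "norm (q n x) \<le> B * indicator (cball 0 (R + norm e)) x"
      proof (cases "x + z *\<^sub>R e \<in> K")
        case True
        have "norm x \<le> norm (x + z *\<^sub>R e) + norm (z *\<^sub>R e)" by (metis add_diff_cancel norm_triangle_ineq4)
        also have "norm (z *\<^sub>R e) \<le> norm e" using z h by (simp add: mult_left_le_one_le)
        finally have "norm x \<le> R + norm e" using R[OF True] by simp
        thus ?thesis using B by (simp add: qe)
      qed (use B zd qe in simp)
    qed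
  qed
  hence "(\<lambda>n::nat. 0::real) \<longlonglongrightarrow> (LINT x|lborel. d x)" by (simp add: q0)
  thus ?thesis by (simp add: LIMSEQ_const_iff)
qed

text \<open>The function \<open>d\<close> is the derivative of x_i v^2 in one coordinate direction
  i, so its integral is 0. Since |x_i| \<le> R, the mixed term 2 x_i v (Dv)_i can be absorbed into
  half of v^2 and a multiple of |Dv|^2.\<close>

lemma poincare_test_fun:
  fixes \<Omega> :: "'a::euclidean_space set"
  assumes O: "open \<Omega>" and R: "\<And>x. x \<in> \<Omega> \<Longrightarrow> norm x \<le> R" and t: "test_fun \<Omega> v Dv"
  shows "(LINT x|lebesgue_on \<Omega>. (v x)\<^sup>2) \<le> 4 * R\<^sup>2 * (LINT x|lebesgue_on \<Omega>. (norm (Dv x))\<^sup>2)"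
proof -
  obtain K where K: "compact K" "K \<subseteq> \<Omega>" and z: "\<And>x. x \<notin> K \<Longrightarrow> v x = 0" "\<And>x. x \<notin> K \<Longrightarrow> Dv x = 0"
    using test_fun_supportE[OF t] by metis
  note cont = test_fun_continuous[OF t]
  obtain i :: 'a where i: "i \<in> Basis" using nonempty_Basis by blast
  define d where "d = (\<lambda>x. (v x)\<^sup>2 + 2 * ((x \<bullet> i) * v x * (Dv x \<bullet> i)))"
  have cd: "continuous_on UNIV d" unfolding d_def by (intro continuous_intros cont)
  have cg: "continuous_on UNIV (\<lambda>x. (x \<bullet> i) * (v x)\<^sup>2)" by (intro continuous_intros cont)
  have d0: "(LINT x|lborel. d x) = 0"
  proof (rule integral_directional_derivative_zero[where g = "\<lambda>x. (x \<bullet> i) * (v x)\<^sup>2" and e = i, OF _ cg cd K(1)])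
    fix x s
    have "((\<lambda>s. v (x + s *\<^sub>R i)) has_derivative (\<lambda>h. (h *\<^sub>R i) \<bullet> Dv (x + s *\<^sub>R i))) (at s)"
    proof (rule has_derivative_compose[where f = "\<lambda>s. x + s *\<^sub>R i" and g = v])
      show "((\<lambda>s. x + s *\<^sub>R i) has_derivative (\<lambda>h. h *\<^sub>R i)) (at s)" by (auto intro!: derivative_eq_intros)
      show "(v has_derivative (\<lambda>h. h \<bullet> Dv (x + s *\<^sub>R i))) (at (x + s *\<^sub>R i))"
        by (rule test_fun_has_derivative[OF t])
    qed
    hence [derivative_intros]: "((\<lambda>s. v (x + s *\<^sub>R i)) has_real_derivative (Dv (x + s *\<^sub>R i) \<bullet> i)) (at s)"
      by (simp add: has_field_derivative_def inner_commute mult.commute[of _ "_ \<bullet> _"])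
    have [derivative_intros]: "((\<lambda>s. (x + s *\<^sub>R i) \<bullet> i) has_real_derivative 1) (at s)"
      using i by (simp add: inner_add_left) (auto intro!: derivative_eq_intros)
    show "((\<lambda>s. ((x + s *\<^sub>R i) \<bullet> i) * (v (x + s *\<^sub>R i))\<^sup>2) has_real_derivative d (x + s *\<^sub>R i)) (at s)"
      unfolding d_def by (auto intro!: derivative_eq_intros simp: algebra_simps inner_same_Basis[OF i])
  qed (auto simp: z d_def)
  have zo: "v x = 0" "Dv x = 0" if "x \<notin> \<Omega>" for x using K z that by blast+
  have e1: "(LINT x|lebesgue_on \<Omega>. d x) = 0"
    using d0 by (subst integral_lebesgue_on_eq_lborel(1)[OF O cd]) (use zo in \<open>simp_all add: d_def\<close>)
  have id: "integrable (lebesgue_on \<Omega>) d"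
    by (rule integral_lebesgue_on_eq_lborel(2)[OF O cd _ integrable_continuous_compact_support[OF cd K(1)]])
       (use zo z in \<open>simp_all add: d_def\<close>)
  have iv: "integrable (lebesgue_on \<Omega>) (\<lambda>x. (v x)\<^sup>2)" "integrable (lebesgue_on \<Omega>) (\<lambda>x. (norm (Dv x))\<^sup>2)"
    using test_fun_L2[OF O t] by (auto simp: L2_fun_def)
  have "(LINT x|lebesgue_on \<Omega>. (1/2) * (v x)\<^sup>2 - 2 * R\<^sup>2 * (norm (Dv x))\<^sup>2) \<le> (LINT x|lebesgue_on \<Omega>. d x)"
  proof (rule integral_mono)
    fix x assume "x \<in> space (lebesgue_on \<Omega>)"
    hence x: "x \<in> \<Omega>" by simp
    have a: "\<bar>x \<bullet> i\<bar> \<le> R" using R[OF x] Basis_le_norm[OF i, of x] by simp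
    have b: "\<bar>Dv x \<bullet> i\<bar> \<le> norm (Dv x)" using Basis_le_norm[OF i] by simp
    define y where "y = (x \<bullet> i) * (Dv x \<bullet> i)"
    have "\<bar>y\<bar> \<le> R * norm (Dv x)" unfolding y_def abs_mult using a b by (intro mult_mono) auto
    hence "y\<^sup>2 \<le> (R * norm (Dv x))\<^sup>2" by (rule abs_le_square_iff[THEN iffD1, OF order.trans]) simp
    hence "y\<^sup>2 \<le> R\<^sup>2 * (norm (Dv x))\<^sup>2" by (simp add: power_mult_distrib)
    \<comment> \<open>Completing the square gives 2 v y \<ge> -v^2/2 - 2 y^2; with y^2 \<le> R^2
      |Dv|^2 this is the origin of the constant 4 R^2.\<close>
    moreover have "0 \<le> (v x / 2 + y)\<^sup>2 * 2" by simp
    hence "0 \<le> (v x)\<^sup>2 / 2 + 2 * (v x * y) + 2 * y\<^sup>2"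
      by (simp add: power2_eq_square algebra_simps)
    ultimately have "(1/2) * (v x)\<^sup>2 - 2 * (R\<^sup>2 * (norm (Dv x))\<^sup>2) \<le> (v x)\<^sup>2 + 2 * (v x * y)"
      by linarith
    thus "(1/2) * (v x)\<^sup>2 - 2 * R\<^sup>2 * (norm (Dv x))\<^sup>2 \<le> d x"
      by (simp add: d_def y_def mult_ac)
  qed (use iv id in auto)
  thus ?thesis using iv e1 by simp
qed

text \<open>The weak equation can only be tested with compactly supported C1 functions, so the
  approximants \<open>v n\<close> of \<open>f\<close> are used instead of \<open>f\<close>. Poincare
  for \<open>v n\<close> and passage to the limit yield \<mu> \<ge> 1 / (8 R^2).\<close>

lemma dirichlet_eigenvalue_pos:
  fixes \<Omega> :: "'a::euclidean_space set"
  assumes O: "open \<Omega>" and bd: "bounded \<Omega>" and ef: "dirichlet_eigenfunction \<Omega> \<mu> f"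
    and unit: "L2_inner \<Omega> f f = 1"
  shows "\<mu> > 0"
proof -
  obtain R0 where R0: "\<And>x. x \<in> \<Omega> \<Longrightarrow> norm x \<le> R0" using bd by (auto simp: bounded_iff)
  define R where "R = max R0 1"
  have R: "\<And>x. x \<in> \<Omega> \<Longrightarrow> norm x \<le> R" "R > 0" using R0 by (auto simp: R_def le_max_iff_disj)
  obtain G where G: "H10_fun \<Omega> f G"
    and weak: "\<And>w Dw. test_fun \<Omega> w Dw \<Longrightarrow> (LINT x|lebesgue_on \<Omega>. G x \<bullet> Dw x) = \<mu> * L2_inner \<Omega> f w"
    using ef by (auto simp: dirichlet_eigenfunction_def)
  then obtain v Dv where t: "\<And>n. test_fun \<Omega> (v n) (Dv n)"
    and lv: "(\<lambda>n. norm_L2 \<Omega> (\<lambda>x. f x - v n x)) \<longlonglongrightarrow> 0"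
    and lD: "(\<lambda>n. norm_L2 \<Omega> (\<lambda>x. norm (G x - Dv n x))) \<longlonglongrightarrow> 0"
    and f: "f \<in> L2_fun \<Omega>" and Gm: "G \<in> borel_measurable (lebesgue_on \<Omega>)"
    and GL: "(\<lambda>x. norm (G x)) \<in> L2_fun \<Omega>"
    by (auto simp: H10_fun_def)
  have v: "v n \<in> L2_fun \<Omega>" "(\<lambda>x. norm (Dv n x)) \<in> L2_fun \<Omega>" for n using test_fun_L2[OF O t] by auto
  have Dm: "Dv n \<in> borel_measurable (lebesgue_on \<Omega>)" for n
    using test_fun_continuous(2)[OF t] O by (intro continuous_imp_measurable_on_sets_lebesgue) auto
  define \<epsilon> where "\<epsilon> = (\<lambda>n. norm_L2 \<Omega> (\<lambda>x. norm (G x - Dv n x)))"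
  define r where "r = (\<lambda>n. L2_inner \<Omega> (\<lambda>x. f x - v n x) f)"
  have fv: "L2_inner \<Omega> f (v n) = 1 - r n" for n
    unfolding r_def using f v unit by (subst L2_inner_diff_left) (auto simp: L2_inner_commute)
  have rl: "r \<longlonglongrightarrow> 0"
  proof (rule tendsto_0_le[OF lv, of _ 1])
    have "\<bar>r n\<bar> \<le> norm_L2 \<Omega> (\<lambda>x. f x - v n x)" for n
      using L2_inner_unit_le[of "\<lambda>x. f x - v n x" \<Omega> f] f v unit unfolding r_def
      by (intro abs_le_square_iff[THEN iffD2, of _ "norm_L2 \<Omega> _", simplified]) auto
    thus "\<forall>\<^sub>F x in sequentially. norm (r x) \<le> norm (norm_L2 \<Omega> (\<lambda>xa. f xa - v x xa)) * 1"
      by (intro always_eventually allI) simp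
  qed
  have key: "\<mu> * (1 - r n) \<ge> (1/2) * ((1 - 2 * r n) / (4 * R\<^sup>2) - (\<epsilon> n)\<^sup>2)" for n
  proof -
    have "(norm_L2 \<Omega> (\<lambda>x. f x - v n x))\<^sup>2 = (norm_L2 \<Omega> f)\<^sup>2 - 2 * L2_inner \<Omega> f (v n) + (norm_L2 \<Omega> (v n))\<^sup>2"
      by (rule norm_L2_square_diff[OF f v(1)])
    hence "(norm_L2 \<Omega> (v n))\<^sup>2 \<ge> 1 - 2 * r n"
      using zero_le_power2[of "norm_L2 \<Omega> (\<lambda>x. f x - v n x)"] by (simp add: norm_L2_square[of _ f] unit fv)
    also have "(norm_L2 \<Omega> (v n))\<^sup>2 = (LINT x|lebesgue_on \<Omega>. (v n x)\<^sup>2)"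
      by (simp add: norm_L2_def)
    also have "\<dots> \<le> 4 * R\<^sup>2 * (LINT x|lebesgue_on \<Omega>. (norm (Dv n x))\<^sup>2)"
      by (rule poincare_test_fun[OF O R(1) t])
    finally have p: "(LINT x|lebesgue_on \<Omega>. (norm (Dv n x))\<^sup>2) \<ge> (1 - 2 * r n) / (4 * R\<^sup>2)"
      using R(2) by (simp add: divide_le_eq mult.commute)
    have i1: "integrable (lebesgue_on \<Omega>) (\<lambda>x. (norm (G x))\<^sup>2)" "integrable (lebesgue_on \<Omega>) (\<lambda>x. (norm (Dv n x))\<^sup>2)"
      using GL v by (auto simp: L2_fun_def)
    have i2: "integrable (lebesgue_on \<Omega>) (\<lambda>x. (norm (G x - Dv n x))\<^sup>2)"
    proof (rule Bochner_Integration.integrable_bound)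
      show "integrable (lebesgue_on \<Omega>) (\<lambda>x. 2 * (norm (G x))\<^sup>2 + 2 * (norm (Dv n x))\<^sup>2)" using i1 by simp
      show "(\<lambda>x. (norm (G x - Dv n x))\<^sup>2) \<in> borel_measurable (lebesgue_on \<Omega>)" using Gm Dm by simp
      have "(norm (y - z))\<^sup>2 \<le> 2 * (norm y)\<^sup>2 + 2 * (norm z)\<^sup>2" for y z :: 'a
      proof -
        have "0 \<le> (norm (y + z))\<^sup>2" by simp
        thus ?thesis by (simp only: power2_norm_eq_inner inner_simps inner_commute[of z y])
      qed
      thus "AE x in lebesgue_on \<Omega>. norm ((norm (G x - Dv n x))\<^sup>2) \<le> norm (2 * (norm (G x))\<^sup>2 + 2 * (norm (Dv n x))\<^sup>2)"
        by (intro AE_I2) simp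
    qed
    have "\<mu> * (1 - r n) = (LINT x|lebesgue_on \<Omega>. G x \<bullet> Dv n x)" by (simp add: weak[OF t] fv)
    \<comment> \<open>Polarization: the term with \<open>G\<close> is merely dropped as nonnegative,
      the one with \<open>Dv n\<close> is bounded by Poincare, and the difference tends to 0. This
      costs a factor 2 but avoids a Poincare inequality for \<open>f\<close> itself.\<close>
    also have "(\<lambda>x. G x \<bullet> Dv n x) = (\<lambda>x. (1/2) * ((norm (G x))\<^sup>2 + (norm (Dv n x))\<^sup>2 - (norm (G x - Dv n x))\<^sup>2))"
      by (simp add: fun_eq_iff power2_norm_eq_inner inner_simps inner_commute)
    also have "(LINT x|lebesgue_on \<Omega>. (1/2) * ((norm (G x))\<^sup>2 + (norm (Dv n x))\<^sup>2 - (norm (G x - Dv n x))\<^sup>2)) =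
       (1/2) * ((LINT x|lebesgue_on \<Omega>. (norm (G x))\<^sup>2) + (LINT x|lebesgue_on \<Omega>. (norm (Dv n x))\<^sup>2) - (\<epsilon> n)\<^sup>2)"
      using i1 i2 by (simp add: \<epsilon>_def norm_L2_def)
    finally have "\<mu> * (1 - r n) = (1/2) * ((LINT x|lebesgue_on \<Omega>. (norm (G x))\<^sup>2) + (LINT x|lebesgue_on \<Omega>. (norm (Dv n x))\<^sup>2) - (\<epsilon> n)\<^sup>2)" .
    moreover have "(LINT x|lebesgue_on \<Omega>. (norm (G x))\<^sup>2) \<ge> 0" by simp
    moreover have "(1/2) * (X - e) \<le> m" if "m = (1/2) * (A + B - e)" "0 \<le> A" "X \<le> B" for m A B X e :: real
      using that by simp
    ultimately show ?thesis using p by blast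
  qed
  have l1: "(\<lambda>n. \<mu> * (1 - r n)) \<longlonglongrightarrow> \<mu> * (1 - 0)" by (intro tendsto_intros rl)
  have l2: "(\<lambda>n. (1/2) * ((1 - 2 * r n) / (4 * R\<^sup>2) - (\<epsilon> n)\<^sup>2)) \<longlonglongrightarrow> (1/2) * ((1 - 2 * 0) / (4 * R\<^sup>2) - 0\<^sup>2)"
    using R(2) lD unfolding \<epsilon>_def by (intro tendsto_intros rl) auto
  have "(1/2) * ((1 - 2 * 0) / (4 * R\<^sup>2) - 0\<^sup>2) \<le> \<mu> * (1 - 0)"
    by (rule LIMSEQ_le[OF l2 l1]) (use key in blast)
  hence "1 / (8 * R\<^sup>2) \<le> \<mu>" by simp
  moreover have "0 < 1 / (8 * R\<^sup>2)" using R(2) by simp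
  ultimately show ?thesis by (rule less_le_trans[rotated])
qed

section \<open>The error of a single mode\<close>

lemma dirichlet_eigensystemD:
  assumes "dirichlet_eigensystem \<Omega> lam \<phi>"
  shows "\<phi> j \<in> L2_fun \<Omega>"
    and "L2_inner \<Omega> (\<phi> i) (\<phi> j) = (if i = j then 1 else 0)"
    and "v \<in> L2_fun \<Omega> \<Longrightarrow> L2_sums \<Omega> (\<lambda>j x. L2_inner \<Omega> v (\<phi> j) * \<phi> j x) v"
    and "lam 0 \<le> lam j"
  using assms by (auto simp: dirichlet_eigensystem_def dirichlet_eigenfunction_def H10_fun_def monoD)

lemma dirichlet_eigensystem_pos:
  assumes "convex_polyhedral_domain \<Omega>" "dirichlet_eigensystem \<Omega> lam \<phi>"
  shows "lam 0 > 0"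
proof (rule dirichlet_eigenvalue_pos)
  show "open \<Omega>" using assms by (simp add: convex_polyhedral_domain_def)
  show "bounded \<Omega>"
    using assms polytope_imp_bounded bounded_subset[OF _ closure_subset]
    by (auto simp: convex_polyhedral_domain_def)
  show "dirichlet_eigenfunction \<Omega> (lam 0) (\<phi> 0)"
    using assms by (simp add: dirichlet_eigensystem_def)
  show "L2_inner \<Omega> (\<phi> 0) (\<phi> 0) = 1" by (simp add: dirichlet_eigensystemD(2)[OF assms(2)])
qed

lemma dirichlet_eigensystem_parseval:
  assumes "dirichlet_eigensystem \<Omega> lam \<phi>" "v \<in> L2_fun \<Omega>"
  shows "(\<lambda>j. (L2_inner \<Omega> v (\<phi> j))\<^sup>2) sums (norm_L2 \<Omega> v)\<^sup>2"
  by (intro L2_parseval dirichlet_eigensystemD[OF assms(1)] assms(2))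

lemma dw_solution_coeff:
  assumes es: "dirichlet_eigensystem \<Omega> lam \<phi>" and s: "dw_solution \<Omega> lam \<phi> \<alpha> T a b u"
    and t: "0 \<le> t" "t \<le> T"
  shows "L2_inner \<Omega> (u t) (\<phi> j) =
    mittag_leffler \<alpha> 1 (- lam j * t powr \<alpha>) * L2_inner \<Omega> a (\<phi> j) +
    t * mittag_leffler \<alpha> 2 (- lam j * t powr \<alpha>) * L2_inner \<Omega> b (\<phi> j)"
proof -
  note phi = dirichlet_eigensystemD(1)[OF es] and on = dirichlet_eigensystemD(2)[OF es]
  obtain Fa Fb where Fa: "dw_F \<Omega> lam \<phi> \<alpha> t a Fa" and Fb: "dw_Fbar \<Omega> lam \<phi> \<alpha> t b Fb"
    and ut: "u t \<in> L2_fun \<Omega>" and eq: "L2_eq \<Omega> (u t) (\<lambda>x. Fa x + Fb x)"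
    using s t unfolding dw_solution_def by (meson atLeastAtMost_iff)
  have F: "Fa \<in> L2_fun \<Omega>" "Fb \<in> L2_fun \<Omega>"
    using Fa Fb by (simp_all add: dw_F_def dw_Fbar_def L2_sums_def)
  have "L2_inner \<Omega> (u t) (\<phi> j) = L2_inner \<Omega> (\<lambda>x. Fa x + Fb x) (\<phi> j)"
    by (rule L2_inner_cong[OF eq ut L2_fun_add[OF F] phi])
  also have "\<dots> = L2_inner \<Omega> Fa (\<phi> j) + L2_inner \<Omega> Fb (\<phi> j)"
    by (rule L2_inner_add_left[OF F phi])
  finally show ?thesis
    using L2_sums_coeff[OF phi on Fa[unfolded dw_F_def], of j] L2_sums_coeff[OF phi on Fb[unfolded dw_Fbar_def], of j]
    by simp
qed

section \<open>Carrying the determinant bound over to all modes\<close>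

lemma powr_time_rescale:
  fixes \<alpha> l l0 t :: real
  assumes "\<alpha> > 0" "l > 0" "l0 > 0"
  shows "((l / l0) powr (1 / \<alpha>) * t) powr \<alpha> = l / l0 * t powr \<alpha>"
  using assms by (simp add: powr_mult powr_powr)

text \<open>The Mittag-Leffler arguments depend on eigenvalue and time through l t^\<alpha> only,
  and stretching time by \<open>s\<close> compensates replacing \<open>l\<close> by
  \<open>l0\<close>. The prefactors t1 and t2 account for the remaining factor s.\<close>

lemma dw_psi_rescale:
  assumes "\<alpha> > 0" "l > 0" "l0 > 0"
  defines "s \<equiv> (l / l0) powr (1 / \<alpha>)"
  shows "dw_psi \<alpha> (s * t1) (s * t2) l0 = s * dw_psi \<alpha> t1 t2 l"
proof -
  have e: "- l0 * (s * t) powr \<alpha> = - l * t powr \<alpha>" for t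
    using assms(1-3) by (simp add: s_def powr_time_rescale)
  show ?thesis unfolding dw_psi_def e by (simp add: algebra_simps)
qed

text \<open>As l \<ge> l0, the stretching factor \<open>s\<close> is at least 1 and the stretched
  times stay above the threshold \<open>m\<close>. The two time powers each contribute l / l0, which
  replaces l0 by l in the denominator, and one factor s cancels on both sides.\<close>

lemma dw_psi_upper:
  assumes al: "\<alpha> > 0" and l: "l0 > 0" "l \<ge> l0" and T: "0 < T1" "T1 < T2" "m \<le> T1"
    and psi: "\<And>t1 t2. m \<le> t1 \<Longrightarrow> t1 < t2 \<Longrightarrow>
           dw_psi \<alpha> t1 t2 l0 \<le> B * (t2 - t1) * (1 / (l0\<^sup>2 * t1 powr \<alpha> * t2 powr \<alpha>))"
  shows "dw_psi \<alpha> T1 T2 l \<le> B * (T2 - T1) / (T1 powr \<alpha> * T2 powr \<alpha>) / l\<^sup>2"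
proof -
  define s where "s = (l / l0) powr (1 / \<alpha>)"
  have s1: "s \<ge> 1" unfolding s_def using l al by (intro ge_one_powr_ge_zero) auto
  have sa: "(s * t) powr \<alpha> = l / l0 * t powr \<alpha>" for t
    unfolding s_def using l al by (intro powr_time_rescale) auto
  have "T1 \<le> s * T1" using s1 T by simp
  with T(3) have "m \<le> s * T1" by (rule order.trans)
  hence "dw_psi \<alpha> (s * T1) (s * T2) l0 \<le>
     B * (s * T2 - s * T1) * (1 / (l0\<^sup>2 * (s * T1) powr \<alpha> * (s * T2) powr \<alpha>))"
    using T s1 by (intro psi) auto
  moreover have "dw_psi \<alpha> (s * T1) (s * T2) l0 = s * dw_psi \<alpha> T1 T2 l"
    unfolding s_def using al l T by (intro dw_psi_rescale) auto
  moreover have "B * (s * T2 - s * T1) * (1 / (l0\<^sup>2 * (s * T1) powr \<alpha> * (s * T2) powr \<alpha>)) =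
      s * (B * (T2 - T1) / (T1 powr \<alpha> * T2 powr \<alpha>) / l\<^sup>2)"
  proof -
    have "l0\<^sup>2 * (s * T1) powr \<alpha> * (s * T2) powr \<alpha> = l\<^sup>2 * (T1 powr \<alpha> * T2 powr \<alpha>)"
      using T l by (simp add: sa power2_eq_square)
    moreover have "s * T2 - s * T1 = s * (T2 - T1)" by (simp add: right_diff_distrib)
    ultimately show ?thesis by (simp only: divide_inverse inverse_mult_distrib mult_1_left mult_ac)
  qed
  ultimately have "s * dw_psi \<alpha> T1 T2 l \<le> s * (B * (T2 - T1) / (T1 powr \<alpha> * T2 powr \<alpha>) / l\<^sup>2)" by simp
  thus ?thesis by (rule mult_left_le_imp_le) (use s1 in simp)
qed

text \<open>Cramer's rule for one mode; the determinant is \<open>- (\<gamma>\<^sup>2 + \<gamma> (R - p) + (P r - p R))\<close>, a sum of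
  terms of one sign.\<close>

lemma mode_system_bound:
  fixes l \<gamma> c C x y A B :: real
  assumes l: "l > 0" and g: "\<gamma> > 0" and c: "c > 0" and C: "C > 0"
    and p: "p \<le> - c / l" and R: "R \<ge> c / l" and psi: "p * R - P * r \<le> - c / l\<^sup>2"
    and up: "\<bar>p\<bar> \<le> C / l" "\<bar>P\<bar> \<le> C / l" "\<bar>r\<bar> \<le> C / l" "\<bar>R\<bar> \<le> C / l"
    and e1: "(p - \<gamma>) * x + P * y = A" and e2: "r * x + (\<gamma> + R) * y = B"
  shows "\<bar>x\<bar> \<le> (1 + C) / min 1 c * ((\<bar>A\<bar> + \<bar>B\<bar>) * (l / (1 + \<gamma> * l)))"
    and "\<bar>y\<bar> \<le> (1 + C) / min 1 c * ((\<bar>A\<bar> + \<bar>B\<bar>) * (l / (1 + \<gamma> * l)))"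
proof -
  define k where "k = min 1 c"
  \<comment> \<open>The common scale of the system: the determinant is at least k w^2 and every
    cofactor at most (1 + C) w, so the quotient is of order 1 / w, which is the filter l / (1 +
    \<gamma> l).\<close>
  define w where "w = \<gamma> + 1 / l"
  define D where "D = \<gamma>\<^sup>2 + \<gamma> * (R - p) - (p * R - P * r)"
  have k: "0 < k" "k \<le> 1" "k \<le> c" using c by (auto simp: k_def)
  have w: "w > 0" using l g by (simp add: w_def add_pos_pos)
  have "k * \<gamma>\<^sup>2 \<le> \<gamma>\<^sup>2" using k by (simp add: mult_left_le_one_le)
  moreover have "\<gamma> * (2 * k / l) \<le> \<gamma> * (R - p)"
  proof (intro mult_left_mono)
    have "k / l \<le> c / l" using k l by (simp add: divide_right_mono)
    thus "2 * k / l \<le> R - p" using p R by simp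
  qed (use g in simp)
  moreover have "k / l\<^sup>2 \<le> - (p * R - P * r)"
  proof -
    have "k / l\<^sup>2 \<le> c / l\<^sup>2" using k by (simp add: divide_right_mono)
    thus ?thesis using psi by simp
  qed
  ultimately have "k * \<gamma>\<^sup>2 + \<gamma> * (2 * k / l) + k / l\<^sup>2 \<le> D" by (simp add: D_def)
  moreover have "k * \<gamma>\<^sup>2 + \<gamma> * (2 * k / l) + k / l\<^sup>2 = k * w\<^sup>2"
    by (simp add: w_def power2_eq_square algebra_simps)
  ultimately have D: "k * w\<^sup>2 \<le> D" by simp
  have Cw: "C / l \<le> (1 + C) * w" "\<gamma> + C / l \<le> (1 + C) * w"
  proof -
    have "0 \<le> C * \<gamma>" "0 < 1 / l" "0 < C / l" using C g l by auto
    moreover have "(1 + C) * w = \<gamma> + C * \<gamma> + 1 / l + C / l"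
      by (simp add: w_def algebra_simps add_divide_distrib)
    ultimately show "C / l \<le> (1 + C) * w" "\<gamma> + C / l \<le> (1 + C) * w"
      using g by linarith+
  qed
  have fin: "\<bar>z\<bar> \<le> (1 + C) / min 1 c * ((\<bar>A\<bar> + \<bar>B\<bar>) * (l / (1 + \<gamma> * l)))"
    if Dz: "D * z = u1 * A + u2 * B" and u: "\<bar>u1\<bar> \<le> (1 + C) * w" "\<bar>u2\<bar> \<le> (1 + C) * w" for z u1 u2
  proof -
    have "k * w\<^sup>2 * \<bar>z\<bar> \<le> D * \<bar>z\<bar>" using D by (intro mult_right_mono) auto
    also have "\<dots> = \<bar>D * z\<bar>" using D k w by (simp add: abs_mult) (smt (verit) mult_nonneg_nonneg zero_le_power2)
    also have "\<dots> \<le> \<bar>u1\<bar> * \<bar>A\<bar> + \<bar>u2\<bar> * \<bar>B\<bar>"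
      unfolding Dz abs_mult[symmetric] by (rule abs_triangle_ineq)
    also have "\<dots> \<le> ((1 + C) * w) * \<bar>A\<bar> + ((1 + C) * w) * \<bar>B\<bar>"
      using u by (intro add_mono mult_right_mono) auto
    also have "\<dots> = w * ((1 + C) * (\<bar>A\<bar> + \<bar>B\<bar>))" by (simp add: algebra_simps)
    finally have "w * (k * w * \<bar>z\<bar>) \<le> w * ((1 + C) * (\<bar>A\<bar> + \<bar>B\<bar>))"
      by (simp add: power2_eq_square mult_ac)
    hence "k * w * \<bar>z\<bar> \<le> (1 + C) * (\<bar>A\<bar> + \<bar>B\<bar>)" using w by (simp only: mult_le_cancel_left_pos)
    hence "\<bar>z\<bar> \<le> (1 + C) * (\<bar>A\<bar> + \<bar>B\<bar>) / (k * w)"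
      using k w by (simp add: pos_le_divide_eq mult.commute)
    also have "\<dots> = (1 + C) / k * ((\<bar>A\<bar> + \<bar>B\<bar>) * (1 / w))" by simp
    also have "1 / w = l / (1 + \<gamma> * l)" using l by (simp add: w_def add_divide_distrib[symmetric] field_simps)
    finally show ?thesis by (simp add: k_def)
  qed
  have "D * x = - (\<gamma> + R) * A + P * B"
    unfolding D_def e1[symmetric] e2[symmetric] by (simp add: power2_eq_square algebra_simps)
  thus "\<bar>x\<bar> \<le> (1 + C) / min 1 c * ((\<bar>A\<bar> + \<bar>B\<bar>) * (l / (1 + \<gamma> * l)))"
    by (rule fin) (use up g Cw in auto)
  have "D * y = r * A + (\<gamma> - p) * B"
    unfolding D_def e1[symmetric] e2[symmetric] by (simp add: power2_eq_square algebra_simps)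
  thus "\<bar>y\<bar> \<le> (1 + C) / min 1 c * ((\<bar>A\<bar> + \<bar>B\<bar>) * (l / (1 + \<gamma> * l)))"
    by (rule fin) (use up g Cw in auto)
qed

text \<open>Reduces everything to sequences: \<open>n1\<close> and \<open>n2\<close> are the
  coefficients of the data errors, and \<open>K\<close> is chosen ahead of \<gamma>, \<delta> and
  the data. At t = 0 the damping factor is 1; the velocity error is listed separately because it is
  not a value of the solution.\<close>

lemma regularized_error_coeffs:
  fixes \<Omega> :: "'a::euclidean_space set"
  assumes dom: "convex_polyhedral_domain \<Omega>" and es: "dirichlet_eigensystem \<Omega> lam \<phi>"
    and al: "1 < \<alpha>" "\<alpha> < 2" and cs: "c_star > 0"
    and M: "M > 0"
    and psi: "\<And>t1 t2. M \<le> t1 \<Longrightarrow> t1 < t2 \<Longrightarrow>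
           dw_psi \<alpha> t1 t2 (lam 0) \<le> c_star * (t2 - t1) / (Gamma (1 - \<alpha>) * Gamma (2 - \<alpha>))
                                  * (1 / ((lam 0)\<^sup>2 * t1 powr \<alpha> * t2 powr \<alpha>))"
    and z0: "z0 > 0"
    and ml1: "\<And>z. z \<ge> z0 \<Longrightarrow> mittag_leffler \<alpha> 1 (- z) \<le> 1 / (2 * Gamma (1 - \<alpha>) * z) \<and>
                        1 / (2 * Gamma (1 - \<alpha>) * z) < 0"
    and ml2: "\<And>z. z \<ge> z0 \<Longrightarrow> mittag_leffler \<alpha> 2 (- z) \<ge> 1 / (2 * Gamma (2 - \<alpha>) * z) \<and>
                        1 / (2 * Gamma (2 - \<alpha>) * z) > 0"
    and Mz: "M powr \<alpha> > z0 / lam 0"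
    and T: "M \<le> T1" "T1 < T2" "T2 \<le> T"
    and sol: "dw_solution \<Omega> lam \<phi> \<alpha> T a b u"
  obtains K where "K > 0"
    "\<And>\<gamma> \<delta> g1 g2 v v1. \<gamma> > 0 \<Longrightarrow> g1 \<in> L2_fun \<Omega> \<Longrightarrow> g2 \<in> L2_fun \<Omega> \<Longrightarrow>
       norm_L2 \<Omega> (\<lambda>x. u T1 x - g1 x) = \<delta> \<Longrightarrow> norm_L2 \<Omega> (\<lambda>x. u T2 x - g2 x) = \<delta> \<Longrightarrow>
       dw_regularized \<Omega> lam \<phi> \<alpha> T T1 T2 \<gamma> g1 g2 v v1 \<Longrightarrow>
       \<exists>n1 n2. (\<lambda>j. (n1 j)\<^sup>2) sums \<delta>\<^sup>2 \<and> (\<lambda>j. (n2 j)\<^sup>2) sums \<delta>\<^sup>2 \<and>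
         (\<forall>j. \<bar>L2_inner \<Omega> (\<lambda>x. v1 x - b x) (\<phi> j)\<bar> \<le>
            K * (\<gamma> * (\<bar>L2_inner \<Omega> a (\<phi> j)\<bar> + \<bar>L2_inner \<Omega> b (\<phi> j)\<bar>) + (\<bar>n1 j\<bar> + \<bar>n2 j\<bar>)) * (lam j / (1 + \<gamma> * lam j))) \<and>
         (\<forall>t\<in>{0..T}. \<forall>j. \<bar>L2_inner \<Omega> (\<lambda>x. v t x - u t x) (\<phi> j)\<bar> \<le>
            K * (\<gamma> * (\<bar>L2_inner \<Omega> a (\<phi> j)\<bar> + \<bar>L2_inner \<Omega> b (\<phi> j)\<bar>) + (\<bar>n1 j\<bar> + \<bar>n2 j\<bar>)) * (lam j / (1 + \<gamma> * lam j))
              / (1 + lam j * t powr \<alpha>))"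
proof -
  note phi = dirichlet_eigensystemD(1)[OF es]
  have l0: "lam 0 > 0" by (rule dirichlet_eigensystem_pos[OF dom es])
  have lj: "lam j \<ge> lam 0" for j by (rule dirichlet_eigensystemD(4)[OF es])
  have lp: "lam j > 0" for j using l0 lj[of j] by simp
  have T1: "T1 > 0" "T2 > 0" "T > 0" "T1 \<le> T" "T2 \<le> T" using M T by auto
  \<comment> \<open>The signs of both Gamma values are read off the assumed bounds at z =
    z0.\<close>
  have G1: "Gamma (1 - \<alpha>) < 0" using ml1[of z0] z0 by (simp add: divide_less_0_iff mult_less_0_iff zero_less_mult_iff)
  have G2: "Gamma (2 - \<alpha>) > 0" using ml2[of z0] z0 by (simp add: zero_less_divide_iff zero_less_mult_iff)
  obtain C1 where C1: "\<And>z. z \<ge> 0 \<Longrightarrow> \<bar>mittag_leffler \<alpha> 1 (- z)\<bar> * (1 + z) \<le> C1"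
    using mittag_leffler_bound[OF al, of 1] by auto
  obtain C2 where C2: "\<And>z. z \<ge> 0 \<Longrightarrow> \<bar>mittag_leffler \<alpha> 2 (- z)\<bar> * (1 + z) \<le> C2"
    using mittag_leffler_bound[OF al, of 2] by auto
  \<comment> \<open>One constant for both solution operators; \<open>T\<close> enters because the
    second carries the factor t \<le> T, and the lower bound 1 gives K0 \<le> K below.\<close>
  define C0 where "C0 = max 1 (max C1 (T * C2))"
  define E1 where "E1 = (\<lambda>t j. mittag_leffler \<alpha> 1 (- lam j * t powr \<alpha>))"
  define E2 where "E2 = (\<lambda>t j. t * mittag_leffler \<alpha> 2 (- lam j * t powr \<alpha>))"
  have C0: "C0 \<ge> 1" by (simp add: C0_def)
  have nn: "0 \<le> lam j * t powr \<alpha>" for j t using lp[of j] by simp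
  have E1b: "\<bar>E1 t j\<bar> * (1 + lam j * t powr \<alpha>) \<le> C0" for t j
    using C1[OF nn, of j t] by (simp add: E1_def C0_def)
  have E2b: "\<bar>E2 t j\<bar> * (1 + lam j * t powr \<alpha>) \<le> C0" if "0 \<le> t" "t \<le> T" for t j
  proof -
    let ?m = "\<bar>mittag_leffler \<alpha> 2 (- (lam j * t powr \<alpha>))\<bar> * (1 + lam j * t powr \<alpha>)"
    have "0 \<le> ?m" using nn[of j t] by simp
    hence "t * ?m \<le> T * C2" using C2[OF nn, of j t] that by (intro mult_mono) auto
    thus ?thesis using that by (simp add: E2_def C0_def abs_mult mult.assoc)
  qed
  define \<tau> where "\<tau> = T1 powr \<alpha>"
  have tau: "\<tau> > 0" "T2 powr \<alpha> \<ge> \<tau>" using T T1 al by (auto simp: \<tau>_def intro!: powr_mono2)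
  \<comment> \<open>At the two observation times 1 + \<lambda> t^\<alpha> \<ge> \<lambda> \<tau>,
    which turns the general decay into a bound C / \<lambda> for the matrix entries.\<close>
  define C where "C = C0 / \<tau>"
  have C: "C > 0" using C0 tau by (simp add: C_def)
  have bd: "\<bar>E1 t j\<bar> \<le> C / lam j" "\<bar>E2 t j\<bar> \<le> C / lam j" if "t = T1 \<or> t = T2" for t j
  proof -
    have t: "0 \<le> t" "t \<le> T" "\<tau> \<le> t powr \<alpha>" using that T1 tau by (auto simp: \<tau>_def)
    have s: "lam j * \<tau> \<le> 1 + lam j * t powr \<alpha>"
    proof -
      have "lam j * \<tau> \<le> lam j * t powr \<alpha>" using t(3) lp[of j] by (intro mult_left_mono) auto
      thus ?thesis by simp
    qed
    have "\<bar>e\<bar> \<le> C / lam j" if "\<bar>e\<bar> * (1 + lam j * t powr \<alpha>) \<le> C0" for e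
    proof -
      have "\<bar>e\<bar> * (lam j * \<tau>) \<le> C0" using that s mult_left_mono[OF s, of "\<bar>e\<bar>"] by simp
      thus ?thesis using lp[of j] tau by (simp add: C_def field_simps)
    qed
    thus "\<bar>E1 t j\<bar> \<le> C / lam j" "\<bar>E2 t j\<bar> \<le> C / lam j" using E1b E2b t by blast+
  qed
  \<comment> \<open>The three constants are what the assumed bounds give for the diagonal entry at
    \<open>T1\<close>, the diagonal entry at \<open>T2\<close> and the determinant \<psi>; their
    minimum serves all three.\<close>
  define c1 where "c1 = - 1 / (2 * Gamma (1 - \<alpha>) * T1 powr \<alpha>)"
  define c2 where "c2 = T2 * (1 / (2 * Gamma (2 - \<alpha>) * T2 powr \<alpha>))"
  define c3 where "c3 = - (c_star / (Gamma (1 - \<alpha>) * Gamma (2 - \<alpha>)) * (T2 - T1) / (T1 powr \<alpha> * T2 powr \<alpha>))"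
  have c1: "c1 > 0" using G1 T1 by (simp add: c1_def zero_less_divide_iff mult_less_0_iff)
  have c2: "c2 > 0" using G2 T1 by (simp add: c2_def)
  have c3: "c3 > 0"
  proof -
    have "Gamma (1 - \<alpha>) * Gamma (2 - \<alpha>) < 0" using G1 G2 by (simp add: mult_less_0_iff)
    hence "c_star / (Gamma (1 - \<alpha>) * Gamma (2 - \<alpha>)) < 0" using cs by (simp add: divide_less_0_iff)
    moreover have "(T2 - T1) / (T1 powr \<alpha> * T2 powr \<alpha>) > 0" using T T1 by simp
    ultimately show ?thesis unfolding c3_def times_divide_eq_right[symmetric] neg_0_less_iff_less
      by (rule mult_neg_pos)
  qed
  define c where "c = min c1 (min c2 c3)"
  have c: "c > 0" "c \<le> c1" "c \<le> c2" "c \<le> c3" using c1 c2 c3 by (auto simp: c_def)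
  \<comment> \<open>The extra size condition on \<open>M (lam 0)\<close> places the first mode in
    the asymptotic range at both observation times; larger eigenvalues only increase the
    argument.\<close>
  have zl: "z0 \<le> lam j * t powr \<alpha>" if "t = T1 \<or> t = T2" for t j
  proof -
    have "M powr \<alpha> \<le> t powr \<alpha>" using that M T al by (intro powr_mono2) auto
    hence "z0 / lam 0 \<le> t powr \<alpha>" using Mz by simp
    hence "z0 \<le> lam 0 * t powr \<alpha>" using l0 by (simp add: field_simps)
    also have "\<dots> \<le> lam j * t powr \<alpha>" using lj by (intro mult_right_mono) auto
    finally show ?thesis .
  qed
  have pl: "E1 T1 j \<le> - c / lam j" for j
  proof -
    have "E1 T1 j \<le> 1 / (2 * Gamma (1 - \<alpha>) * (lam j * T1 powr \<alpha>))"
      using ml1[OF zl[of T1 j]] by (simp add: E1_def)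
    also have "\<dots> = - (c1 / lam j)" by (simp add: c1_def)
    also have "\<dots> \<le> - (c / lam j)" using c lp[of j] by (simp add: divide_right_mono)
    finally show ?thesis by simp
  qed
  have Rl: "E2 T2 j \<ge> c / lam j" for j
  proof -
    have "c / lam j \<le> c2 / lam j" using c lp[of j] by (simp add: divide_right_mono)
    also have "\<dots> = T2 * (1 / (2 * Gamma (2 - \<alpha>) * (lam j * T2 powr \<alpha>)))" by (simp add: c2_def)
    also have "\<dots> \<le> E2 T2 j" unfolding E2_def using ml2[OF zl[of T2 j]] T1 by (intro mult_left_mono) auto
    finally show ?thesis .
  qed
  have psil: "E1 T1 j * E2 T2 j - E2 T1 j * E1 T2 j \<le> - c / (lam j)\<^sup>2" for j
  proof -
    have "E1 T1 j * E2 T2 j - E2 T1 j * E1 T2 j = dw_psi \<alpha> T1 T2 (lam j)"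
      by (simp add: E1_def E2_def dw_psi_def)
    also have "\<dots> \<le> c_star / (Gamma (1 - \<alpha>) * Gamma (2 - \<alpha>)) * (T2 - T1) / (T1 powr \<alpha> * T2 powr \<alpha>) / (lam j)\<^sup>2"
    proof (rule dw_psi_upper[of \<alpha> "lam 0" "lam j" T1 T2 M])
      fix t1 t2 assume "M \<le> t1" "t1 < t2"
      from psi[OF this] show "dw_psi \<alpha> t1 t2 (lam 0) \<le> c_star / (Gamma (1 - \<alpha>) * Gamma (2 - \<alpha>)) * (t2 - t1)
          * (1 / ((lam 0)\<^sup>2 * t1 powr \<alpha> * t2 powr \<alpha>))" by simp
    qed (use al l0 lj T T1 in auto)
    also have "\<dots> = - (c3 / (lam j)\<^sup>2)" by (simp add: c3_def)
    also have "\<dots> \<le> - (c / (lam j)\<^sup>2)" using c by (simp add: divide_right_mono)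
    finally show ?thesis by simp
  qed
  define K0 where "K0 = (1 + C) / min 1 c"
  have K0: "K0 > 0" using C c by (simp add: K0_def)
  \<comment> \<open>Each of the two initial errors contributes K0 N j, damped by at most C0 / (1 +
    \<lambda> t^\<alpha>).\<close>
  define K where "K = K0 * (2 * C0)"
  show thesis
  proof (rule that[of K])
    show "K > 0" using K0 C0 by (simp add: K_def)
    fix \<gamma> \<delta> g1 g2 v v1
    assume g: "\<gamma> > 0" and g1: "g1 \<in> L2_fun \<Omega>" and g2: "g2 \<in> L2_fun \<Omega>"
      and d1: "norm_L2 \<Omega> (\<lambda>x. u T1 x - g1 x) = \<delta>" and d2: "norm_L2 \<Omega> (\<lambda>x. u T2 x - g2 x) = \<delta>"
      and reg: "dw_regularized \<Omega> lam \<phi> \<alpha> T T1 T2 \<gamma> g1 g2 v v1"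
    have vs: "dw_solution \<Omega> lam \<phi> \<alpha> T (v 0) v1 v"
      and r1: "L2_eq \<Omega> (\<lambda>x. - \<gamma> * v 0 x + v T1 x) g1" and r2: "L2_eq \<Omega> (\<lambda>x. \<gamma> * v1 x + v T2 x) g2"
      using reg by (simp_all add: dw_regularized_def)
    have L: "b \<in> L2_fun \<Omega>" "v 0 \<in> L2_fun \<Omega>" "v1 \<in> L2_fun \<Omega>"
      using sol vs by (simp_all add: dw_solution_def)
    have Lt: "u t \<in> L2_fun \<Omega>" "v t \<in> L2_fun \<Omega>" if "0 \<le> t" "t \<le> T" for t
      using sol vs that by (simp_all add: dw_solution_def)
    define ca where "ca = (\<lambda>j. L2_inner \<Omega> a (\<phi> j))"
    define cb where "cb = (\<lambda>j. L2_inner \<Omega> b (\<phi> j))"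
    define x where "x = (\<lambda>j. L2_inner \<Omega> (v 0) (\<phi> j) - ca j)"
    define y where "y = (\<lambda>j. L2_inner \<Omega> v1 (\<phi> j) - cb j)"
    define n1 where "n1 = (\<lambda>j. L2_inner \<Omega> (\<lambda>x. u T1 x - g1 x) (\<phi> j))"
    define n2 where "n2 = (\<lambda>j. L2_inner \<Omega> (\<lambda>x. u T2 x - g2 x) (\<phi> j))"
    have cu: "L2_inner \<Omega> (u t) (\<phi> j) = E1 t j * ca j + E2 t j * cb j" if "0 \<le> t" "t \<le> T" for t j
      using dw_solution_coeff[OF es sol that] by (simp add: E1_def E2_def ca_def cb_def)
    have cv: "L2_inner \<Omega> (v t) (\<phi> j) = E1 t j * (x j + ca j) + E2 t j * (y j + cb j)" if "0 \<le> t" "t \<le> T" for t j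
      using dw_solution_coeff[OF es vs that] by (simp add: E1_def E2_def x_def y_def)
    have v0c: "L2_inner \<Omega> (v 0) (\<phi> j) = x j + ca j" and v1c: "L2_inner \<Omega> v1 (\<phi> j) = y j + cb j" for j
      by (simp_all add: x_def y_def)
    \<comment> \<open>The exact solution satisfies the observation equation without the \<gamma>
      term, so subtraction leaves \<gamma> times the exact initial datum and the noise as right-hand
      side. The second equation is obtained in the same way.\<close>
    have q1: "(E1 T1 j - \<gamma>) * x j + E2 T1 j * y j = \<gamma> * ca j - n1 j" for j
    proof -
      have Lg: "(\<lambda>x. - \<gamma> * v 0 x + v T1 x) \<in> L2_fun \<Omega>" using L Lt T1 by (intro L2_fun_add L2_fun_scale) auto
      have "L2_inner \<Omega> g1 (\<phi> j) = L2_inner \<Omega> (\<lambda>x. - \<gamma> * v 0 x + v T1 x) (\<phi> j)"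
        by (rule L2_inner_cong[OF r1 Lg g1 phi, symmetric])
      also have "\<dots> = - \<gamma> * L2_inner \<Omega> (v 0) (\<phi> j) + L2_inner \<Omega> (v T1) (\<phi> j)"
        unfolding L2_inner_scale_left[symmetric] using L Lt T1 phi by (intro L2_inner_add_left L2_fun_scale) auto
      finally have 1: "L2_inner \<Omega> g1 (\<phi> j) = - \<gamma> * (x j + ca j) + (E1 T1 j * (x j + ca j) + E2 T1 j * (y j + cb j))"
        unfolding v0c cv[OF less_imp_le[OF T1(1)] T1(4)] .
      have "n1 j = L2_inner \<Omega> (u T1) (\<phi> j) - L2_inner \<Omega> g1 (\<phi> j)"
        unfolding n1_def using Lt T1 g1 phi by (intro L2_inner_diff_left) auto
      thus ?thesis using T1 by (simp add: cu 1 algebra_simps)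
    qed
    have q2: "E1 T2 j * x j + (\<gamma> + E2 T2 j) * y j = - \<gamma> * cb j - n2 j" for j
    proof -
      have Lg: "(\<lambda>x. \<gamma> * v1 x + v T2 x) \<in> L2_fun \<Omega>" using L Lt T1 by (intro L2_fun_add L2_fun_scale) auto
      have "L2_inner \<Omega> g2 (\<phi> j) = L2_inner \<Omega> (\<lambda>x. \<gamma> * v1 x + v T2 x) (\<phi> j)"
        by (rule L2_inner_cong[OF r2 Lg g2 phi, symmetric])
      also have "\<dots> = \<gamma> * L2_inner \<Omega> v1 (\<phi> j) + L2_inner \<Omega> (v T2) (\<phi> j)"
        unfolding L2_inner_scale_left[symmetric] using L Lt T1 phi by (intro L2_inner_add_left L2_fun_scale) auto
      finally have 1: "L2_inner \<Omega> g2 (\<phi> j) = \<gamma> * (y j + cb j) + (E1 T2 j * (x j + ca j) + E2 T2 j * (y j + cb j))"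
        unfolding v1c cv[OF less_imp_le[OF T1(2)] T1(5)] .
      have "n2 j = L2_inner \<Omega> (u T2) (\<phi> j) - L2_inner \<Omega> g2 (\<phi> j)"
        unfolding n2_def using Lt T1 g2 phi by (intro L2_inner_diff_left) auto
      thus ?thesis using T1 by (simp add: cu 1 algebra_simps)
    qed
    define N where "N = (\<lambda>j. (\<gamma> * (\<bar>ca j\<bar> + \<bar>cb j\<bar>) + (\<bar>n1 j\<bar> + \<bar>n2 j\<bar>)) * (lam j / (1 + \<gamma> * lam j)))"
    have N0: "N j \<ge> 0" for j using g lp[of j] by (simp add: N_def add_nonneg_nonneg)
    have xy: "\<bar>x j\<bar> \<le> K0 * N j" "\<bar>y j\<bar> \<le> K0 * N j" for j
    proof -
      let ?A = "\<gamma> * ca j - n1 j" and ?B = "- \<gamma> * cb j - n2 j"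
      have "\<bar>?A\<bar> \<le> \<bar>\<gamma> * ca j\<bar> + \<bar>n1 j\<bar>" "\<bar>?B\<bar> \<le> \<bar>\<gamma> * cb j\<bar> + \<bar>n2 j\<bar>" by auto
      hence "\<bar>?A\<bar> + \<bar>?B\<bar> \<le> \<gamma> * (\<bar>ca j\<bar> + \<bar>cb j\<bar>) + (\<bar>n1 j\<bar> + \<bar>n2 j\<bar>)"
        using g by (simp add: abs_mult algebra_simps)
      hence AB: "(\<bar>?A\<bar> + \<bar>?B\<bar>) * (lam j / (1 + \<gamma> * lam j)) \<le> N j"
        unfolding N_def using g lp[of j] by (intro mult_right_mono) auto
      have m: "\<bar>x j\<bar> \<le> K0 * ((\<bar>?A\<bar> + \<bar>?B\<bar>) * (lam j / (1 + \<gamma> * lam j)))"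
        "\<bar>y j\<bar> \<le> K0 * ((\<bar>?A\<bar> + \<bar>?B\<bar>) * (lam j / (1 + \<gamma> * lam j)))"
        unfolding K0_def
        by (rule mode_system_bound[OF lp g c(1) C pl Rl psil bd(1)[of T1] bd(2)[of T1] bd(1)[of T2] bd(2)[of T2] q1 q2]; simp)+
      have "K0 * ((\<bar>?A\<bar> + \<bar>?B\<bar>) * (lam j / (1 + \<gamma> * lam j))) \<le> K0 * N j"
        using AB K0 by (intro mult_left_mono) auto
      thus "\<bar>x j\<bar> \<le> K0 * N j" "\<bar>y j\<bar> \<le> K0 * N j" using m by linarith+
    qed
    have KN: "K0 * N j \<le> K * N j" for j
      unfolding K_def using K0 C0 N0[of j] by (intro mult_right_mono) auto
    show "\<exists>n1 n2. (\<lambda>j. (n1 j)\<^sup>2) sums \<delta>\<^sup>2 \<and> (\<lambda>j. (n2 j)\<^sup>2) sums \<delta>\<^sup>2 \<and>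
         (\<forall>j. \<bar>L2_inner \<Omega> (\<lambda>x. v1 x - b x) (\<phi> j)\<bar> \<le>
            K * (\<gamma> * (\<bar>L2_inner \<Omega> a (\<phi> j)\<bar> + \<bar>L2_inner \<Omega> b (\<phi> j)\<bar>) + (\<bar>n1 j\<bar> + \<bar>n2 j\<bar>)) * (lam j / (1 + \<gamma> * lam j))) \<and>
         (\<forall>t\<in>{0..T}. \<forall>j. \<bar>L2_inner \<Omega> (\<lambda>x. v t x - u t x) (\<phi> j)\<bar> \<le>
            K * (\<gamma> * (\<bar>L2_inner \<Omega> a (\<phi> j)\<bar> + \<bar>L2_inner \<Omega> b (\<phi> j)\<bar>) + (\<bar>n1 j\<bar> + \<bar>n2 j\<bar>)) * (lam j / (1 + \<gamma> * lam j))
              / (1 + lam j * t powr \<alpha>))"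
    proof (intro exI conjI allI ballI)
      show "(\<lambda>j. (n1 j)\<^sup>2) sums \<delta>\<^sup>2"
        unfolding n1_def d1[symmetric] using Lt T1 g1 by (intro dirichlet_eigensystem_parseval[OF es] L2_fun_diff) auto
      show "(\<lambda>j. (n2 j)\<^sup>2) sums \<delta>\<^sup>2"
        unfolding n2_def d2[symmetric] using Lt T1 g2 by (intro dirichlet_eigensystem_parseval[OF es] L2_fun_diff) auto
      fix j
      have "L2_inner \<Omega> (\<lambda>x. v1 x - b x) (\<phi> j) = y j"
        unfolding y_def cb_def by (rule L2_inner_diff_left[OF L(3,1) phi])
      hence "\<bar>L2_inner \<Omega> (\<lambda>x. v1 x - b x) (\<phi> j)\<bar> \<le> K * N j" using xy(2)[of j] KN[of j] by simp
      thus "\<bar>L2_inner \<Omega> (\<lambda>x. v1 x - b x) (\<phi> j)\<bar> \<le>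
            K * (\<gamma> * (\<bar>L2_inner \<Omega> a (\<phi> j)\<bar> + \<bar>L2_inner \<Omega> b (\<phi> j)\<bar>) + (\<bar>n1 j\<bar> + \<bar>n2 j\<bar>)) * (lam j / (1 + \<gamma> * lam j))"
        by (simp only: N_def ca_def cb_def mult.assoc)
    next
      fix t j assume "t \<in> {0..T}"
      hence t: "0 \<le> t" "t \<le> T" by auto
      have w: "1 + lam j * t powr \<alpha> > 0" using nn[of j t] by simp
      have "L2_inner \<Omega> (\<lambda>x. v t x - u t x) (\<phi> j) = E1 t j * x j + E2 t j * y j"
        using L2_inner_diff_left[OF Lt(2)[OF t] Lt(1)[OF t] phi, of j] by (simp add: cu[OF t] cv[OF t] algebra_simps)
      hence "\<bar>L2_inner \<Omega> (\<lambda>x. v t x - u t x) (\<phi> j)\<bar> \<le> \<bar>E1 t j\<bar> * \<bar>x j\<bar> + \<bar>E2 t j\<bar> * \<bar>y j\<bar>"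
        by (simp only: abs_mult[symmetric] abs_triangle_ineq)
      also have "\<dots> \<le> C0 / (1 + lam j * t powr \<alpha>) * (K0 * N j) + C0 / (1 + lam j * t powr \<alpha>) * (K0 * N j)"
      proof (intro add_mono mult_mono xy)
        show "\<bar>E1 t j\<bar> \<le> C0 / (1 + lam j * t powr \<alpha>)" "\<bar>E2 t j\<bar> \<le> C0 / (1 + lam j * t powr \<alpha>)"
          using E1b[of t j] E2b[OF t, of j] w by (simp_all add: pos_le_divide_eq)
      qed (use C0 w in auto)
      also have "\<dots> = K * N j / (1 + lam j * t powr \<alpha>)" by (simp add: K_def)
      finally show "\<bar>L2_inner \<Omega> (\<lambda>x. v t x - u t x) (\<phi> j)\<bar> \<le>
            K * (\<gamma> * (\<bar>L2_inner \<Omega> a (\<phi> j)\<bar> + \<bar>L2_inner \<Omega> b (\<phi> j)\<bar>) + (\<bar>n1 j\<bar> + \<bar>n2 j\<bar>)) * (lam j / (1 + \<gamma> * lam j))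
              / (1 + lam j * t powr \<alpha>)"
        by (simp only: N_def ca_def cb_def mult.assoc)
    qed
  qed
qed

section \<open>Convergence rates\<close>

text \<open>The square of a three-term sum is at most three times the sum of the squares; this
  replaces the triangle inequality in the space of square-summable sequences and accounts for the
  factor 3.\<close>

lemma l2_error_bound:
  fixes z h n1 n2 :: "nat \<Rightarrow> real"
  assumes z: "(\<lambda>j. (z j)\<^sup>2) sums Z\<^sup>2" and h: "(\<lambda>j. (h j)\<^sup>2) sums H\<^sup>2"
    and n: "(\<lambda>j. (n1 j)\<^sup>2) sums \<delta>\<^sup>2" "(\<lambda>j. (n2 j)\<^sup>2) sums \<delta>\<^sup>2"
    and nn: "X \<ge> 0" "Y \<ge> 0" "H \<ge> 0" "\<delta> \<ge> 0" "\<And>j. h j \<ge> 0"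
    and le: "\<And>j. \<bar>z j\<bar> \<le> X * h j + Y * (\<bar>n1 j\<bar> + \<bar>n2 j\<bar>)"
  shows "Z \<le> 3 * (X * H + Y * \<delta>)"
proof -
  have "(z j)\<^sup>2 \<le> 3 * X\<^sup>2 * (h j)\<^sup>2 + 3 * Y\<^sup>2 * (n1 j)\<^sup>2 + 3 * Y\<^sup>2 * (n2 j)\<^sup>2" for j
  proof -
    have "(z j)\<^sup>2 \<le> (X * h j + Y * (\<bar>n1 j\<bar> + \<bar>n2 j\<bar>))\<^sup>2"
      using power_mono[OF le[of j], of 2] by simp
    also have "\<dots> = (X * h j + Y * \<bar>n1 j\<bar> + Y * \<bar>n2 j\<bar>)\<^sup>2" by (simp add: algebra_simps)
    also have "\<dots> \<le> 3 * (X * h j)\<^sup>2 + 3 * (Y * \<bar>n1 j\<bar>)\<^sup>2 + 3 * (Y * \<bar>n2 j\<bar>)\<^sup>2"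
    proof -
      have "(p + q + r)\<^sup>2 \<le> 3 * p\<^sup>2 + 3 * q\<^sup>2 + 3 * r\<^sup>2" for p q r :: real
      proof -
        have "3 * p\<^sup>2 + 3 * q\<^sup>2 + 3 * r\<^sup>2 - (p + q + r)\<^sup>2 = (p - q)\<^sup>2 + (q - r)\<^sup>2 + (p - r)\<^sup>2"
          by algebra
        also have "\<dots> \<ge> 0" by (intro add_nonneg_nonneg zero_le_power2)
        finally show ?thesis by (simp only: diff_ge_0_iff_ge)
      qed
      thus ?thesis .
    qed
    finally show ?thesis by (simp add: power_mult_distrib)
  qed
  moreover have "(\<lambda>j. 3 * X\<^sup>2 * (h j)\<^sup>2 + 3 * Y\<^sup>2 * (n1 j)\<^sup>2 + 3 * Y\<^sup>2 * (n2 j)\<^sup>2) sums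
      (3 * X\<^sup>2 * H\<^sup>2 + 3 * Y\<^sup>2 * \<delta>\<^sup>2 + 3 * Y\<^sup>2 * \<delta>\<^sup>2)"
    by (intro sums_add sums_mult h n)
  ultimately have "Z\<^sup>2 \<le> 3 * X\<^sup>2 * H\<^sup>2 + 3 * Y\<^sup>2 * \<delta>\<^sup>2 + 3 * Y\<^sup>2 * \<delta>\<^sup>2"
    by (rule sums_le[OF _ z])
  also have "\<dots> \<le> (3 * (X * H + Y * \<delta>))\<^sup>2"
  proof -
    have "(3 * (p + q))\<^sup>2 = 9 * p\<^sup>2 + 9 * q\<^sup>2 + 18 * (p * q)" for p q :: real
      by (simp add: power2_eq_square algebra_simps)
    hence "(3 * (X * H + Y * \<delta>))\<^sup>2 = 9 * (X\<^sup>2 * H\<^sup>2) + 9 * (Y\<^sup>2 * \<delta>\<^sup>2) + 18 * ((X * H) * (Y * \<delta>))"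
      by (simp only: power_mult_distrib)
    moreover have "0 \<le> (X * H) * (Y * \<delta>)" using nn by simp
    moreover have "0 \<le> X\<^sup>2 * H\<^sup>2" "0 \<le> Y\<^sup>2 * \<delta>\<^sup>2" by simp_all
    ultimately show ?thesis by linarith
  qed
  finally have "Z\<^sup>2 \<le> (3 * (X * H + Y * \<delta>))\<^sup>2" .
  moreover have "0 \<le> 3 * (X * H + Y * \<delta>)" using nn(1-4) by simp
  ultimately show ?thesis by (rule power2_le_imp_le)
qed

text \<open>(w l)^\<theta> is at most 1 when w l \<le> 1 and at most w l otherwise, so it never
  exceeds 1 + w l. It is applied with w = \<gamma> for the regularization and w = t^\<alpha> for the
  smoothing.\<close>

lemma powr_interpolate:
  fixes w l \<theta> :: real
  assumes "w > 0" "l > 0" "0 \<le> \<theta>" "\<theta> \<le> 1"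
  shows "l powr \<theta> / (1 + w * l) \<le> w powr (- \<theta>)"
proof -
  have "(w * l) powr \<theta> \<le> 1 + w * l"
  proof (cases "w * l \<le> 1")
    case True
    hence "(w * l) powr \<theta> \<le> 1 powr \<theta>" using assms by (intro powr_mono2) auto
    moreover have "0 < w * l" using assms by simp
    ultimately show ?thesis by simp
  next
    case False
    hence "(w * l) powr \<theta> \<le> (w * l) powr 1" using assms by (intro powr_mono) auto
    thus ?thesis using assms by simp
  qed
  hence "w powr \<theta> * l powr \<theta> \<le> 1 + w * l" by (simp only: powr_mult)
  moreover have p: "0 < 1 + w * l" using assms by (intro add_pos_pos mult_pos_pos) auto
  ultimately have "w powr \<theta> * l powr \<theta> / (1 + w * l) \<le> 1" by (simp only: divide_le_eq_1_pos)
  hence "l powr \<theta> / (1 + w * l) \<le> 1 / w powr \<theta>"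
    using assms(1) by (metis mult.commute pos_le_divide_eq powr_gt_zero times_divide_eq_left less_numeral_extra(3))
  thus ?thesis by (simp only: powr_minus_divide)
qed

text \<open>The factor \<gamma> l / (1 + \<gamma> l) lies between 0 and 1, so the squares of
  \<open>d\<close> dominate, and it tends to 0 for each fixed l. No rate is available because the
  eigenvalues may be unbounded.\<close>

lemma filter_factor_tendsto_0:
  fixes l d :: "nat \<Rightarrow> real"
  assumes "\<And>j. l j > 0" "summable (\<lambda>j. (d j)\<^sup>2)"
  shows "((\<lambda>\<gamma>. \<Sum>j. (\<gamma> * l j / (1 + \<gamma> * l j) * d j)\<^sup>2) \<longlongrightarrow> 0) (at_right 0)"
proof -
  have "((\<lambda>\<gamma>. \<Sum>j. (\<gamma> * l j / (1 + \<gamma> * l j) * d j)\<^sup>2) \<longlongrightarrow> (\<Sum>j::nat. 0)) (at_right 0)"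
  proof (rule tannerys_theorem[where M = "\<lambda>j. (d j)\<^sup>2", THEN conjunct2, THEN conjunct2])
    fix j
    have "((\<lambda>\<gamma>. (\<gamma> * l j / (1 + \<gamma> * l j) * d j)\<^sup>2) \<longlongrightarrow> (0 * l j / (1 + 0 * l j) * d j)\<^sup>2) (at_right 0)"
      by (intro tendsto_intros) auto
    thus "((\<lambda>\<gamma>. (\<gamma> * l j / (1 + \<gamma> * l j) * d j)\<^sup>2) \<longlongrightarrow> 0) (at_right 0)" by simp
  next
    have "norm ((\<gamma> * l j / (1 + \<gamma> * l j) * d j)\<^sup>2) \<le> (d j)\<^sup>2" if "\<gamma> > 0" for \<gamma> j
    proof -
      have p: "0 < \<gamma> * l j" using that assms(1)[of j] by simp
      hence "(\<gamma> * l j / (1 + \<gamma> * l j))\<^sup>2 \<le> 1\<^sup>2" by (intro power_mono) (auto simp: divide_le_eq)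
      hence "(\<gamma> * l j / (1 + \<gamma> * l j))\<^sup>2 * (d j)\<^sup>2 \<le> 1 * (d j)\<^sup>2" by (intro mult_right_mono) auto
      thus ?thesis by (simp only: power_mult_distrib real_norm_def) simp
    qed
    thus "\<forall>\<^sub>F (j, \<gamma>) in at_top \<times>\<^sub>F at_right 0. norm ((\<gamma> * l j / (1 + \<gamma> * l j) * d j)\<^sup>2) \<le> (d j)\<^sup>2"
      by (intro eventually_prod_filter[THEN iffD2] exI[of _ "\<lambda>_. True"] exI[of _ "\<lambda>\<gamma>. \<gamma> > 0"])
         (auto intro: eventually_at_right_less)
  qed (use assms in auto)
  thus ?thesis by simp
qed

theorem theorem3p7:
  fixes \<Omega> :: "'a::euclidean_space set"
    and lam :: "nat \<Rightarrow> real" and \<phi> :: "nat \<Rightarrow> 'a \<Rightarrow> real"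
    and \<alpha> T T1 T2 c_star z0 :: real and M :: "real \<Rightarrow> real"
    and a b :: "'a \<Rightarrow> real" and u :: "real \<Rightarrow> 'a \<Rightarrow> real"
  assumes "DIM('a) \<le> 3" and "convex_polyhedral_domain \<Omega>"
    and "dirichlet_eigensystem \<Omega> lam \<phi>"
    and "1 < \<alpha>" and "\<alpha> < 2"
    and "c_star > 0"
    and "\<And>l. l > 0 \<Longrightarrow> M l > 0"
    and "\<And>l t1 t2. l > 0 \<Longrightarrow> M l \<le> t1 \<Longrightarrow> t1 < t2 \<Longrightarrow>
           dw_psi \<alpha> t1 t2 l \<le> c_star * (t2 - t1) / (Gamma (1 - \<alpha>) * Gamma (2 - \<alpha>))
                                  * (1 / (l\<^sup>2 * t1 powr \<alpha> * t2 powr \<alpha>)) \<and>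
           c_star * (t2 - t1) / (Gamma (1 - \<alpha>) * Gamma (2 - \<alpha>))
             * (1 / (l\<^sup>2 * t1 powr \<alpha> * t2 powr \<alpha>)) < 0"
    and "z0 > 0"
    and "\<And>z. z \<ge> z0 \<Longrightarrow> mittag_leffler \<alpha> 1 (- z) \<le> 1 / (2 * Gamma (1 - \<alpha>) * z) \<and>
                        1 / (2 * Gamma (1 - \<alpha>) * z) < 0"
    and "\<And>z. z \<ge> z0 \<Longrightarrow> mittag_leffler \<alpha> 2 (- z) \<ge> 1 / (2 * Gamma (2 - \<alpha>) * z) \<and>
                        1 / (2 * Gamma (2 - \<alpha>) * z) > 0"
    and "M (lam 0) powr \<alpha> > z0 / lam 0"
    and "M (lam 0) \<le> T1" and "T1 < T2" and "T2 \<le> T"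
    and "dw_solution \<Omega> lam \<phi> \<alpha> T a b u"
  shows "(\<forall>q\<in>{0..2}. a \<in> Hdot \<Omega> lam \<phi> q \<and> b \<in> Hdot \<Omega> lam \<phi> q \<longrightarrow>
            (\<exists>c>0. \<forall>\<gamma> \<delta> g1 g2 v v1.
               \<gamma> > 0 \<and> g1 \<in> L2_fun \<Omega> \<and> g2 \<in> L2_fun \<Omega> \<and>
               norm_L2 \<Omega> (\<lambda>x. u T1 x - g1 x) = \<delta> \<and> norm_L2 \<Omega> (\<lambda>x. u T2 x - g2 x) = \<delta> \<and>
               dw_regularized \<Omega> lam \<phi> \<alpha> T T1 T2 \<gamma> g1 g2 v v1 \<longrightarrow>
                 norm_L2 \<Omega> (\<lambda>x. v 0 x - u 0 x) + norm_L2 \<Omega> (\<lambda>x. v1 x - b x)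
                   \<le> c * (\<gamma> powr (q / 2) + \<delta> * \<gamma> powr (-1)) \<and>
                 (\<forall>t\<in>{0<..T}.
                    norm_L2 \<Omega> (\<lambda>x. v t x - u t x)
                      \<le> c * (\<gamma> * min (\<gamma> powr (- (1 - q / 2))) (t powr (- \<alpha> * (1 - q / 2)))
                             + \<delta> * min (\<gamma> powr (-1)) (t powr (- \<alpha>))))))
       \<and> (\<forall>s\<in>{0<..1}. \<forall>\<epsilon>>0. \<exists>\<eta>>0. \<forall>\<gamma> \<delta> g1 g2 v v1.
               0 < \<gamma> \<and> \<gamma> < \<eta> \<and> \<delta> < \<eta> \<and> \<delta> / \<gamma> < \<eta> \<and>
               g1 \<in> L2_fun \<Omega> \<and> g2 \<in> L2_fun \<Omega> \<and>
               norm_L2 \<Omega> (\<lambda>x. u T1 x - g1 x) = \<delta> \<and> norm_L2 \<Omega> (\<lambda>x. u T2 x - g2 x) = \<delta> \<and>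
               dw_regularized \<Omega> lam \<phi> \<alpha> T T1 T2 \<gamma> g1 g2 v v1 \<longrightarrow>
                 norm_L2 \<Omega> (\<lambda>x. v 0 x - u 0 x)
                   + norm_Hdot \<Omega> lam \<phi> (- s) (\<lambda>x. v1 x - b x) < \<epsilon>)"
proof -
  note es = assms(3)
  have l0: "lam 0 > 0" by (rule dirichlet_eigensystem_pos[OF assms(2,3)])
  have lj: "lam j \<ge> lam 0" for j by (rule dirichlet_eigensystemD(4)[OF es])
  have lp: "lam j > 0" for j using l0 lj[of j] by simp
  have T: "0 \<le> T" "0 < T1" "T1 \<le> T" using assms(7)[OF l0] assms(13-15) by auto
  define ca where "ca = (\<lambda>j. \<bar>L2_inner \<Omega> a (\<phi> j)\<bar> + \<bar>L2_inner \<Omega> b (\<phi> j)\<bar>)"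
  have ca_eq: "\<bar>L2_inner \<Omega> a (\<phi> j)\<bar> + \<bar>L2_inner \<Omega> b (\<phi> j)\<bar> = ca j" for j
    by (simp add: ca_def)
  have ca0: "ca j \<ge> 0" for j by (simp add: ca_def)
  obtain K where K: "K > 0" and coeffs:
    "\<And>\<gamma> \<delta> g1 g2 v v1. \<gamma> > 0 \<Longrightarrow> g1 \<in> L2_fun \<Omega> \<Longrightarrow> g2 \<in> L2_fun \<Omega> \<Longrightarrow>
       norm_L2 \<Omega> (\<lambda>x. u T1 x - g1 x) = \<delta> \<Longrightarrow> norm_L2 \<Omega> (\<lambda>x. u T2 x - g2 x) = \<delta> \<Longrightarrow>
       dw_regularized \<Omega> lam \<phi> \<alpha> T T1 T2 \<gamma> g1 g2 v v1 \<Longrightarrow>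
       \<exists>n1 n2. (\<lambda>j. (n1 j)\<^sup>2) sums \<delta>\<^sup>2 \<and> (\<lambda>j. (n2 j)\<^sup>2) sums \<delta>\<^sup>2 \<and>
         (\<forall>j. \<bar>L2_inner \<Omega> (\<lambda>x. v1 x - b x) (\<phi> j)\<bar> \<le>
            K * (\<gamma> * ca j + (\<bar>n1 j\<bar> + \<bar>n2 j\<bar>)) * (lam j / (1 + \<gamma> * lam j))) \<and>
         (\<forall>t\<in>{0..T}. \<forall>j. \<bar>L2_inner \<Omega> (\<lambda>x. v t x - u t x) (\<phi> j)\<bar> \<le>
            K * (\<gamma> * ca j + (\<bar>n1 j\<bar> + \<bar>n2 j\<bar>)) * (lam j / (1 + \<gamma> * lam j))
              / (1 + lam j * t powr \<alpha>))"
  proof (rule regularized_error_coeffs[OF assms(2-6) assms(7)[OF l0] assms(8)[OF l0, THEN conjunct1]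
          assms(9-16), unfolded ca_eq], goal_cases)
    case (5 K)
    show thesis by (rule 5(1)[OF 5(2)]) (rule 5(3))
  qed assumption+
  define adm where "adm = (\<lambda>\<gamma> \<delta> g1 g2 v v1. \<gamma> > 0 \<and> g1 \<in> L2_fun \<Omega> \<and> g2 \<in> L2_fun \<Omega> \<and>
       norm_L2 \<Omega> (\<lambda>x. u T1 x - g1 x) = \<delta> \<and> norm_L2 \<Omega> (\<lambda>x. u T2 x - g2 x) = \<delta> \<and>
       dw_regularized \<Omega> lam \<phi> \<alpha> T T1 T2 \<gamma> g1 g2 v v1)"
  \<comment> \<open>A weight \<open>h\<close> with a bound \<open>X\<close> for the approximation factor and \<open>Y\<close> for the data error
    factor at time \<open>t\<close> gives an estimate of the error at time \<open>t\<close>.\<close>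
  have est: "norm_L2 \<Omega> (\<lambda>x. v t x - u t x) \<le> 3 * (K * X * H + K * Y * \<delta>)"
    and est1: "t = 0 \<Longrightarrow> norm_L2 \<Omega> (\<lambda>x. v1 x - b x) \<le> 3 * (K * X * H + K * Y * \<delta>)"
    if A: "adm \<gamma> \<delta> g1 g2 v v1" and t: "0 \<le> t" "t \<le> T"
      and h: "(\<lambda>j. (h j)\<^sup>2) sums H\<^sup>2" "H \<ge> 0" "\<And>j. h j \<ge> 0"
      and X: "X \<ge> 0" "\<And>j. \<gamma> * ca j * (lam j / (1 + \<gamma> * lam j)) / (1 + lam j * t powr \<alpha>) \<le> X * h j"
      and Y: "Y \<ge> 0" "\<And>j. lam j / (1 + \<gamma> * lam j) / (1 + lam j * t powr \<alpha>) \<le> Y"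
    for \<gamma> \<delta> :: real and g1 g2 v v1 t and h :: "nat \<Rightarrow> real" and H X Y
  proof -
    have A': "\<gamma> > 0" "g1 \<in> L2_fun \<Omega>" "g2 \<in> L2_fun \<Omega>"
       "norm_L2 \<Omega> (\<lambda>x. u T1 x - g1 x) = \<delta>" "norm_L2 \<Omega> (\<lambda>x. u T2 x - g2 x) = \<delta>"
       "dw_regularized \<Omega> lam \<phi> \<alpha> T T1 T2 \<gamma> g1 g2 v v1"
      using A by (simp_all add: adm_def)
    obtain n1 n2 where n: "(\<lambda>j. (n1 j)\<^sup>2) sums \<delta>\<^sup>2" "(\<lambda>j. (n2 j)\<^sup>2) sums \<delta>\<^sup>2"
      and b1: "\<forall>j. \<bar>L2_inner \<Omega> (\<lambda>x. v1 x - b x) (\<phi> j)\<bar> \<le>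
            K * (\<gamma> * ca j + (\<bar>n1 j\<bar> + \<bar>n2 j\<bar>)) * (lam j / (1 + \<gamma> * lam j))"
      and b2: "\<forall>t\<in>{0..T}. \<forall>j. \<bar>L2_inner \<Omega> (\<lambda>x. v t x - u t x) (\<phi> j)\<bar> \<le>
            K * (\<gamma> * ca j + (\<bar>n1 j\<bar> + \<bar>n2 j\<bar>)) * (lam j / (1 + \<gamma> * lam j)) / (1 + lam j * t powr \<alpha>)"
      using coeffs[OF A'] by (elim exE conjE) (rule that)
    have tT: "t \<in> {0..T}" using t by simp
    have L: "v t \<in> L2_fun \<Omega>" "u t \<in> L2_fun \<Omega>" "v1 \<in> L2_fun \<Omega>" "b \<in> L2_fun \<Omega>"
      using A'(6) assms(16) t by (simp_all add: dw_regularized_def dw_solution_def)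
    have d0: "\<delta> \<ge> 0" using A'(4) norm_L2_nonneg by metis
    have le: "K * (\<gamma> * ca j + (\<bar>n1 j\<bar> + \<bar>n2 j\<bar>)) * (lam j / (1 + \<gamma> * lam j)) / (1 + lam j * t powr \<alpha>)
        \<le> (K * X) * h j + (K * Y) * (\<bar>n1 j\<bar> + \<bar>n2 j\<bar>)" for j
    proof -
      define m where "m = lam j / (1 + \<gamma> * lam j)"
      define w where "w = 1 + lam j * t powr \<alpha>"
      have "K * (\<gamma> * ca j + (\<bar>n1 j\<bar> + \<bar>n2 j\<bar>)) * m / w
         = K * (\<gamma> * ca j * m / w) + K * ((m / w) * (\<bar>n1 j\<bar> + \<bar>n2 j\<bar>))"
        by (simp add: algebra_simps add_divide_distrib)
      also have "\<dots> \<le> K * (X * h j) + K * (Y * (\<bar>n1 j\<bar> + \<bar>n2 j\<bar>))"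
        using X(2)[of j] Y(2)[of j] K unfolding m_def[symmetric] w_def[symmetric]
        by (intro add_mono mult_left_mono mult_right_mono) auto
      finally show ?thesis by (simp only: m_def w_def mult.assoc)
    qed
    show "norm_L2 \<Omega> (\<lambda>x. v t x - u t x) \<le> 3 * (K * X * H + K * Y * \<delta>)"
    proof (rule l2_error_bound[OF dirichlet_eigensystem_parseval[OF es L2_fun_diff[OF L(1,2)]] h(1) n])
      fix j
      show "\<bar>L2_inner \<Omega> (\<lambda>x. v t x - u t x) (\<phi> j)\<bar> \<le> (K * X) * h j + (K * Y) * (\<bar>n1 j\<bar> + \<bar>n2 j\<bar>)"
        using b2[THEN bspec, OF tT, THEN spec, of j] le[of j] by (rule order.trans)
    qed (use K X Y h d0 in auto)
    show "norm_L2 \<Omega> (\<lambda>x. v1 x - b x) \<le> 3 * (K * X * H + K * Y * \<delta>)" if "t = 0"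
    proof (rule l2_error_bound[OF dirichlet_eigensystem_parseval[OF es L2_fun_diff[OF L(3,4)]] h(1) n])
      fix j
      show "\<bar>L2_inner \<Omega> (\<lambda>x. v1 x - b x) (\<phi> j)\<bar> \<le> (K * X) * h j + (K * Y) * (\<bar>n1 j\<bar> + \<bar>n2 j\<bar>)"
        using b1[THEN spec, of j] le[of j] that by simp
    qed (use K X Y h d0 in auto)
  qed
  have sumsq: "summable (\<lambda>j. lam j powr q * (ca j)\<^sup>2)"
    if "summable (\<lambda>j. lam j powr q * (L2_inner \<Omega> a (\<phi> j))\<^sup>2)" "summable (\<lambda>j. lam j powr q * (L2_inner \<Omega> b (\<phi> j))\<^sup>2)" for q
  proof (rule summable_comparison_test')
    show "summable (\<lambda>j. 2 * (lam j powr q * (L2_inner \<Omega> a (\<phi> j))\<^sup>2) + 2 * (lam j powr q * (L2_inner \<Omega> b (\<phi> j))\<^sup>2))"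
      by (intro summable_add summable_mult that)
    fix j :: nat assume "j \<ge> 0"
    have "(ca j)\<^sup>2 \<le> 2 * (L2_inner \<Omega> a (\<phi> j))\<^sup>2 + 2 * (L2_inner \<Omega> b (\<phi> j))\<^sup>2"
      using sum_squares_bound[of "\<bar>L2_inner \<Omega> a (\<phi> j)\<bar>" "\<bar>L2_inner \<Omega> b (\<phi> j)\<bar>"]
      by (simp add: ca_def power2_sum)
    hence "lam j powr q * (ca j)\<^sup>2 \<le> lam j powr q * (2 * (L2_inner \<Omega> a (\<phi> j))\<^sup>2 + 2 * (L2_inner \<Omega> b (\<phi> j))\<^sup>2)"
      by (intro mult_left_mono) auto
    thus "norm (lam j powr q * (ca j)\<^sup>2) \<le>
       2 * (lam j powr q * (L2_inner \<Omega> a (\<phi> j))\<^sup>2) + 2 * (lam j powr q * (L2_inner \<Omega> b (\<phi> j))\<^sup>2)"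
      by (simp add: algebra_simps)
  qed
  \<comment> \<open>Either denominator may be discarded, being at least 1; interpolating with the
    other gives the two entries of the minimum.\<close>
  have rate: "l powr \<theta> / (1 + \<gamma> * l) / (1 + l * t powr \<alpha>) \<le> min (\<gamma> powr (- \<theta>)) (t powr (- \<alpha> * \<theta>))"
    if p: "l > 0" "\<gamma> > 0" "t > 0" "0 \<le> \<theta>" "\<theta> \<le> 1" for l \<gamma> t \<theta> :: real
  proof -
    have pp: "0 < \<gamma> * l" "0 < l * t powr \<alpha>" using p by auto
    have "l powr \<theta> / (1 + \<gamma> * l) / (1 + l * t powr \<alpha>) \<le> l powr \<theta> / (1 + \<gamma> * l) / 1"
      using pp by (intro divide_left_mono) auto
    also have "\<dots> \<le> \<gamma> powr (- \<theta>)" using powr_interpolate[of \<gamma> l \<theta>] p by simp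
    finally have 1: "l powr \<theta> / (1 + \<gamma> * l) / (1 + l * t powr \<alpha>) \<le> \<gamma> powr (- \<theta>)" .
    have "l powr \<theta> / (1 + \<gamma> * l) / (1 + l * t powr \<alpha>) = l powr \<theta> / (1 + t powr \<alpha> * l) / (1 + \<gamma> * l)"
      by (simp add: mult.commute)
    also have "\<dots> \<le> l powr \<theta> / (1 + t powr \<alpha> * l) / 1"
      using pp by (intro divide_left_mono) (auto simp: mult.commute)
    also have "\<dots> \<le> (t powr \<alpha>) powr (- \<theta>)" using powr_interpolate[of "t powr \<alpha>" l \<theta>] p by simp
    finally show ?thesis using 1 by (simp add: powr_powr)
  qed
  have rate0: "l powr \<theta> / (1 + \<gamma> * l) \<le> \<gamma> powr (- \<theta>)"
    if "l > 0" "\<gamma> > 0" "0 \<le> \<theta>" "\<theta> \<le> 1" for l \<gamma> \<theta> :: real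
    using powr_interpolate[of \<gamma> l \<theta>] that by simp
  have part1: "\<exists>c>0. \<forall>\<gamma> \<delta> g1 g2 v v1. adm \<gamma> \<delta> g1 g2 v v1 \<longrightarrow>
                 norm_L2 \<Omega> (\<lambda>x. v 0 x - u 0 x) + norm_L2 \<Omega> (\<lambda>x. v1 x - b x)
                   \<le> c * (\<gamma> powr (q / 2) + \<delta> * \<gamma> powr (-1)) \<and>
                 (\<forall>t\<in>{0<..T}.
                    norm_L2 \<Omega> (\<lambda>x. v t x - u t x)
                      \<le> c * (\<gamma> * min (\<gamma> powr (- (1 - q / 2))) (t powr (- \<alpha> * (1 - q / 2)))
                             + \<delta> * min (\<gamma> powr (-1)) (t powr (- \<alpha>))))"
    if q: "q \<in> {0..2}" and ab: "a \<in> Hdot \<Omega> lam \<phi> q" "b \<in> Hdot \<Omega> lam \<phi> q" for q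
  proof -
    \<comment> \<open>Writing \<lambda> = \<lambda>^\<theta> \<lambda>^(q/2) with \<theta> = 1 - q/2
      gives the second factor to the data, where the assumed regularity makes it square summable,
      and leaves the first to be interpolated.\<close>
    define h where "h = (\<lambda>j. lam j powr (q / 2) * ca j)"
    define H where "H = sqrt (\<Sum>j. (h j)\<^sup>2)"
    define \<theta> where "\<theta> = 1 - q / 2"
    have th: "0 \<le> \<theta>" "\<theta> \<le> 1" using q by (auto simp: \<theta>_def)
    have hsq: "(h j)\<^sup>2 = lam j powr q * (ca j)\<^sup>2" for j
      by (simp add: h_def power_mult_distrib power2_eq_square flip: powr_add)
    have sm: "summable (\<lambda>j. (h j)\<^sup>2)" unfolding hsq using ab by (intro sumsq) (auto simp: Hdot_def)
    have h0: "h j \<ge> 0" for j by (simp add: h_def ca0)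
    have H0: "H \<ge> 0" unfolding H_def using sm by (intro real_sqrt_ge_zero suminf_nonneg) auto
    have H: "(\<lambda>j. (h j)\<^sup>2) sums H\<^sup>2"
      unfolding H_def using sm by (simp add: suminf_nonneg summable_sums)
    have cah: "\<gamma> * ca j * (lam j / (1 + \<gamma> * lam j)) / w = \<gamma> * (lam j powr \<theta> / (1 + \<gamma> * lam j) / w) * h j" for \<gamma> j w
    proof -
      have "lam j powr \<theta> * lam j powr (q / 2) = lam j" using lp[of j] by (simp add: \<theta>_def flip: powr_add)
      thus ?thesis by (simp add: h_def mult_ac)
    qed
    \<comment> \<open>Half of \<open>c\<close> covers one norm, since X H + Y \<delta> \<le> (H + 1)
      (X + \<delta> Y); the estimate at t = 0 adds two norms.\<close>
    define c where "c = 6 * K * (H + 1)"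
    have c0: "c > 0" using K H0 by (simp add: c_def)
    have cb: "3 * (K * X * H + K * Y * \<delta>) \<le> c / 2 * (X + \<delta> * Y)" if "X \<ge> 0" "Y \<ge> 0" "\<delta> \<ge> 0" for X Y \<delta>
    proof -
      have "c / 2 * (X + \<delta> * Y) - 3 * (K * X * H + K * Y * \<delta>) = 3 * K * (X + H * (\<delta> * Y))"
        by (simp add: c_def algebra_simps)
      also have "\<dots> \<ge> 0" using that K H0 by simp
      finally show ?thesis by simp
    qed
    show ?thesis
    proof (intro exI conjI allI impI ballI)
      show "c > 0" by (rule c0)
    next
      fix \<gamma> \<delta> g1 g2 v v1
      assume A: "adm \<gamma> \<delta> g1 g2 v v1"
      hence g: "\<gamma> > 0" and d: "\<delta> \<ge> 0" using norm_L2_nonneg by (auto simp: adm_def)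
      have gq: "\<gamma> * \<gamma> powr (- \<theta>) = \<gamma> powr (q / 2)"
        using g powr_add[of \<gamma> 1 "- \<theta>"] by (simp add: \<theta>_def)
      have b: "3 * (K * \<gamma> powr (q / 2) * H + K * \<gamma> powr (-1) * \<delta>) \<le> c / 2 * (\<gamma> powr (q / 2) + \<delta> * \<gamma> powr (-1))"
        by (rule cb) (use d in auto)
      \<comment> \<open>Here \<open>0 powr \<alpha>\<close> is 0, so the damping denominator is 1
        and only the regularization contributes.\<close>
      have X: "\<gamma> * ca j * (lam j / (1 + \<gamma> * lam j)) / (1 + lam j * 0 powr \<alpha>) \<le> \<gamma> powr (q / 2) * h j" for j
      proof -
        have "\<gamma> * (lam j powr \<theta> / (1 + \<gamma> * lam j)) * h j \<le> \<gamma> * \<gamma> powr (- \<theta>) * h j"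
          using rate0[OF lp g th] g h0 by (intro mult_right_mono mult_left_mono) auto
        thus ?thesis unfolding cah gq by simp
      qed
      \<comment> \<open>Noise has no regularity, hence the exponent \<theta> = 1 in the
        interpolation.\<close>
      have Y: "lam j / (1 + \<gamma> * lam j) / (1 + lam j * 0 powr \<alpha>) \<le> \<gamma> powr (-1)" for j
        using rate0[OF lp g, of 1 j] lp[of j] by simp
      have "norm_L2 \<Omega> (\<lambda>x. v 0 x - u 0 x) \<le> 3 * (K * \<gamma> powr (q / 2) * H + K * \<gamma> powr (-1) * \<delta>)"
        by (rule est[OF A _ _ H H0 h0 _ X _ Y]) (use T in auto)
      moreover have "norm_L2 \<Omega> (\<lambda>x. v1 x - b x) \<le> 3 * (K * \<gamma> powr (q / 2) * H + K * \<gamma> powr (-1) * \<delta>)"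
        by (rule est1[OF A _ _ H H0 h0 _ X _ Y]) (use T in auto)
      ultimately show "norm_L2 \<Omega> (\<lambda>x. v 0 x - u 0 x) + norm_L2 \<Omega> (\<lambda>x. v1 x - b x)
                   \<le> c * (\<gamma> powr (q / 2) + \<delta> * \<gamma> powr (-1))"
        using b by simp
    next
      fix \<gamma> \<delta> g1 g2 v v1 t
      assume A: "adm \<gamma> \<delta> g1 g2 v v1" and "t \<in> {0<..T}"
      hence g: "\<gamma> > 0" and d: "\<delta> \<ge> 0" and t: "0 < t" "t \<le> T" using norm_L2_nonneg by (auto simp: adm_def)
      let ?m = "min (\<gamma> powr (- \<theta>)) (t powr (- \<alpha> * \<theta>))"
      let ?n = "min (\<gamma> powr (-1)) (t powr (- \<alpha>))"
      have X: "\<gamma> * ca j * (lam j / (1 + \<gamma> * lam j)) / (1 + lam j * t powr \<alpha>) \<le> (\<gamma> * ?m) * h j" for j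
        unfolding cah using rate[OF lp g t(1) th] g h0 by (intro mult_right_mono mult_left_mono) auto
      have Y: "lam j / (1 + \<gamma> * lam j) / (1 + lam j * t powr \<alpha>) \<le> ?n" for j
        using rate[OF lp g t(1), of 1 j] lp[of j] by simp
      have "norm_L2 \<Omega> (\<lambda>x. v t x - u t x) \<le> 3 * (K * (\<gamma> * ?m) * H + K * ?n * \<delta>)"
        by (rule est[OF A _ _ H H0 h0 _ X _ Y]) (use t g in auto)
      also have "\<dots> \<le> c / 2 * (\<gamma> * ?m + \<delta> * ?n)" by (rule cb) (use d g in auto)
      also have "\<dots> \<le> c * (\<gamma> * ?m + \<delta> * ?n)" using c0 d g by (intro mult_right_mono) auto
      finally show "norm_L2 \<Omega> (\<lambda>x. v t x - u t x)
                      \<le> c * (\<gamma> * min (\<gamma> powr (- (1 - q / 2))) (t powr (- \<alpha> * (1 - q / 2)))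
                             + \<delta> * min (\<gamma> powr (-1)) (t powr (- \<alpha>)))"
        unfolding \<theta>_def .
    qed
  qed
  have part2: "\<exists>\<eta>>0. \<forall>\<gamma> \<delta> g1 g2 v v1.
               \<gamma> < \<eta> \<and> \<delta> / \<gamma> < \<eta> \<and> adm \<gamma> \<delta> g1 g2 v v1 \<longrightarrow>
                 norm_L2 \<Omega> (\<lambda>x. v 0 x - u 0 x)
                   + norm_Hdot \<Omega> lam \<phi> (- s) (\<lambda>x. v1 x - b x) < \<epsilon>"
    if s: "s \<in> {0<..1}" and e: "\<epsilon> > 0" for s \<epsilon> :: real
  proof -
    have ab: "a \<in> L2_fun \<Omega>" "b \<in> L2_fun \<Omega>" using assms(16) by (simp_all add: dw_solution_def)
    have "summable (\<lambda>j. lam j powr 0 * (ca j)\<^sup>2)"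
      using dirichlet_eigensystem_parseval[OF es ab(1)] dirichlet_eigensystem_parseval[OF es ab(2)] lp
      by (intro sumsq) (simp_all add: sums_iff less_imp_neq[THEN not_sym])
    hence smc: "summable (\<lambda>j. (ca j)\<^sup>2)" using lp by (simp add: less_imp_neq[THEN not_sym])
    \<comment> \<open>For data merely in L2 the filter factor stays inside the weight, so X = 1 and
      the smallness sits in \<open>H \<gamma>\<close> itself.\<close>
    define h where "h = (\<lambda>\<gamma> j. \<gamma> * lam j / (1 + \<gamma> * lam j) * ca j)"
    define H where "H = (\<lambda>\<gamma>. sqrt (\<Sum>j. (h \<gamma> j)\<^sup>2))"
    have sm: "summable (\<lambda>j. (h \<gamma> j)\<^sup>2)" if "\<gamma> > 0" for \<gamma>
    proof (rule summable_comparison_test'[OF smc])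
      fix j :: nat
      have p: "0 < \<gamma> * lam j" using that lp[of j] by simp
      hence "\<gamma> * lam j / (1 + \<gamma> * lam j) * ca j \<le> 1 * ca j"
        using ca0[of j] by (intro mult_right_mono) (auto simp: divide_le_eq)
      hence "(h \<gamma> j)\<^sup>2 \<le> (ca j)\<^sup>2" unfolding h_def using p ca0[of j] by (intro power_mono) auto
      thus "norm ((h \<gamma> j)\<^sup>2) \<le> (ca j)\<^sup>2" by simp
    qed
    have "(H \<longlongrightarrow> sqrt 0) (at_right 0)"
      unfolding H_def h_def by (intro tendsto_intros filter_factor_tendsto_0[OF lp smc])
    \<comment> \<open>The summand 1 accounts for the displacement error, the square root for
      embedding L2 into the space of order -s.\<close>
    define S where "S = 3 * K * (1 + sqrt (lam 0 powr (- s)))"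
    have S: "S > 0" using K by (simp add: S_def add_pos_nonneg)
    define e1 where "e1 = \<epsilon> / (2 * S)"
    have e1: "e1 > 0" using S e by (simp add: e1_def)
    have "eventually (\<lambda>\<gamma>. H \<gamma> < e1) (at_right 0)"
      using \<open>(H \<longlongrightarrow> sqrt 0) (at_right 0)\<close> e1 by (intro order_tendstoD(2)[of _ "sqrt 0"]) auto
    then obtain \<eta>0 where eta0: "\<eta>0 > 0" "\<And>\<gamma>. 0 < \<gamma> \<Longrightarrow> \<gamma> < \<eta>0 \<Longrightarrow> H \<gamma> < e1"
      by (auto simp: eventually_at_right_field)
    show ?thesis
    \<comment> \<open>Below \<open>\<eta>0\<close> the approximation part \<open>H \<gamma>\<close>
      is less than \<open>e1\<close>, and the bound on \<delta> / \<gamma> makes the noise part less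
      than \<open>e1\<close>; since e1 = \<epsilon> / (2 S), the total is below \<epsilon>.\<close>
    proof (intro exI[of _ "min \<eta>0 e1"] conjI allI impI)
      show "min \<eta>0 e1 > 0" using eta0 e1 by simp
      fix \<gamma> \<delta> g1 g2 v v1
      assume asm: "\<gamma> < min \<eta>0 e1 \<and> \<delta> / \<gamma> < min \<eta>0 e1 \<and> adm \<gamma> \<delta> g1 g2 v v1"
      hence A: "adm \<gamma> \<delta> g1 g2 v v1" by blast
      hence g: "\<gamma> > 0" by (simp add: adm_def)
      have h0: "h \<gamma> j \<ge> 0" for j unfolding h_def using g lp[of j] ca0[of j] by simp
      have H0: "H \<gamma> \<ge> 0" unfolding H_def using sm[OF g] by (intro real_sqrt_ge_zero suminf_nonneg) auto
      have H: "(\<lambda>j. (h \<gamma> j)\<^sup>2) sums (H \<gamma>)\<^sup>2"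
        unfolding H_def using sm[OF g] by (simp add: suminf_nonneg summable_sums)
      have X: "\<gamma> * ca j * (lam j / (1 + \<gamma> * lam j)) / (1 + lam j * 0 powr \<alpha>) \<le> 1 * h \<gamma> j" for j
        by (simp add: h_def mult_ac)
      have Y: "lam j / (1 + \<gamma> * lam j) / (1 + lam j * 0 powr \<alpha>) \<le> \<gamma> powr (-1)" for j
        using rate0[OF lp g, of 1 j] lp[of j] by simp
      define W where "W = 3 * (K * 1 * H \<gamma> + K * \<gamma> powr (-1) * \<delta>)"
      have E0: "norm_L2 \<Omega> (\<lambda>x. v 0 x - u 0 x) \<le> W"
        unfolding W_def by (rule est[OF A _ _ H H0 h0 _ X _ Y]) (use T in auto)
      have E1: "norm_L2 \<Omega> (\<lambda>x. v1 x - b x) \<le> W"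
        unfolding W_def by (rule est1[OF A _ _ H H0 h0 _ X _ Y]) (use T in auto)
      have L: "(\<lambda>x. v1 x - b x) \<in> L2_fun \<Omega>"
        using A ab by (auto simp: adm_def dw_regularized_def dw_solution_def)
      have P: "(\<lambda>j. (L2_inner \<Omega> (\<lambda>x. v1 x - b x) (\<phi> j))\<^sup>2) sums (norm_L2 \<Omega> (\<lambda>x. v1 x - b x))\<^sup>2"
        by (rule dirichlet_eigensystem_parseval[OF es L])
      \<comment> \<open>With a negative exponent the weights decrease along the spectrum, so the
        first eigenvalue carries the largest one and the L2 estimate transfers.\<close>
      have "norm_Hdot \<Omega> lam \<phi> (- s) (\<lambda>x. v1 x - b x) \<le> sqrt (lam 0 powr (- s)) * norm_L2 \<Omega> (\<lambda>x. v1 x - b x)"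
      proof -
        let ?x = "\<lambda>j. (L2_inner \<Omega> (\<lambda>x. v1 x - b x) (\<phi> j))\<^sup>2"
        have le: "lam j powr (- s) * ?x j \<le> lam 0 powr (- s) * ?x j" for j
          using lj[of j] l0 s by (intro mult_right_mono powr_mono2') auto
        have R: "(\<lambda>j. lam 0 powr (- s) * ?x j) sums (lam 0 powr (- s) * (norm_L2 \<Omega> (\<lambda>x. v1 x - b x))\<^sup>2)"
          by (intro sums_mult P)
        have Q: "summable (\<lambda>j. lam j powr (- s) * ?x j)"
          by (rule summable_comparison_test'[OF sums_summable[OF R], of 0]) (use le in simp)
        have "(\<Sum>j. lam j powr (- s) * ?x j) \<le> lam 0 powr (- s) * (norm_L2 \<Omega> (\<lambda>x. v1 x - b x))\<^sup>2"
          by (rule sums_le[OF le summable_sums[OF Q] R])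
        hence "norm_Hdot \<Omega> lam \<phi> (- s) (\<lambda>x. v1 x - b x) \<le> sqrt (lam 0 powr (- s) * (norm_L2 \<Omega> (\<lambda>x. v1 x - b x))\<^sup>2)"
          unfolding norm_Hdot_def by (rule real_sqrt_le_mono)
        thus ?thesis by (simp add: real_sqrt_mult)
      qed
      also have "\<dots> \<le> sqrt (lam 0 powr (- s)) * W" using E1 by (intro mult_left_mono) auto
      finally have "norm_L2 \<Omega> (\<lambda>x. v 0 x - u 0 x) + norm_Hdot \<Omega> lam \<phi> (- s) (\<lambda>x. v1 x - b x)
          \<le> W + sqrt (lam 0 powr (- s)) * W" using E0 by simp
      also have "\<dots> = S * (H \<gamma> + \<delta> / \<gamma>)"
        using g by (simp add: W_def S_def powr_minus algebra_simps divide_inverse)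
      also have "\<dots> < S * (e1 + e1)"
        using asm eta0(2)[of \<gamma>] g S by (intro mult_strict_left_mono add_strict_mono) auto
      also have "\<dots> = \<epsilon>" using S by (simp add: e1_def)
      finally show "norm_L2 \<Omega> (\<lambda>x. v 0 x - u 0 x) + norm_Hdot \<Omega> lam \<phi> (- s) (\<lambda>x. v1 x - b x) < \<epsilon>" .
    qed
  qed
  show ?thesis
  proof (intro conjI ballI impI allI)
    fix q assume "q \<in> {0..2::real}" "a \<in> Hdot \<Omega> lam \<phi> q \<and> b \<in> Hdot \<Omega> lam \<phi> q"
    thus "\<exists>c>0. \<forall>\<gamma> \<delta> g1 g2 v v1.
               \<gamma> > 0 \<and> g1 \<in> L2_fun \<Omega> \<and> g2 \<in> L2_fun \<Omega> \<and>
               norm_L2 \<Omega> (\<lambda>x. u T1 x - g1 x) = \<delta> \<and> norm_L2 \<Omega> (\<lambda>x. u T2 x - g2 x) = \<delta> \<and>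
               dw_regularized \<Omega> lam \<phi> \<alpha> T T1 T2 \<gamma> g1 g2 v v1 \<longrightarrow>
                 norm_L2 \<Omega> (\<lambda>x. v 0 x - u 0 x) + norm_L2 \<Omega> (\<lambda>x. v1 x - b x)
                   \<le> c * (\<gamma> powr (q / 2) + \<delta> * \<gamma> powr (-1)) \<and>
                 (\<forall>t\<in>{0<..T}.
                    norm_L2 \<Omega> (\<lambda>x. v t x - u t x)
                      \<le> c * (\<gamma> * min (\<gamma> powr (- (1 - q / 2))) (t powr (- \<alpha> * (1 - q / 2)))
                             + \<delta> * min (\<gamma> powr (-1)) (t powr (- \<alpha>))))"
      using part1[of q] unfolding adm_def by blast
  next
    fix s \<epsilon> :: real assume "s \<in> {0<..1}" "\<epsilon> > 0"
    from part2[OF this] show "\<exists>\<eta>>0. \<forall>\<gamma> \<delta> g1 g2 v v1.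
               0 < \<gamma> \<and> \<gamma> < \<eta> \<and> \<delta> < \<eta> \<and> \<delta> / \<gamma> < \<eta> \<and>
               g1 \<in> L2_fun \<Omega> \<and> g2 \<in> L2_fun \<Omega> \<and>
               norm_L2 \<Omega> (\<lambda>x. u T1 x - g1 x) = \<delta> \<and> norm_L2 \<Omega> (\<lambda>x. u T2 x - g2 x) = \<delta> \<and>
               dw_regularized \<Omega> lam \<phi> \<alpha> T T1 T2 \<gamma> g1 g2 v v1 \<longrightarrow>
                 norm_L2 \<Omega> (\<lambda>x. v 0 x - u 0 x)
                   + norm_Hdot \<Omega> lam \<phi> (- s) (\<lambda>x. v1 x - b x) < \<epsilon>"
      unfolding adm_def by blast
  qed
qed

end
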